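(* The following two assertions are equivalent: (1) The control system $y_t(t)=Ay(t)+F(t)y(t)+B(t)u(t)$, $t\in(0,T]$, $y(0)=0$, with controls $u(\cdot)\in\mathcal U_p=L^p(0,T;U)$, is finite codimensional exactly controllable in $Y$ (at time $T$). (2) There exist a finite codimensional subspace $\widetilde Y$ of $Y'$ and a constant $C>0$ such that for every $\phi_T\in\widetilde Y$, the mild solution $\phi$ to $$\phi_t(t)=-A^*\phi(t)-F(t)^*\phi(t),\quad t\in(0,T),\qquad \phi(T)=\phi_T,$$ satisfies $$|\phi_T|_{Y'}\le C\,|B(\cdot)^*\phi|_{L^{p'}(0,T;U')}.$$
   Context: $T>0$; $Y$ and $U$ are reflexive (real) Banach spaces with dual spaces $Y'$, $U'$; $p\in(1,\infty]$; $p'=p/(p-1)$ if $p<\infty$ and $p'=1$ if $p=\infty$; $\mathcal U_p=L^p(0,T;U)$. $A:\mathcal D(A)\subseteq Y\to Y$ generates a $C_0$-semigroup on $Y$, $F(\cdot)\in L^\infty(0,T;\mathcal L(Y))$, $B(\cdot)\in L^\infty(0,T;\mathcal L(U;Y))$; $^*$ denotes adjoint operators. $A+F(\cdot)$ generates an evolution operator $\mathcal S(\cdot,\cdot)$ on $Y$, and the mild solution with $y(0)=0$ and control $u$ is $y(t)=\int_0^t\mathcal S(t,s)B(s)u(s)\,ds$. Finite codimensional subspace: a linear subspace $Y_0$ of a Banach space $Z$ is called finite codimensional (in $Z$) if there are $m\ge 0$ and linearly independent $z_1,\dots,z_m\in Z\setminus Y_0$ such that $Y_0$ and $z_1,\dots,z_m$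 together linearly span $Z$. Finite codimensional exact controllability: the system is finite codimensional exactly controllable at time $T$ if the reachable set $\mathcal R(T;0)=\{y(T): y \text{ is the mild solution with } y(0)=0 \text{ for some } u\in\mathcal U_p\}$ is a finite codimensional subspace of $Y$. *)

theory Defs
  imports "HOL-Analysis.Analysis"
begin

text \<open>The dual of a real normed space \<open>'a\<close> is the type \<open>'a \<Rightarrow>\<^sub>L real\<close> with the operator norm.\<close>

definition bidual_embedding ::
    "'a::real_normed_vector \<Rightarrow> (('a \<Rightarrow>\<^sub>L real) \<Rightarrow>\<^sub>L real)" where
  "bidual_embedding x = Blinfun (\<lambda>\<phi>. blinfun_apply \<phi> x)"

lemma bidual_embedding_apply [simp]:
  "blinfun_apply (bidual_embedding x) \<phi> = blinfun_apply \<phi> x"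
  unfolding bidual_embedding_def
  by (simp add: bounded_linear_Blinfun_apply blinfun.bounded_linear_left)

definition reflexive_space :: "'a::real_normed_vector itself \<Rightarrow> bool" where
  "reflexive_space _ \<longleftrightarrow>
     surj (bidual_embedding :: 'a \<Rightarrow> (('a \<Rightarrow>\<^sub>L real) \<Rightarrow>\<^sub>L real))"

definition adjoint_blinfun ::
    "('a::real_normed_vector \<Rightarrow>\<^sub>L 'b::real_normed_vector) \<Rightarrow>
     (('b \<Rightarrow>\<^sub>L real) \<Rightarrow>\<^sub>L ('a \<Rightarrow>\<^sub>L real))" where
  "adjoint_blinfun G = Blinfun (\<lambda>\<phi>. \<phi> o\<^sub>L G)"

lemma adjoint_blinfun_apply [simp]:
  "blinfun_apply (adjoint_blinfun G) \<phi> = \<phi> o\<^sub>L G"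
  unfolding adjoint_blinfun_def
  by (simp add: bounded_linear_Blinfun_apply bounded_bilinear.bounded_linear_left[OF bounded_bilinear_blinfun_compose])

text \<open>A (possibly unbounded) operator is given by its domain \<open>D\<close> and a function \<open>A\<close>, whose values
  outside \<open>D\<close> are irrelevant. The functional \<open>\<psi>\<close> below is unique when \<open>D\<close> is dense, in
  particular when \<open>A\<close> generates a strongly continuous semigroup.\<close>

definition adjoint_domain ::
    "'a::real_normed_vector set \<Rightarrow> ('a \<Rightarrow> 'a) \<Rightarrow> ('a \<Rightarrow>\<^sub>L real) set" where
  "adjoint_domain D A =
     {\<phi>. \<exists>\<psi> :: 'a \<Rightarrow>\<^sub>L real. \<forall>y\<in>D. blinfun_apply \<phi> (A y) = blinfun_apply \<psi> y}"

definition adjoint_op ::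
    "'a::real_normed_vector set \<Rightarrow> ('a \<Rightarrow> 'a) \<Rightarrow> ('a \<Rightarrow>\<^sub>L real) \<Rightarrow> ('a \<Rightarrow>\<^sub>L real)" where
  "adjoint_op D A \<phi> =
     (THE \<psi>. \<forall>y\<in>D. blinfun_apply \<phi> (A y) = blinfun_apply \<psi> y)"

definition finite_codim :: "'a::real_vector set \<Rightarrow> bool" where
  "finite_codim Y0 \<longleftrightarrow> subspace Y0 \<and>
     (\<exists>Z. finite Z \<and> independent Z \<and> Z \<inter> Y0 = {} \<and> span (Y0 \<union> Z) = UNIV)"

text \<open>The library's Bochner integral is restricted to second countable spaces. The following
  notions are the usual ones for an arbitrary Banach space; Borel measurability is replaced by
  strong measurability, and \<open>has_banach_integral\<close> otherwise repeats the definition of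
  \<open>has_bochner_integral\<close>.\<close>

definition strongly_measurable ::
    "'a measure \<Rightarrow> ('a \<Rightarrow> 'b::real_normed_vector) \<Rightarrow> bool" where
  "strongly_measurable M f \<longleftrightarrow>
     (\<exists>s :: nat \<Rightarrow> 'a \<Rightarrow> 'b. (\<forall>i. simple_function M (s i)) \<and>
        (AE x in M. (\<lambda>i. s i x) \<longlonglongrightarrow> f x))"

definition has_banach_integral ::
    "'a measure \<Rightarrow> ('a \<Rightarrow> 'b::real_normed_vector) \<Rightarrow> 'b \<Rightarrow> bool" where
  "has_banach_integral M f x \<longleftrightarrow> strongly_measurable M f \<and>
     (\<exists>s :: nat \<Rightarrow> 'a \<Rightarrow> 'b. (\<forall>i. Bochner_Integration.simple_bochner_integrable M (s i)) \<and>
        (\<lambda>i. \<integral>\<^sup>+x. ennreal (norm (f x - s i x)) \<partial>M) \<longlonglongrightarrow> 0 \<and>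
        (\<lambda>i. Bochner_Integration.simple_bochner_integral M (s i)) \<longlonglongrightarrow> x)"

text \<open>Elements are functions rather than classes modulo null sets.\<close>

definition Lp_space ::
    "ennreal \<Rightarrow> 'a measure \<Rightarrow> ('a \<Rightarrow> 'b::real_normed_vector) set" where
  "Lp_space p M = {f. strongly_measurable M f \<and>
     (if p = \<infinity> then \<exists>c::real. AE x in M. norm (f x) \<le> c
      else (\<integral>\<^sup>+x. ennreal (norm (f x) powr enn2real p) \<partial>M) < \<infinity>)}"

text \<open>Meaningful for elements of \<open>Lp_space p M\<close> only.\<close>

definition Lp_norm ::
    "ennreal \<Rightarrow> 'a measure \<Rightarrow> ('a \<Rightarrow> 'b::real_normed_vector) \<Rightarrow> real" where
  "Lp_norm p M f =
     (if p = \<infinity> then Inf {c. 0 \<le> c \<and> (AE x in M. norm (f x) \<le> c)}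
      else enn2real (\<integral>\<^sup>+x. ennreal (norm (f x) powr enn2real p) \<partial>M) powr (1 / enn2real p))"

definition conjugate_exponent :: "ennreal \<Rightarrow> ennreal" where
  "conjugate_exponent p = (if p = \<infinity> then 1 else p / (p - 1))"

definition C0_semigroup :: "(real \<Rightarrow> 'a::real_normed_vector \<Rightarrow>\<^sub>L 'a) \<Rightarrow> bool" where
  "C0_semigroup G \<longleftrightarrow> G 0 = id_blinfun \<and>
     (\<forall>s\<ge>0. \<forall>t\<ge>0. G (s + t) = G s o\<^sub>L G t) \<and>
     (\<forall>y. ((\<lambda>t. blinfun_apply (G t) y) \<longlongrightarrow> y) (at_right 0))"

definition generates_C0_semigroup ::
    "'a::real_normed_vector set \<Rightarrow> ('a \<Rightarrow> 'a) \<Rightarrow> (real \<Rightarrow> 'a \<Rightarrow>\<^sub>L 'a) \<Rightarrow> bool" where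
  "generates_C0_semigroup D A G \<longleftrightarrow> C0_semigroup G \<and>
     D = {y. \<exists>z. ((\<lambda>h. (blinfun_apply (G h) y - y) /\<^sub>R h) \<longlongrightarrow> z) (at_right 0)} \<and>
     (\<forall>y\<in>D. ((\<lambda>h. (blinfun_apply (G h) y - y) /\<^sub>R h) \<longlongrightarrow> A y) (at_right 0))"

text \<open>The evolution operator \<open>S t s\<close>, \<open>0 \<le> s \<le> t \<le> T\<close>, generated by \<open>A + F\<close>: with \<open>G\<close> the
  semigroup generated by \<open>A\<close>, \<open>S t s y\<close> is the mild solution at time \<open>t\<close> of
  \<open>y' = A y + F y\<close> with value \<open>y\<close> at time \<open>s\<close>.\<close>

definition generates_evolution_op ::
    "'a::real_normed_vector set \<Rightarrow> ('a \<Rightarrow> 'a) \<Rightarrow> (real \<Rightarrow> 'a \<Rightarrow>\<^sub>L 'a) \<Rightarrow> real \<Rightarrow>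
     (real \<Rightarrow> real \<Rightarrow> 'a \<Rightarrow>\<^sub>L 'a) \<Rightarrow> bool" where
  "generates_evolution_op D A F T S \<longleftrightarrow>
     (\<forall>s\<in>{0..T}. S s s = id_blinfun) \<and>
     (\<forall>s r t. 0 \<le> s \<and> s \<le> r \<and> r \<le> t \<and> t \<le> T \<longrightarrow> S t s = S t r o\<^sub>L S r s) \<and>
     (\<forall>y. continuous_on {(t, s). 0 \<le> s \<and> s \<le> t \<and> t \<le> T}
            (\<lambda>(t, s). blinfun_apply (S t s) y)) \<and>
     (\<exists>G. generates_C0_semigroup D A G \<and>
        (\<forall>s t y. 0 \<le> s \<and> s \<le> t \<and> t \<le> T \<longrightarrow>
           has_banach_integral (lebesgue_on {s..t})
             (\<lambda>r. blinfun_apply (G (t - r)) (blinfun_apply (F r) (blinfun_apply (S r s) y)))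
             (blinfun_apply (S t s) y - blinfun_apply (G (t - s)) y)))"

definition mild_control_solution ::
    "(real \<Rightarrow> real \<Rightarrow> 'y::real_normed_vector \<Rightarrow>\<^sub>L 'y) \<Rightarrow>
     (real \<Rightarrow> 'u::real_normed_vector \<Rightarrow>\<^sub>L 'y) \<Rightarrow> real \<Rightarrow>
     (real \<Rightarrow> 'u) \<Rightarrow> (real \<Rightarrow> 'y) \<Rightarrow> bool" where
  "mild_control_solution S B T u y \<longleftrightarrow>
     (\<forall>t\<in>{0..T}. has_banach_integral (lebesgue_on {0..t})
        (\<lambda>s. blinfun_apply (S t s) (blinfun_apply (B s) (u s))) (y t))"

definition reachable_set ::
    "(real \<Rightarrow> real \<Rightarrow> 'y::real_normed_vector \<Rightarrow>\<^sub>L 'y) \<Rightarrow>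
     (real \<Rightarrow> 'u::real_normed_vector \<Rightarrow>\<^sub>L 'y) \<Rightarrow> ennreal \<Rightarrow> real \<Rightarrow> 'y set" where
  "reachable_set S B p T =
     {y T | y u. u \<in> Lp_space p (lebesgue_on {0..T}) \<and> mild_control_solution S B T u y}"

definition finite_codim_exactly_controllable ::
    "(real \<Rightarrow> real \<Rightarrow> 'y::real_normed_vector \<Rightarrow>\<^sub>L 'y) \<Rightarrow>
     (real \<Rightarrow> 'u::real_normed_vector \<Rightarrow>\<^sub>L 'y) \<Rightarrow> ennreal \<Rightarrow> real \<Rightarrow> bool" where
  "finite_codim_exactly_controllable S B p T \<longleftrightarrow> finite_codim (reachable_set S B p T)"

text \<open>Mild solution on \<open>[0, T]\<close> of \<open>\<phi>' = - A \<phi> - F \<phi>\<close>, \<open>\<phi>(T) = \<phi>T\<close>: with \<open>G\<close> the semigroup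
  generated by \<open>A\<close>, \<open>\<phi>(t) = G(T - t) \<phi>T + \<integral>\<^sub>t\<^sup>T G(s - t) F(s) \<phi>(s) ds\<close>.\<close>

definition mild_backward_solution ::
    "'a::real_normed_vector set \<Rightarrow> ('a \<Rightarrow> 'a) \<Rightarrow> (real \<Rightarrow> 'a \<Rightarrow>\<^sub>L 'a) \<Rightarrow> real \<Rightarrow>
     'a \<Rightarrow> (real \<Rightarrow> 'a) \<Rightarrow> bool" where
  "mild_backward_solution D A F T \<phi>T \<phi> \<longleftrightarrow> continuous_on {0..T} \<phi> \<and>
     (\<exists>G. generates_C0_semigroup D A G \<and>
        (\<forall>t\<in>{0..T}. has_banach_integral (lebesgue_on {t..T})
           (\<lambda>s. blinfun_apply (G (s - t)) (blinfun_apply (F s) (\<phi> s)))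
           (\<phi> t - blinfun_apply (G (T - t)) \<phi>T)))"

end

theory Submission
  imports Defs
begin

text \<open>The reachable set is the range of \<open>L u = \<integral> S(T, s) B(s) u(s) ds\<close>, and the Duhamel formulas for
  \<open>S\<close> and for the backward solution \<open>\<phi>\<close> give \<open>\<phi>(t) = S(T, t)\<^sup>* \<phi>\<^sub>T\<close>. By Hoelder's inequality and a
  converse up to the factor 2, the observed quantity is therefore comparable with the seminorm
  \<open>M \<psi> = sup {\<bar>\<psi> (L u)\<bar> | \<parallel>u\<parallel> \<le> 1}\<close> on the dual space.

  If the range together with a finite set \<open>Z\<close> spans \<open>Y\<close>, Baire's theorem puts a ball into the closure of
  the image of some multiple of the unit ball; functionals that vanish on \<open>Z\<close> then satisfy the estimate.
  Conversely, by reflexivity the estimate on a subspace of finite codimension becomes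
  \<open>\<parallel>\<psi>\<parallel> \<le> C (M \<psi> + \<Sum>\<^sub>w \<bar>\<psi> w\<bar>)\<close> for all \<open>\<psi>\<close>, with finitely many vectors \<open>w\<close>. The Hahn-Banach theorem, applied to
  the seminorm \<open>inf {\<parallel>(u, a)\<parallel> + N \<parallel>y - L u - \<Sum>\<^sub>w a\<^sub>w w\<parallel>}\<close>, turns this into approximate solvability of
  \<open>y = L u + \<Sum>\<^sub>w a\<^sub>w w\<close>, and iteration gives exact solvability.\<close>

section \<open>The Hahn-Banach theorem and Baire category\<close>

text \<open>Controls are functions rather than classes, so there is no Banach space of controls to
  which the open mapping theorem could be applied. The image of the unit ball serves instead, as a
  mere convex symmetric set in the state space, and completeness of Lp enters as the summation of
  fast decaying series of controls.

  The obstacle on the dual side is that \<open>S T s\<close> is only strongly continuous in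
  \<open>s\<close>. The curve \<open>\<psi> o\<^sub>L S T s\<close> is then a priori only weak-star
  continuous, while the observed norm calls for strong measurability in the dual norm. Reflexivity
  makes the adjoint semigroup strongly continuous, so the backward equation has norm continuous
  solutions, and these are the curves in question.

  A subspace of finite codimension need not be closed. The estimate is therefore carried to the
  whole dual one vector at a time, according to whether the new vector lies in the closure of what
  is already covered.

  The factor 2 arises because norming vectors are chosen measurably in time and norm the functionals
  only approximately.\<close>

definition sublinear :: "('a::real_vector \<Rightarrow> real) \<Rightarrow> bool" where
  "sublinear p \<longleftrightarrow> (\<forall>x y. p (x + y) \<le> p x + p y) \<and> (\<forall>c x. 0 \<le> c \<longrightarrow> p (c *\<^sub>R x) = c * p x)"

lemma sublinear_add: "sublinear p \<Longrightarrow> p (x + y) \<le> p x + p y"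
  and sublinear_scale: "sublinear p \<Longrightarrow> 0 \<le> c \<Longrightarrow> p (c *\<^sub>R x) = c * p x"
  by (auto simp: sublinear_def)

lemma sublinear_zero: "sublinear p \<Longrightarrow> p 0 = 0"
  using sublinear_scale[of p 0 0] by simp

lemma sublinear_minus: "sublinear p \<Longrightarrow> - p (- x) \<le> p x"
  using sublinear_add[of p x "- x"] sublinear_zero[of p] by simp

text \<open>The inequality with the factor \<open>1 / c\<close>, applied to
  \<open>c *\<^sub>R x\<close>, is the reverse inequality, so one direction of homogeneity
  suffices.\<close>

lemma sublinearI:
  assumes add: "\<And>x y. p (x + y) \<le> p x + p y"
    and scale: "\<And>c x. 0 < c \<Longrightarrow> p (c *\<^sub>R x) \<le> c * p x" and zero: "p 0 = 0"
  shows "sublinear p"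
  unfolding sublinear_def
proof (intro conjI allI impI)
  fix c :: real and x assume c: "0 \<le> c"
  show "p (c *\<^sub>R x) = c * p x"
  proof (cases "c = 0")
    case False
    with c have c: "0 < c" by simp
    have "p ((1 / c) *\<^sub>R (c *\<^sub>R x)) \<le> (1 / c) * p (c *\<^sub>R x)"
      using c by (intro scale) simp
    then have "c * p x \<le> p (c *\<^sub>R x)"
      using c by (simp add: field_simps)
    with scale[OF c, of x] show ?thesis by simp
  qed (simp add: zero)
qed (rule add)

text \<open>Taking the infimum along the ray in direction \<open>y\<close> pushes the value at
  \<open>- y\<close> down to \<open>- p y\<close> without losing sublinearity. Hence a minimal
  sublinear functional is odd, and a linear functional below \<open>q\<close> must attain
  \<open>p y\<close> at \<open>y\<close>.\<close>

lemma sublinear_shrink: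
  fixes p :: "'a::real_vector \<Rightarrow> real"
  assumes p: "sublinear p"
  obtains q where "sublinear q" "\<And>x. q x \<le> p x" "q (- y) \<le> - p y"
proof -
  define g where "g x t = p (x + t *\<^sub>R y) - t * p y" for x t
  define q where "q x = (INF t\<in>{0..}. g x t)" for x
  \<comment> \<open>The bound does not depend on \<open>t\<close>, so the infimum along the ray is
    finite.\<close>
  have lower: "- p (- x) \<le> g x t" if "0 \<le> t" for x t
    using sublinear_add[OF p, of "x + t *\<^sub>R y" "- x"] sublinear_scale[OF p that, of y]
    by (simp add: g_def)
  have bdd: "bdd_below (g x ` {0..})" for x
    by (rule bdd_belowI2[of _ "- p (- x)"]) (use lower in auto)
  have le: "q x \<le> g x t" if "0 \<le> t" for x t
    unfolding q_def using that by (intro cINF_lower bdd) auto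
  have ge: "c \<le> q x" if "\<And>t. 0 \<le> t \<Longrightarrow> c \<le> g x t" for c x
    unfolding q_def using that by (intro cINF_greatest) auto
  have sub: "g (x + x') (s + t) \<le> g x s + g x' t" for x x' s t
    using sublinear_add[OF p, of "x + s *\<^sub>R y" "x' + t *\<^sub>R y"]
    by (simp add: g_def algebra_simps)
  have le_p: "q x \<le> p x" for x
    using le[of 0 x] by (simp add: g_def)
  show thesis
  proof (rule that[of q])
    show "sublinear q"
    proof (rule sublinearI)
      fix x x'
      have "q (x + x') - g x s \<le> q x'" if "0 \<le> s" for s
        by (rule ge) (use that le[of "s + _" "x + x'"] sub[of x x' s] in \<open>smt (verit)\<close>)
      then have "q (x + x') - q x' \<le> q x"
        by (intro ge) (simp add: algebra_simps)
      then show "q (x + x') \<le> q x + q x'" by simp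
    next
      fix c :: real and x assume c: "0 < c"
      have "q (c *\<^sub>R x) / c \<le> q x"
      proof (rule ge)
        fix t :: real assume t: "0 \<le> t"
        have "q (c *\<^sub>R x) \<le> g (c *\<^sub>R x) (c * t)" using c t by (intro le) simp
        also have "\<dots> = c * g x t"
          using sublinear_scale[OF p, of c "x + t *\<^sub>R y"] c by (simp add: g_def algebra_simps)
        finally show "q (c *\<^sub>R x) / c \<le> g x t" using c by (simp add: field_simps)
      qed
      then show "q (c *\<^sub>R x) \<le> c * q x" using c by (simp add: field_simps)
    next
      have "0 \<le> q 0"
        by (rule ge) (use lower[of _ 0] sublinear_zero[OF p] in simp)
      with le_p[of 0] show "q 0 = 0" by (simp add: sublinear_zero[OF p])
    qed
    show "q (- y) \<le> - p y"
      using le[of 1 "- y"] by (simp add: g_def sublinear_zero[OF p])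
  qed (rule le_p)
qed

lemma sublinear_minimal:
  fixes p0 :: "'a::real_vector \<Rightarrow> real"
  assumes p0: "sublinear p0"
  obtains p where "sublinear p" "p \<le> p0" "\<And>q. sublinear q \<Longrightarrow> q \<le> p \<Longrightarrow> q = p"
proof -
  define A where "A = {p. sublinear p \<and> p \<le> p0}"
  \<comment> \<open>The order is reversed, so that the maximal element delivered by Zorn's lemma is
    pointwise minimal.\<close>
  define P where "P p q \<longleftrightarrow> q \<le> p" for p q :: "'a \<Rightarrow> real"
  have "\<exists>m\<in>A. \<forall>a\<in>A. P m a \<longrightarrow> a = m"
  proof (rule predicate_Zorn)
    show "partial_order_on A (relation_of P A)"
      by (rule partial_order_on_relation_ofI) (auto simp: P_def)
    fix C assume C: "C \<in> Chains (relation_of P A)"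
    then have CA: "C \<subseteq> A" and chain: "\<And>p q. p \<in> C \<Longrightarrow> q \<in> C \<Longrightarrow> p \<le> q \<or> q \<le> p"
      by (auto simp: Chains_def relation_of_def P_def)
    show "\<exists>u\<in>A. \<forall>a\<in>C. P a u"
    proof (cases "C = {}")
      case True
      then show ?thesis using p0 by (auto simp: A_def)
    next
      case False
      have sl: "sublinear p" and leq: "p x \<le> p0 x" if "p \<in> C" for p x
        using CA that by (auto simp: A_def le_fun_def)
      have lower: "- p0 (- x) \<le> p x" if "p \<in> C" for p x
        using sublinear_minus[OF sl[OF that], of x] leq[OF that, of "- x"] by simp
      \<comment> \<open>The lower bound is the same for all members, so the pointwise infimum of the
        chain is finite.\<close>
      define r where "r x = (INF p\<in>C. p x)" for x
      have bdd: "bdd_below ((\<lambda>p. p x) ` C)" for x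
        by (rule bdd_belowI2[of _ "- p0 (- x)"]) (use lower in auto)
      have le: "r x \<le> p x" if "p \<in> C" for p x
        unfolding r_def using that by (intro cINF_lower bdd) auto
      have ge: "c \<le> r x" if "\<And>p. p \<in> C \<Longrightarrow> c \<le> p x" for c x
        unfolding r_def using that False by (intro cINF_greatest) auto
      obtain p1 where p1: "p1 \<in> C" using False by auto
      have "sublinear r"
      proof (rule sublinearI)
        fix x y
        \<comment> \<open>Two members of a chain are comparable, so both may be replaced by the
          smaller one before subadditivity is used.\<close>
        have "r (x + y) \<le> p x + q y" if "p \<in> C" "q \<in> C" for p q
          using chain[OF that]
        proof
          assume "p \<le> q"
          then show ?thesis
            using le[OF that(1), of "x + y"] sublinear_add[OF sl[OF that(1)], of x y]
            by (auto simp: le_fun_def intro: order_trans)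
        next
          assume "q \<le> p"
          then show ?thesis
            using le[OF that(2), of "x + y"] sublinear_add[OF sl[OF that(2)], of x y]
            by (smt (verit) le_fun_def)
        qed
        then have "r (x + y) - p x \<le> q y" if "p \<in> C" "q \<in> C" for p q
          using that by (simp add: algebra_simps)
        then have "r (x + y) - p x \<le> r y" if "p \<in> C" for p
          by (intro ge) (use that in auto)
        then have "r (x + y) - r y \<le> r x"
          by (intro ge) (simp add: algebra_simps)
        then show "r (x + y) \<le> r x + r y" by simp
      next
        fix c :: real and x assume c: "0 < c"
        have "r (c *\<^sub>R x) / c \<le> r x"
        proof (rule ge)
          fix p assume "p \<in> C"
          then show "r (c *\<^sub>R x) / c \<le> p x"
            using le[of p "c *\<^sub>R x"] sublinear_scale[OF sl, of p c x] c by (simp add: field_simps)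
        qed
        then show "r (c *\<^sub>R x) \<le> c * r x" using c by (simp add: field_simps)
      next
        have "r 0 \<le> 0" using le[OF p1, of 0] sublinear_zero[OF sl[OF p1]] by simp
        moreover have "0 \<le> r 0" by (rule ge) (simp add: sublinear_zero[OF sl])
        ultimately show "r 0 = 0" by simp
      qed
      moreover have "r \<le> p0" using le[OF p1] leq[OF p1] by (auto simp: le_fun_def intro: order_trans)
      ultimately show ?thesis using le by (auto simp: A_def P_def le_fun_def intro!: bexI[of _ r])
    qed
  qed
  then obtain m where "m \<in> A" "\<And>a. a \<in> A \<Longrightarrow> a \<le> m \<Longrightarrow> a = m" by (auto simp: P_def)
  then show thesis by (intro that[of m]) (auto simp: A_def intro: order_trans)
qed

text \<open>Minimality against the functional of \<open>sublinear_shrink\<close> makes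
  \<open>p\<close> odd. Subadditivity at two vectors and at their negatives then combines to
  additivity.\<close>

lemma sublinear_minimal_linear:
  fixes p :: "'a::real_vector \<Rightarrow> real"
  assumes p: "sublinear p" and min: "\<And>q. sublinear q \<Longrightarrow> q \<le> p \<Longrightarrow> q = p"
  shows "linear p"
proof -
  have neg: "p (- y) = - p y" for y
  proof -
    obtain q where "sublinear q" "\<And>x. q x \<le> p x" "q (- y) \<le> - p y"
      using sublinear_shrink[OF p] by metis
    with min[of q] have "p (- y) \<le> - p y" by (auto simp: le_fun_def)
    with sublinear_minus[OF p, of y] show ?thesis by simp
  qed
  show ?thesis
  proof (rule linearI)
    fix x y
    show "p (x + y) = p x + p y"
      using sublinear_add[OF p, of x y] sublinear_add[OF p, of "- x" "- y"] neg[of x] neg[of y]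
        neg[of "x + y"] by simp
  next
    fix c x
    show "p (c *\<^sub>R x) = c *\<^sub>R p x"
      using sublinear_scale[OF p, of c x] sublinear_scale[OF p, of "- c" x] neg[of "c *\<^sub>R x"]
      by (cases "0 \<le> c") auto
  qed
qed

text \<open>In place of an extension from the line through \<open>y\<close>, the prescribed value is
  built in by shrinking in direction \<open>y\<close> before a minimal functional is taken.\<close>

theorem hahn_banach_sublinear:
  fixes p :: "'a::real_vector \<Rightarrow> real"
  assumes p: "sublinear p"
  obtains f where "linear f" "\<And>x. f x \<le> p x" "f y = p y"
proof -
  obtain q where q: "sublinear q" "\<And>x. q x \<le> p x" "q (- y) \<le> - p y"
    using sublinear_shrink[OF p] by metis
  obtain f where f: "sublinear f" "f \<le> q" "\<And>g. sublinear g \<Longrightarrow> g \<le> f \<Longrightarrow> g = f"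
    using sublinear_minimal[OF q(1)] by metis
  have lin: "linear f" using f by (intro sublinear_minimal_linear)
  have fq: "f x \<le> q x" for x using f(2) by (auto simp: le_fun_def)
  have "f (- y) \<le> - p y" using fq[of "- y"] q(3) by simp
  then have "p y \<le> f y" using linear_neg[OF lin, of y] by simp
  moreover have le: "f x \<le> p x" for x using fq[of x] q(2)[of x] by simp
  ultimately show thesis by (intro that[of f]) (auto simp: lin intro: antisym)
qed

lemma abs_homogeneousI:
  fixes q :: "'a::real_vector \<Rightarrow> real"
  assumes le: "\<And>c x. q (c *\<^sub>R x) \<le> \<bar>c\<bar> * q x"
  shows "q (c *\<^sub>R x) = \<bar>c\<bar> * q x"
proof (cases "c = 0")
  case True
  then show ?thesis using le[of 0 0] le[of 2 0] by simp
next
  case False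
  have "q ((1 / c) *\<^sub>R c *\<^sub>R x) \<le> \<bar>1 / c\<bar> * q (c *\<^sub>R x)" by (rule le)
  then have "\<bar>c\<bar> * q x \<le> q (c *\<^sub>R x)" using False by (simp add: field_simps)
  with le[of c x] show ?thesis by simp
qed

corollary hahn_banach_seminorm:
  fixes q :: "'a::real_normed_vector \<Rightarrow> real"
  assumes add: "\<And>x y. q (x + y) \<le> q x + q y" and scale: "\<And>c x. q (c *\<^sub>R x) = \<bar>c\<bar> * q x"
    and bound: "\<And>x. q x \<le> N * norm x"
  obtains \<psi> :: "'a \<Rightarrow>\<^sub>L real" where "\<And>x. \<bar>\<psi> x\<bar> \<le> q x" "\<psi> y = q y"
proof -
  have "sublinear q" using add scale by (auto simp: sublinear_def)
  then obtain f where f: "linear f" "\<And>x. f x \<le> q x" "f y = q y"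
    using hahn_banach_sublinear by metis
  have neg: "q (- x) = q x" for x using scale[of "- 1" x] by simp
  have abs: "\<bar>f x\<bar> \<le> q x" for x
    using f(2)[of x] f(2)[of "- x"] linear_neg[OF f(1), of x] neg[of x] by simp
  have "bounded_linear f"
    by (rule bounded_linear_intro[where K=N])
      (use f(1) abs bound in \<open>auto simp: linear_add linear_scale mult.commute intro: order_trans\<close>)
  then have "blinfun_apply (Blinfun f) = f" by (rule bounded_linear_Blinfun_apply)
  with abs f(3) show thesis by (intro that[of "Blinfun f"]) auto
qed

corollary norming_functional:
  fixes y :: "'a::real_normed_vector"
  obtains \<psi> :: "'a \<Rightarrow>\<^sub>L real" where "norm \<psi> \<le> 1" "\<psi> y = norm y"
proof -
  obtain \<psi> :: "'a \<Rightarrow>\<^sub>L real" where "\<And>x. \<bar>\<psi> x\<bar> \<le> norm x" "\<psi> y = norm y"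
    by (rule hahn_banach_seminorm[of norm 1 y]) (auto simp: norm_triangle_ineq)
  then show thesis by (intro that[of \<psi>]) (auto intro!: norm_blinfun_bound)
qed

corollary functional_eqI:
  fixes x y :: "'a::real_normed_vector"
  assumes "\<And>\<psi> :: 'a \<Rightarrow>\<^sub>L real. \<psi> x = \<psi> y"
  shows "x = y"
proof -
  obtain \<psi> :: "'a \<Rightarrow>\<^sub>L real" where "\<psi> (x - y) = norm (x - y)"
    using norming_functional by metis
  then show ?thesis using assms[of \<psi>] by (simp add: blinfun.diff_right)
qed

text \<open>The dominating seminorm is the distance to \<open>V\<close>. It vanishes on
  \<open>V\<close> and is positive at \<open>e\<close>, and division by that distance normalises the
  functional.\<close>

corollary separating_functional:
  fixes V :: "'a::real_normed_vector set"
  assumes V: "subspace V" and e: "e \<notin> closure V"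
  obtains \<psi> :: "'a \<Rightarrow>\<^sub>L real" where "\<And>v. v \<in> V \<Longrightarrow> \<psi> v = 0" "\<psi> e = 1"
proof -
  define q where "q x = infdist x V" for x
  have ne: "V \<noteq> {}" using subspace_0[OF V] by auto
  have le: "q x \<le> norm (x - v)" if "v \<in> V" for x v
    using infdist_le[OF that, of x] by (simp add: q_def dist_norm)
  have approx: "\<exists>v\<in>V. norm (x - v) < q x + d" if "0 < d" for x d
  proof -
    have "(INF a\<in>V. dist x a) < q x + d"
      using that ne by (simp add: q_def infdist_def)
    then show ?thesis
      using ne by (subst (asm) cINF_less_iff) (auto simp: dist_norm intro: bdd_belowI2[of _ 0])
  qed
  have add: "q (x + y) \<le> q x + q y" for x y
  proof (rule field_le_epsilon)
    fix d :: real assume "0 < d"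
    then obtain v w where vw: "v \<in> V" "w \<in> V" "norm (x - v) < q x + d/2" "norm (y - w) < q y + d/2"
      using approx[of "d/2"] by (metis half_gt_zero)
    have "q (x + y) \<le> norm ((x + y) - (v + w))"
      using vw V by (intro le subspace_add)
    also have "\<dots> \<le> norm (x - v) + norm (y - w)"
      by (rule norm_diff_triangle_ineq)
    finally show "q (x + y) \<le> q x + q y + d" using vw by simp
  qed
  have zero: "q v = 0" if "v \<in> V" for v using that by (simp add: q_def)
  have scale1: "q (c *\<^sub>R x) \<le> \<bar>c\<bar> * q x" for c x
  proof (rule field_le_epsilon)
    fix d :: real assume d: "0 < d"
    \<comment> \<open>The summand 1 keeps the tolerance well defined for
      \<open>c = 0\<close>.\<close>
    obtain v where v: "v \<in> V" "norm (x - v) < q x + d / (\<bar>c\<bar> + 1)"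
      using approx[of "d / (\<bar>c\<bar> + 1)" x] d by (auto simp: divide_pos_pos)
    have "q (c *\<^sub>R x) \<le> norm (c *\<^sub>R x - c *\<^sub>R v)"
      using v V by (intro le subspace_scale)
    also have "\<dots> = \<bar>c\<bar> * norm (x - v)" by (metis norm_scaleR scaleR_diff_right)
    also have "\<dots> \<le> \<bar>c\<bar> * (q x + d / (\<bar>c\<bar> + 1))" using v by (intro mult_left_mono) auto
    also have "\<dots> = \<bar>c\<bar> * q x + \<bar>c\<bar> / (\<bar>c\<bar> + 1) * d" by (simp add: algebra_simps)
    also have "\<dots> \<le> \<bar>c\<bar> * q x + 1 * d"
      using d by (intro add_left_mono mult_right_mono) auto
    finally show "q (c *\<^sub>R x) \<le> \<bar>c\<bar> * q x + d" by simp
  qed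
  note scale = abs_homogeneousI[of q, OF scale1]
  obtain \<psi> :: "'a \<Rightarrow>\<^sub>L real" where \<psi>: "\<And>x. \<bar>\<psi> x\<bar> \<le> q x" "\<psi> e = q e"
    by (rule hahn_banach_seminorm[of q 1 e])
      (use add scale le[OF subspace_0[OF V]] in auto)
  have pos: "q e \<noteq> 0" using e ne in_closure_iff_infdist_zero[of V e] by (simp add: q_def)
  show thesis
  proof (rule that[of "(1 / q e) *\<^sub>R \<psi>"])
    show "((1 / q e) *\<^sub>R \<psi>) v = 0" if "v \<in> V" for v
      using \<psi>(1)[of v] zero[OF that] by (simp add: blinfun.scaleR_left)
    show "((1 / q e) *\<^sub>R \<psi>) e = 1" using \<psi>(2) pos by (simp add: blinfun.scaleR_left)
  qed
qed

section \<open>Consequences of Baire's theorem\<close>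

lemma baire_ball:
  fixes E :: "nat \<Rightarrow> 'a::banach set"
  assumes closed: "\<And>n. closed (E n)" and cover: "(\<Union>n. E n) = UNIV"
  obtains n x e where "0 < e" "ball x e \<subseteq> E n"
proof -
  have "\<exists>n. interior (E n) \<noteq> {}"
  proof (rule ccontr)
    assume "\<not> ?thesis"
    then have "euclidean interior_of \<Union>(range E) = {}"
      by (intro Baire_category_alt) (auto simp: closed completely_metrizable_space_euclidean)
    then show False using cover by simp
  qed
  then obtain n x where "x \<in> interior (E n)" by auto
  then show thesis using that by (auto simp: mem_interior)
qed

text \<open>Convexity and symmetry move a ball around an arbitrary point to the origin, because
  \<open>y\<close> is the midpoint of \<open>x + y\<close> and \<open>- (x - y)\<close>.\<close>

lemma baire_ball_zero:
  fixes E :: "nat \<Rightarrow> 'a::banach set"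
  assumes closed: "\<And>n. closed (E n)" and cover: "(\<Union>n. E n) = UNIV"
    and convex: "\<And>n. convex (E n)" and symmetric: "\<And>n x. x \<in> E n \<Longrightarrow> - x \<in> E n"
  obtains n e where "0 < e" "ball 0 e \<subseteq> E n"
proof -
  obtain n x e where e: "0 < e" "ball x e \<subseteq> E n"
    using baire_ball[OF closed cover] by metis
  have "y \<in> E n" if "y \<in> ball 0 e" for y
  proof -
    have "x + y \<in> E n" "x - y \<in> E n"
      using that e by (auto simp: dist_norm subset_eq)
    then have "(1/2) *\<^sub>R (x + y) + (1/2) *\<^sub>R (- (x - y)) \<in> E n"
      by (intro convexD[OF convex] symmetric) auto
    then show ?thesis by (simp add: algebra_simps flip: scaleR_add_left)
  qed
  with e(1) show thesis by (intro that) auto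
qed

theorem uniform_boundedness:
  fixes \<Phi> :: "'i \<Rightarrow> 'a::banach \<Rightarrow>\<^sub>L 'b::real_normed_vector"
  assumes bdd: "\<And>x. \<exists>K. \<forall>i\<in>I. norm (\<Phi> i x) \<le> K"
  obtains M where "0 < M" "\<And>i. i \<in> I \<Longrightarrow> norm (\<Phi> i) \<le> M"
proof -
  define E where "E n = {x. \<forall>i\<in>I. norm (\<Phi> i x) \<le> real n}" for n
  have "closed (E n)" for n
    unfolding E_def Collect_ball_eq
    by (intro closed_INT ballI closed_Collect_le continuous_intros)
  moreover have "x \<in> (\<Union>n. E n)" for x
  proof -
    obtain K where "\<forall>i\<in>I. norm (\<Phi> i x) \<le> K" using bdd by blast
    moreover obtain n where "K \<le> real n" using real_arch_simple by blast
    ultimately have "x \<in> E n" by (auto simp: E_def intro: order_trans)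
    then show ?thesis by blast
  qed
  moreover have "convex (E n)" for n
  proof (rule convexI)
    fix x y and u v :: real assume *: "x \<in> E n" "y \<in> E n" "0 \<le> u" "0 \<le> v" "u + v = 1"
    have "norm (\<Phi> i (u *\<^sub>R x + v *\<^sub>R y)) \<le> real n" if "i \<in> I" for i
    proof -
      have "norm (\<Phi> i (u *\<^sub>R x + v *\<^sub>R y)) \<le> u * norm (\<Phi> i x) + v * norm (\<Phi> i y)"
        using norm_triangle_ineq[of "u *\<^sub>R \<Phi> i x" "v *\<^sub>R \<Phi> i y"] *
        by (simp add: blinfun.add_right blinfun.scaleR_right)
      also have "\<dots> \<le> u * real n + v * real n"
        using * that by (intro add_mono mult_left_mono) (auto simp: E_def)
      finally show ?thesis using * by (simp flip: distrib_right)
    qed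
    then show "u *\<^sub>R x + v *\<^sub>R y \<in> E n" by (simp add: E_def)
  qed
  moreover have "- x \<in> E n" if "x \<in> E n" for x n
    using that by (simp add: E_def blinfun.minus_right)
  ultimately obtain n e where e: "0 < e" "ball 0 e \<subseteq> E n"
    using baire_ball_zero[of E] by (metis UNIV_eq_I)
  have "norm (\<Phi> i) \<le> 2 * real n / e" if i: "i \<in> I" for i
  proof (rule norm_blinfun_bound)
    fix x
    show "norm (\<Phi> i x) \<le> 2 * real n / e * norm x"
    proof (cases "x = 0")
      case False
      \<comment> \<open>Scaling to half the radius puts the vector strictly inside the open ball;
        this is the factor 2 in the bound.\<close>
      define c where "c = e / (2 * norm x)"
      have "c *\<^sub>R x \<in> ball 0 e" using False e by (simp add: c_def)
      then have "c *\<^sub>R x \<in> E n" using e by blast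
      then have "norm (\<Phi> i (c *\<^sub>R x)) \<le> real n" using i by (simp add: E_def)
      then show ?thesis using False e by (simp add: c_def blinfun.scaleR_right field_simps)
    qed simp
  qed (use e in simp)
  moreover have "0 \<le> 2 * real n / e" using e by simp
  ultimately show thesis by (intro that[of "2 * real n / e + 1"]) force+
qed

section \<open>Solvability from bounds on functionals\<close>

lemma approx_by_convex:
  fixes K :: "'a::real_normed_vector set"
  assumes K: "convex K" "\<And>x. x \<in> K \<Longrightarrow> - x \<in> K" "K \<noteq> {}" and C: "0 \<le> C"
    and dual: "\<And>\<psi> :: 'a \<Rightarrow>\<^sub>L real. (\<And>x. x \<in> K \<Longrightarrow> blinfun_apply \<psi> x \<le> 1) \<Longrightarrow> norm \<psi> \<le> C"
  shows "\<exists>a x. 0 \<le> a \<and> a \<le> (C + 1) * norm y \<and> x \<in> K \<and> norm (y - a *\<^sub>R x) \<le> norm y / 4"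
proof (cases "y = 0")
  case True
  with K show ?thesis by auto
next
  case False
  \<comment> \<open>The weight of the residual. A near minimiser has \<open>N\<close> times its
    residual below \<open>(C + 1) * norm y\<close>, so this value makes the residual at most a
    quarter of \<open>norm y\<close>.\<close>
  define N where "N = 4 * (C + 1)"
  have N: "0 < N" using C by (simp add: N_def)
  define q where "q y = (INF (a, x)\<in>{0..} \<times> K. a + N * norm (y - a *\<^sub>R x))" for y
  have bdd: "bdd_below ((\<lambda>(a, x). a + N * norm (y - a *\<^sub>R x)) ` ({0..} \<times> K))" for y
    by (rule bdd_belowI2[of _ 0]) (use N in auto)
  have le: "q y \<le> a + N * norm (y - a *\<^sub>R x)" if "0 \<le> a" "x \<in> K" for y a x
    unfolding q_def using that by (intro cINF_lower2[OF bdd, of "(a, x)"]) auto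
  have ge: "c \<le> q y" if "\<And>a x. 0 \<le> a \<Longrightarrow> x \<in> K \<Longrightarrow> c \<le> a + N * norm (y - a *\<^sub>R x)" for c y
    unfolding q_def using that K(3) by (intro cINF_greatest) auto
  have add: "q (y + z) \<le> q y + q z" for y z
  proof -
    have *: "q (y + z) \<le> (a + N * norm (y - a *\<^sub>R x)) + (b + N * norm (z - b *\<^sub>R w))"
      if "0 \<le> a" "x \<in> K" "0 \<le> b" "w \<in> K" for a x b w
    proof -
      \<comment> \<open>Convexity merges two scaled elements of \<open>K\<close> into one; when both
        factors vanish, any element serves.\<close>
      obtain v where v: "v \<in> K" "(a + b) *\<^sub>R v = a *\<^sub>R x + b *\<^sub>R w"
      proof (cases "a + b = 0")
        case True
        with \<open>0 \<le> a\<close> \<open>0 \<le> b\<close> have "a = 0" "b = 0" by auto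
        with \<open>x \<in> K\<close> show ?thesis by (intro that[of x]) auto
      next
        case False
        with \<open>0 \<le> a\<close> \<open>0 \<le> b\<close> have "(a / (a + b)) *\<^sub>R x + (b / (a + b)) *\<^sub>R w \<in> K"
          by (intro convexD K \<open>x \<in> K\<close> \<open>w \<in> K\<close>) (auto simp flip: add_divide_distrib)
        with False show ?thesis by (intro that) (auto simp: scaleR_add_right)
      qed
      have "q (y + z) \<le> (a + b) + N * norm ((y + z) - (a + b) *\<^sub>R v)"
        using v(1) that by (intro le) auto
      also have "norm ((y + z) - (a + b) *\<^sub>R v) \<le> norm (y - a *\<^sub>R x) + norm (z - b *\<^sub>R w)"
        unfolding v(2) by (rule norm_diff_triangle_ineq)
      finally show ?thesis using N by (simp add: algebra_simps)
    qed
    have "q (y + z) - (a + N * norm (y - a *\<^sub>R x)) \<le> q z" if "0 \<le> a" "x \<in> K" for a x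
      by (rule ge) (use *[OF that] in \<open>simp add: algebra_simps\<close>)
    then have "q (y + z) - q z \<le> q y"
      by (intro ge) (simp add: algebra_simps)
    then show ?thesis by simp
  qed
  have "q (c *\<^sub>R y) \<le> \<bar>c\<bar> * q y" for c y
  proof (cases "c = 0")
    case True
    obtain x where "x \<in> K" using K(3) by auto
    with le[of 0 x 0] True show ?thesis by simp
  next
    case False
    have "q (c *\<^sub>R y) / \<bar>c\<bar> \<le> q y"
    proof (rule ge)
      fix a x assume ax: "(0::real) \<le> a" "x \<in> K"
      \<comment> \<open>Symmetry moves the sign of \<open>c\<close> into \<open>K\<close>, so that
        the scalar factor stays nonnegative.\<close>
      have sx: "sgn c *\<^sub>R x \<in> K" using K(2)[of x] ax False by (auto simp: sgn_if)
      have "c *\<^sub>R y - (\<bar>c\<bar> * a) *\<^sub>R (sgn c *\<^sub>R x) = c *\<^sub>R (y - a *\<^sub>R x)"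
        by (simp add: sgn_if scaleR_diff_right)
      then have "norm (c *\<^sub>R y - (\<bar>c\<bar> * a) *\<^sub>R (sgn c *\<^sub>R x)) = \<bar>c\<bar> * norm (y - a *\<^sub>R x)"
        by simp
      moreover have "q (c *\<^sub>R y) \<le> \<bar>c\<bar> * a + N * norm (c *\<^sub>R y - (\<bar>c\<bar> * a) *\<^sub>R (sgn c *\<^sub>R x))"
        using ax sx by (intro le) auto
      ultimately have "q (c *\<^sub>R y) \<le> \<bar>c\<bar> * (a + N * norm (y - a *\<^sub>R x))"
        by (simp add: algebra_simps)
      then show "q (c *\<^sub>R y) / \<bar>c\<bar> \<le> a + N * norm (y - a *\<^sub>R x)"
        using False by (simp add: field_simps)
    qed
    then show ?thesis using False by (simp add: field_simps)
  qed
  note scale = abs_homogeneousI[of q, OF this]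
  have bound: "q y \<le> N * norm y" for y
    using K(3) le[of 0 _ y] by auto
  obtain \<psi> :: "'a \<Rightarrow>\<^sub>L real" where \<psi>: "\<And>x. \<bar>\<psi> x\<bar> \<le> q x" "\<psi> y = q y"
    using hahn_banach_seminorm[OF add scale bound, of y] by metis
  \<comment> \<open>Representing \<open>x\<close> by itself with \<open>a = 1\<close> leaves no
    residual, hence \<open>q x \<le> 1\<close> on \<open>K\<close> and the dual bound applies to
    \<psi>.\<close>
  have "\<psi> x \<le> 1" if "x \<in> K" for x
    using \<psi>(1)[of x] le[of 1 x x] that by simp
  then have "norm \<psi> \<le> C" by (rule dual)
  then have "q y \<le> C * norm y"
    using norm_blinfun[of \<psi> y] \<psi>(2) mult_right_mono[of "norm \<psi>" C "norm y"] by simp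
  \<comment> \<open>Strictness, gained by passing from \<open>C\<close> to \<open>C + 1\<close> for
    nonzero \<open>y\<close>, produces a pair below the bound although the infimum may not be
    attained.\<close>
  also have "\<dots> < (C + 1) * norm y" using False by (simp add: algebra_simps)
  finally obtain a x where ax: "0 \<le> a" "x \<in> K" "a + N * norm (y - a *\<^sub>R x) < (C + 1) * norm y"
    unfolding q_def using K(3) bdd[of y] by (subst (asm) cINF_less_iff) auto
  have "a \<le> (C + 1) * norm y" using ax N mult_nonneg_nonneg[OF less_imp_le[OF N] norm_ge_zero[of "y - a *\<^sub>R x"]] by linarith
  moreover have "N * norm (y - a *\<^sub>R x) \<le> N * (norm y / 4)"
  proof -
    have "N * (norm y / 4) = (C + 1) * norm y" by (simp add: N_def)
    with ax show ?thesis by linarith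
  qed
  ultimately show ?thesis using ax N by (intro exI[of _ a] exI[of _ x]) auto
qed

text \<open>Each residual is approximated again. It shrinks by the factor 1/4 and bounds the next
  coefficient, which yields the geometric rate on which the summation of controls relies.\<close>

lemma series_by_convex:
  fixes K :: "'a::real_normed_vector set"
  assumes K: "convex K" "\<And>x. x \<in> K \<Longrightarrow> - x \<in> K" "K \<noteq> {}" and C: "0 \<le> C"
    and dual: "\<And>\<psi> :: 'a \<Rightarrow>\<^sub>L real. (\<And>x. x \<in> K \<Longrightarrow> blinfun_apply \<psi> x \<le> 1) \<Longrightarrow> norm \<psi> \<le> C"
  obtains a x where "\<And>k::nat. 0 \<le> a k" "\<And>k. a k \<le> (C + 1) * norm y * (1/4) ^ k" "\<And>k. x k \<in> K"
    "(\<lambda>k. a k *\<^sub>R x k) sums y"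
proof -
  have "\<forall>y. \<exists>a x. 0 \<le> a \<and> a \<le> (C + 1) * norm y \<and> x \<in> K \<and> norm (y - a *\<^sub>R x) \<le> norm y / 4"
    using approx_by_convex[OF K C dual] by blast
  then obtain \<alpha> \<xi> where *: "\<And>y. 0 \<le> \<alpha> y" "\<And>y. \<alpha> y \<le> (C + 1) * norm y" "\<And>y. \<xi> y \<in> K"
    "\<And>y. norm (y - \<alpha> y *\<^sub>R \<xi> y) \<le> norm y / 4" by metis
  define r where "r = rec_nat y (\<lambda>_ r. r - \<alpha> r *\<^sub>R \<xi> r)"
  have r: "r 0 = y" "r (Suc k) = r k - \<alpha> (r k) *\<^sub>R \<xi> (r k)" for k by (simp_all add: r_def)
  have norm_r: "norm (r k) \<le> norm y * (1/4) ^ k" for k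
  proof (induction k)
    case (Suc k)
    then show ?case using *(4)[of "r k"] by (simp add: r)
  qed (simp add: r)
  have "(\<Sum>k<n. \<alpha> (r k) *\<^sub>R \<xi> (r k)) = y - r n" for n
    by (induction n) (simp_all add: r)
  moreover have "r \<longlonglongrightarrow> 0"
  proof (rule tendsto_norm_zero_cancel, rule tendsto_sandwich[OF _ _ tendsto_const])
    show "(\<lambda>k. norm y * (1/4) ^ k) \<longlonglongrightarrow> 0"
      by (intro tendsto_mult_right_zero LIMSEQ_power_zero) auto
  qed (use norm_r in auto)
  then have "(\<lambda>n. y - r n) \<longlonglongrightarrow> y" using tendsto_diff[OF tendsto_const[of y]] by fastforce
  ultimately have "(\<lambda>k. \<alpha> (r k) *\<^sub>R \<xi> (r k)) sums y" by (simp add: sums_def)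
  moreover have "\<alpha> (r k) \<le> (C + 1) * norm y * (1/4) ^ k" for k
  proof -
    have "\<alpha> (r k) \<le> (C + 1) * norm (r k)" by (rule *)
    also have "\<dots> \<le> (C + 1) * (norm y * (1/4) ^ k)" using C norm_r by (intro mult_left_mono) auto
    finally show ?thesis by (simp add: mult.assoc)
  qed
  ultimately show thesis using * by (intro that[of "\<lambda>k. \<alpha> (r k)" "\<lambda>k. \<xi> (r k)"])
qed

section \<open>Finite codimension and estimates on the dual\<close>

lemma finite_codimI:
  assumes R: "subspace R" and W: "finite W" "span (R \<union> W) = UNIV"
  shows "finite_codim R"
proof -
  \<comment> \<open>A spanning complement of least cardinality contains no redundant vector, which
    gives both independence and disjointness from \<open>R\<close>.\<close>
  obtain Z where Z: "finite Z" "span (R \<union> Z) = UNIV"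
    and min: "\<And>Z'. finite Z' \<Longrightarrow> span (R \<union> Z') = UNIV \<Longrightarrow> card Z \<le> card Z'"
    using W ex_has_least_nat[of "\<lambda>Z. finite Z \<and> span (R \<union> Z) = UNIV" W card] by auto
  have out: "z \<notin> span (R \<union> (Z - {z}))" if "z \<in> Z" for z
  proof
    assume "z \<in> span (R \<union> (Z - {z}))"
    then have "span (insert z (R \<union> (Z - {z}))) = span (R \<union> (Z - {z}))" by (rule span_redundant)
    moreover have "insert z (R \<union> (Z - {z})) = R \<union> Z" using that by auto
    ultimately have "card Z \<le> card (Z - {z})" using Z by (intro min) auto
    then show False using that Z card_Diff1_less[of Z z] by simp
  qed
  have "independent Z"
  proof (unfold dependent_def, clarify)
    fix z assume "z \<in> Z" "z \<in> span (Z - {z})"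
    with out[of z] span_mono[of "Z - {z}" "R \<union> (Z - {z})"] show False by auto
  qed
  moreover have "Z \<inter> R = {}"
    using out by (auto intro: span_base)
  ultimately show ?thesis using R Z by (auto simp: finite_codim_def)
qed

lemma finite_codim_annihilator:
  fixes Z :: "'a::real_normed_vector set"
  assumes "finite Z"
  shows "finite_codim {\<psi> :: 'a \<Rightarrow>\<^sub>L real. \<forall>z\<in>Z. \<psi> z = 0}"
proof -
  have sub: "subspace {\<psi> :: 'a \<Rightarrow>\<^sub>L real. \<forall>z\<in>Z. \<psi> z = 0}" for Z
    by (rule subspaceI) (auto simp: blinfun.add_left blinfun.scaleR_left)
  have "\<exists>W. finite W \<and> span ({\<psi> :: 'a \<Rightarrow>\<^sub>L real. \<forall>z\<in>Z. \<psi> z = 0} \<union> W) = UNIV"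
    using assms
  proof induction
    case empty
    show ?case by (intro exI[of _ "{}"]) simp
  next
    case (insert z Z)
    let ?A = "{\<psi> :: 'a \<Rightarrow>\<^sub>L real. \<forall>z\<in>Z. \<psi> z = 0}"
    let ?B = "{\<psi> :: 'a \<Rightarrow>\<^sub>L real. \<forall>y\<in>insert z Z. \<psi> y = 0}"
    obtain W where W: "finite W" "span (?A \<union> W) = UNIV" using insert.IH by blast
    \<comment> \<open>A further condition costs at most one spanning vector: a functional that kills
      \<open>Z\<close> and has value 1 at \<open>z\<close> if there is one, and otherwise 0, since
      the condition then follows from the others.\<close>
    obtain e where e: "e \<in> ?A" "\<And>\<psi>. \<psi> \<in> ?A \<Longrightarrow> \<psi> - (\<psi> z) *\<^sub>R e \<in> ?B"
    proof (cases "\<exists>\<phi>\<in>?A. \<phi> z \<noteq> 0")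
      case True
      then obtain \<phi> where \<phi>: "\<phi> \<in> ?A" "\<phi> z \<noteq> 0" by auto
      then show ?thesis
        by (intro that[of "(1 / \<phi> z) *\<^sub>R \<phi>"]) (auto simp: blinfun.scaleR_left blinfun.diff_left)
    next
      case False
      then show ?thesis by (intro that[of 0]) (auto simp: blinfun.diff_left)
    qed
    have "\<psi> \<in> span (?B \<union> insert e W)" if "\<psi> \<in> ?A" for \<psi>
    proof -
      have "(\<psi> - (\<psi> z) *\<^sub>R e) + (\<psi> z) *\<^sub>R e \<in> span (?B \<union> insert e W)"
        using e(2)[OF that] by (intro span_add span_scale) (auto intro: span_base)
      then show ?thesis by simp
    qed
    then have "?A \<union> W \<subseteq> span (?B \<union> insert e W)" by (auto intro: span_base)
    then have "span (?A \<union> W) \<subseteq> span (?B \<union> insert e W)" by (rule span_minimal) simp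
    with W show ?case by (intro exI[of _ "insert e W"]) auto
  qed
  with sub show ?thesis using finite_codimI by blast
qed

text \<open>The spanning vectors join \<open>V\<close> one at a time. A new vector in the closure of
  the span reached so far costs nothing, because the estimate passes to the closure by continuity of
  \<open>M\<close>. Otherwise a functional separates it; reflexivity represents this functional by a
  point \<open>w\<close>, and \<bar>\<psi> w\<bar> is the new coordinate.\<close>

lemma finite_codim_dual_estimate:
  fixes M :: "('a::real_normed_vector \<Rightarrow>\<^sub>L real) \<Rightarrow> real" and V Z :: "('a \<Rightarrow>\<^sub>L real) set"
  assumes refl: "reflexive_space TYPE('a)"
    and add: "\<And>\<psi> \<eta>. M (\<psi> + \<eta>) \<le> M \<psi> + M \<eta>" and scale: "\<And>c \<psi>. M (c *\<^sub>R \<psi>) = \<bar>c\<bar> * M \<psi>"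
    and cont: "continuous_on UNIV M"
    and Z: "finite Z" and est: "\<And>\<psi>. \<psi> \<in> V \<Longrightarrow> norm \<psi> \<le> C * M \<psi>" and V: "subspace V"
  shows "\<exists>W C'. finite W \<and> 0 \<le> C' \<and> (\<forall>\<psi>::'a \<Rightarrow>\<^sub>L real. \<psi> \<in> span (V \<union> Z) \<longrightarrow> norm \<psi> \<le> C' * (M \<psi> + (\<Sum>w\<in>W. \<bar>\<psi> w\<bar>)))"
proof -
  have M0: "0 \<le> M \<psi>" for \<psi> using add[of \<psi> "(-1) *\<^sub>R \<psi>"] scale[of "-1" \<psi>] scale[of 0 0] by simp
  show ?thesis using Z
  proof induction
    case empty
    have "norm \<psi> \<le> max 0 C * M \<psi>" if "\<psi> \<in> V" for \<psi>
      using est[OF that] M0[of \<psi>] by (smt (verit) mult_right_mono)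
    then show ?case using V by (intro exI[of _ "{}"] exI[of _ "max 0 C"]) (simp add: span_eq_iff[THEN iffD2])
  next
    case (insert e Z)
    let ?V = "span (V \<union> Z)"
    define N where "N W \<psi> = M \<psi> + (\<Sum>w\<in>W. \<bar>\<psi> w\<bar>)" for W and \<psi> :: "'a \<Rightarrow>\<^sub>L real"
    obtain W C where W: "finite W" and C: "0 \<le> C" and est: "\<And>\<psi>. \<psi> \<in> ?V \<Longrightarrow> norm \<psi> \<le> C * N W \<psi>"
      using insert.IH unfolding N_def by blast
    have N_add: "N W (\<psi> + \<eta>) \<le> N W \<psi> + N W \<eta>" for W \<psi> \<eta>
    proof -
      have "(\<Sum>w\<in>W. \<bar>(\<psi> + \<eta>) w\<bar>) \<le> (\<Sum>w\<in>W. \<bar>\<psi> w\<bar>) + (\<Sum>w\<in>W. \<bar>\<eta> w\<bar>)"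
        unfolding sum.distrib[symmetric] by (intro sum_mono) (simp add: blinfun.add_left)
      with add[of \<psi> \<eta>] show ?thesis by (simp add: N_def)
    qed
    have N_scale: "N W (c *\<^sub>R \<psi>) = \<bar>c\<bar> * N W \<psi>" for W c \<psi>
      by (simp add: N_def scale blinfun.scaleR_left abs_mult distrib_left sum_distrib_left)
    have N0: "0 \<le> N W \<psi>" for W \<psi> using M0 by (simp add: N_def sum_nonneg)
    have split: "\<exists>v c. v \<in> ?V \<and> \<psi> = v + c *\<^sub>R e" if \<psi>: "\<psi> \<in> span (V \<union> insert e Z)" for \<psi>
    proof -
      from \<psi> have "\<psi> \<in> span (insert e (V \<union> Z))" by simp
      then obtain c where "\<psi> - c *\<^sub>R e \<in> ?V" by (auto simp: span_breakdown_eq)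
      then show ?thesis by (intro exI[of _ "\<psi> - c *\<^sub>R e"] exI[of _ c]) simp
    qed
    show ?case
    proof (cases "e \<in> closure ?V")
      case True
      have "closed {\<psi>. norm \<psi> \<le> C * N W \<psi>}"
        unfolding N_def by (intro closed_Collect_le continuous_intros cont)
      moreover have "?V \<subseteq> {\<psi>. norm \<psi> \<le> C * N W \<psi>}" using est by auto
      ultimately have est: "norm \<psi> \<le> C * N W \<psi>" if "\<psi> \<in> closure ?V" for \<psi>
        using that closure_minimal by blast
      have "subspace (closure ?V)"
      proof (rule subspaceI)
        fix x y and c :: real assume x: "x \<in> closure ?V"
        then obtain f where f: "\<And>n. f n \<in> ?V" "f \<longlonglongrightarrow> x" by (auto simp: closure_sequential)
        then show "c *\<^sub>R x \<in> closure ?V"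
          unfolding closure_sequential
          by (intro exI[of _ "\<lambda>n. c *\<^sub>R f n"]) (auto intro: span_scale tendsto_intros)
        assume "y \<in> closure ?V"
        then obtain g where "\<And>n. g n \<in> ?V" "g \<longlonglongrightarrow> y" by (auto simp: closure_sequential)
        with f show "x + y \<in> closure ?V"
          unfolding closure_sequential
          by (intro exI[of _ "\<lambda>n. f n + g n"]) (auto intro: span_add tendsto_intros)
      qed (use closure_subset span_zero in blast)
      then have "\<psi> \<in> closure ?V" if "\<psi> \<in> span (V \<union> insert e Z)" for \<psi>
        using split[OF that] True closure_subset[of ?V] by (auto intro: subspace_add subspace_scale)
      with est W C show ?thesis unfolding N_def by blast
    next
      case False
      obtain \<Lambda> :: "('a \<Rightarrow>\<^sub>L real) \<Rightarrow>\<^sub>L real" where \<Lambda>: "\<And>v. v \<in> ?V \<Longrightarrow> \<Lambda> v = 0" "\<Lambda> e = 1"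
        using separating_functional[OF _ False] by (auto intro: subspace_span)
      obtain w where w: "\<Lambda> = bidual_embedding w" using refl by (auto simp: reflexive_space_def)
      let ?W = "insert w W"
      \<comment> \<open>Read off from
        \<open>norm \<psi> \<le> norm v + \<bar>c\<bar> * norm e\<close>: the old estimate for
        \<open>v = \<psi> - c *\<^sub>R e\<close> contributes \<open>C\<close> and
        \<open>C * N W e\<close>, and \<open>\<bar>c\<bar>\<close> is itself a summand of
        \<open>N ?W \<psi>\<close>.\<close>
      define C' where "C' = C + C * N W e + norm e"
      have C': "0 \<le> C'" using C N0 by (auto simp: C'_def)
      have "norm \<psi> \<le> C' * N ?W \<psi>" if \<psi>: "\<psi> \<in> span (V \<union> insert e Z)" for \<psi>
      proof -
        obtain v c where v: "v \<in> ?V" "\<psi> = v + c *\<^sub>R e" using split[OF \<psi>] by blast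
        have c: "\<psi> w = c" using \<Lambda> v w by (simp add: blinfun.add_left blinfun.scaleR_left)
        have sub: "N W \<psi> \<le> N ?W \<psi>" unfolding N_def using W by (auto simp: sum.insert_if)
        have cw: "\<bar>c\<bar> \<le> N ?W \<psi>"
          unfolding N_def c[symmetric] using M0[of \<psi>] W
            member_le_sum[of w ?W "\<lambda>w. \<bar>\<psi> w\<bar>"] by simp
        have "norm \<psi> \<le> norm v + \<bar>c\<bar> * norm e"
          using v norm_triangle_ineq[of v "c *\<^sub>R e"] by simp
        also have "norm v \<le> C * N W v" by (rule est[OF v(1)])
        also have "C * N W v \<le> C * (N W \<psi> + \<bar>c\<bar> * N W e)"
          using N_add[of W \<psi> "(- c) *\<^sub>R e"] N_scale[of W "- c" e] v C
          by (intro mult_left_mono) auto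
        also have "C * (N W \<psi> + \<bar>c\<bar> * N W e) + \<bar>c\<bar> * norm e = C * N W \<psi> + \<bar>c\<bar> * (C * N W e + norm e)"
          by (simp add: algebra_simps)
        also have "\<dots> \<le> C * N ?W \<psi> + N ?W \<psi> * (C * N W e + norm e)"
          using C N0[of W e] sub cw by (intro add_mono mult_left_mono mult_right_mono) auto
        finally show ?thesis using C by (simp add: C'_def algebra_simps)
      qed
      with W C' show ?thesis unfolding N_def by (intro exI[of _ ?W] exI[of _ C']) auto
    qed
  qed
qed

section \<open>Strong measurability and the Banach-valued integral\<close>

lemma strongly_measurable_simple: "simple_function M f \<Longrightarrow> strongly_measurable M f"
  unfolding strongly_measurable_def by (intro exI[of _ "\<lambda>_. f"]) simp

lemma strongly_measurable_const [simp]: "strongly_measurable M (\<lambda>x. c)"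
  by (simp add: strongly_measurable_simple)

lemma strongly_measurable_cong_AE:
  assumes "strongly_measurable M f" "AE x in M. f x = g x"
  shows "strongly_measurable M g"
proof -
  obtain s where s: "\<And>i. simple_function M (s i)" "AE x in M. (\<lambda>i. s i x) \<longlonglongrightarrow> f x"
    using assms(1) by (auto simp: strongly_measurable_def)
  have "AE x in M. (\<lambda>i. s i x) \<longlonglongrightarrow> g x" using s(2) assms(2) by eventually_elim simp
  with s(1) show ?thesis by (auto simp: strongly_measurable_def)
qed

text \<open>The exceptional null set is absorbed into the limit, because measurability of limits is
  obtained from convergence at every point.\<close>

lemma strongly_measurable_everywhere:
  fixes f :: "'a \<Rightarrow> 'b::real_normed_vector"
  assumes "strongly_measurable M f"
  obtains s g where "\<And>i. simple_function M (s i)" "\<And>x. x \<in> space M \<Longrightarrow> (\<lambda>i::nat. s i x) \<longlonglongrightarrow> g x"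
    "AE x in M. f x = g x"
proof -
  obtain s where s: "\<And>i. simple_function M (s i)" "AE x in M. (\<lambda>i. s i x) \<longlonglongrightarrow> f x"
    using assms by (auto simp: strongly_measurable_def)
  obtain N where N: "{x\<in>space M. \<not> (\<lambda>i. s i x) \<longlonglongrightarrow> f x} \<subseteq> N" "emeasure M N = 0" "N \<in> sets M"
    by (rule AE_E[OF s(2)])
  show thesis
  proof (rule that[of "\<lambda>i x. if x \<in> N then 0 else s i x" "\<lambda>x. if x \<in> N then 0 else f x"])
    show "simple_function M (\<lambda>x. if x \<in> N then 0 else s i x)" for i
      using s N(3) by (intro simple_function_If_set) auto
    show "(\<lambda>i. if x \<in> N then 0 else s i x) \<longlonglongrightarrow> (if x \<in> N then 0 else f x)" if "x \<in> space M" for x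
      using N(1) that by auto
    have "N \<in> null_sets M" using N by auto
    from AE_not_in[OF this] show "AE x in M. f x = (if x \<in> N then 0 else f x)"
      by eventually_elim simp
  qed
qed

lemma strongly_measurable_compose:
  assumes f: "strongly_measurable M f" and h: "continuous_on UNIV h"
  shows "strongly_measurable M (\<lambda>x. h (f x))"
proof -
  obtain s where s: "\<And>i. simple_function M (s i)" "AE x in M. (\<lambda>i. s i x) \<longlonglongrightarrow> f x"
    using f by (auto simp: strongly_measurable_def)
  have "AE x in M. (\<lambda>i. h (s i x)) \<longlonglongrightarrow> h (f x)"
    using s(2) by eventually_elim (use h in \<open>auto intro: continuous_on_tendsto_compose\<close>)
  with s(1) show ?thesis
    unfolding strongly_measurable_def
    by (intro exI[of _ "\<lambda>i x. h (s i x)"]) (auto intro: simple_function_compose1)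
qed

lemma strongly_measurable_Pair:
  assumes f: "strongly_measurable M f" and g: "strongly_measurable M g"
  shows "strongly_measurable M (\<lambda>x. (f x, g x))"
proof -
  obtain s where s: "\<And>i. simple_function M (s i)" "AE x in M. (\<lambda>i. s i x) \<longlonglongrightarrow> f x"
    using f by (auto simp: strongly_measurable_def)
  obtain t where t: "\<And>i. simple_function M (t i)" "AE x in M. (\<lambda>i. t i x) \<longlonglongrightarrow> g x"
    using g by (auto simp: strongly_measurable_def)
  have "AE x in M. (\<lambda>i. (s i x, t i x)) \<longlonglongrightarrow> (f x, g x)"
    using s(2) t(2) by eventually_elim (intro tendsto_Pair)
  with s(1) t(1) show ?thesis
    unfolding strongly_measurable_def by (intro exI[of _ "\<lambda>i x. (s i x, t i x)"]) auto
qed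

lemma strongly_measurable_compose2:
  assumes "strongly_measurable M f" "strongly_measurable M g"
    and "continuous_on UNIV (\<lambda>(a, b). h a b)"
  shows "strongly_measurable M (\<lambda>x. h (f x) (g x))"
  using strongly_measurable_compose[OF strongly_measurable_Pair[OF assms(1,2)] assms(3)] by simp

lemma strongly_measurable_add:
  "strongly_measurable M f \<Longrightarrow> strongly_measurable M g \<Longrightarrow> strongly_measurable M (\<lambda>x. f x + g x)"
  by (rule strongly_measurable_compose2[where h="(+)"])
    (auto simp: case_prod_unfold intro!: continuous_intros)

lemma strongly_measurable_diff:
  "strongly_measurable M f \<Longrightarrow> strongly_measurable M g \<Longrightarrow> strongly_measurable M (\<lambda>x. f x - g x)"
  by (rule strongly_measurable_compose2[where h="(-)"])
    (auto simp: case_prod_unfold intro!: continuous_intros)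

lemma strongly_measurable_scaleR:
  "strongly_measurable M f \<Longrightarrow> strongly_measurable M g \<Longrightarrow> strongly_measurable M (\<lambda>x. f x *\<^sub>R g x)"
  by (rule strongly_measurable_compose2[where h="(*\<^sub>R)"])
    (auto simp: case_prod_unfold intro!: continuous_intros)

lemma strongly_measurable_blinfun_apply:
  "strongly_measurable M f \<Longrightarrow> strongly_measurable M g \<Longrightarrow>
    strongly_measurable M (\<lambda>x. blinfun_apply (f x) (g x))"
  by (rule strongly_measurable_compose2[where h=blinfun_apply])
    (auto simp: case_prod_unfold intro!: continuous_intros)

lemma strongly_measurable_sum:
  "(\<And>i. i \<in> I \<Longrightarrow> strongly_measurable M (f i)) \<Longrightarrow> strongly_measurable M (\<lambda>x. \<Sum>i\<in>I. f i x)"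
  by (induction I rule: infinite_finite_induct) (auto intro: strongly_measurable_add)

lemma borel_measurable_simple_limit:
  fixes g :: "'a \<Rightarrow> 'b::metric_space"
  assumes "\<And>i. simple_function M (s i)" "\<And>x. x \<in> space M \<Longrightarrow> (\<lambda>i. s i x) \<longlonglongrightarrow> g x"
  shows "g \<in> borel_measurable M"
  by (rule borel_measurable_LIMSEQ_metric[OF borel_measurable_simple_function[OF assms(1)] assms(2)])

text \<open>The simple functions below pick, among the first points of a dense sequence, one nearest
  to the value of the function.\<close>

lemma borel_measurable_imp_strongly_measurable:
  fixes g :: "'a \<Rightarrow> 'b::real_normed_vector"
  assumes g: "g \<in> borel_measurable M" and D: "countable D" and sep: "\<And>x. x \<in> space M \<Longrightarrow> g x \<in> closure D"
  shows "strongly_measurable M g"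
proof (cases "D = {}")
  case True
  then have "(0::'b) = g x" if "x \<in> space M" for x using sep[OF that] by simp
  then have "AE x in M. (0::'b) = g x" by (rule AE_I2)
  then show ?thesis by (rule strongly_measurable_cong_AE[rotated]) simp
next
  case False
  define e where "e = from_nat_into D"
  have range_e: "range e = D" using False D by (simp add: e_def)
  define s where "s = rec_nat (\<lambda>_. e 0) (\<lambda>n s x. if dist (g x) (e (Suc n)) < dist (g x) (s x) then e (Suc n) else s x)"
  have s: "s 0 x = e 0"
    "s (Suc n) x = (if dist (g x) (e (Suc n)) < dist (g x) (s n x) then e (Suc n) else s n x)" for n x
    by (simp_all add: s_def)
  have dist_meas: "(\<lambda>x. dist (g x) c) \<in> borel_measurable M" for c
    by (rule measurable_compose[OF g]) (intro borel_measurable_continuous_onI continuous_intros)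
  have d_meas: "(\<lambda>x. dist (g x) (s n x)) \<in> borel_measurable M" for n
  proof (induction n)
    case (Suc n)
    have "(\<lambda>x. dist (g x) (s (Suc n) x)) = (\<lambda>x. min (dist (g x) (e (Suc n))) (dist (g x) (s n x)))"
      unfolding s min_def by (rule ext) simp
    moreover have "\<dots> \<in> borel_measurable M" by (intro borel_measurable_min dist_meas Suc)
    ultimately show ?case by simp
  qed (simp add: s dist_meas)
  have simple: "simple_function M (s n)" for n
  proof (induction n)
    case 0
    have "s 0 = (\<lambda>_. e 0)" by (rule ext) (rule s)
    then show ?case by simp
  next
    case (Suc n)
    have "{x \<in> space M. dist (g x) (e (Suc n)) < dist (g x) (s n x)} \<in> sets M"
      using dist_meas d_meas by (intro borel_measurable_less)
    then have "simple_function M (\<lambda>x. if dist (g x) (e (Suc n)) < dist (g x) (s n x) then e (Suc n) else s n x)"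
      using Suc by (intro simple_function_If) auto
    moreover have "s (Suc n) = (\<lambda>x. if dist (g x) (e (Suc n)) < dist (g x) (s n x) then e (Suc n) else s n x)"
      by (rule ext) (rule s)
    ultimately show ?case by simp
  qed
  have near: "dist (g x) (s n x) \<le> dist (g x) (e k)" if "k \<le> n" for n k x
    using that
  proof (induction n)
    case (Suc n)
    then show ?case by (cases "k = Suc n") (auto simp: s)
  qed (simp add: s)
  have "(\<lambda>n. s n x) \<longlonglongrightarrow> g x" if x: "x \<in> space M" for x
  proof (rule metric_LIMSEQ_I)
    fix r :: real assume "0 < r"
    then obtain d where "d \<in> D" "dist d (g x) < r"
      using sep[OF x] by (auto simp: closure_approachable)
    then obtain k where k: "dist (e k) (g x) < r" using range_e by blast
    have "dist (s n x) (g x) < r" if "k \<le> n" for n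
      using near[OF that, of x] k by (simp add: dist_commute)
    then show "\<exists>k. \<forall>n\<ge>k. dist (s n x) (g x) < r" by blast
  qed
  with simple show ?thesis by (auto simp: strongly_measurable_def)
qed

text \<open>The countably many values of the approximating simple functions are dense enough for the
  limit. Together with \<open>borel_measurable_imp_strongly_measurable\<close> this is Pettis's
  characterisation by Borel measurability and separable range.\<close>

lemma strongly_measurable_imp_separable:
  fixes f :: "'a \<Rightarrow> 'b::real_normed_vector"
  assumes "strongly_measurable M f"
  obtains g D where "g \<in> borel_measurable M" "countable D" "\<And>x. x \<in> space M \<Longrightarrow> g x \<in> closure D"
    "AE x in M. f x = g x"
proof -
  obtain s g where s: "\<And>i. simple_function M (s i)" "\<And>x. x \<in> space M \<Longrightarrow> (\<lambda>i::nat. s i x) \<longlonglongrightarrow> g x"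
    and g: "AE x in M. f x = g x"
    using strongly_measurable_everywhere[OF assms] by metis
  show thesis
  proof (rule that[of g "\<Union>i. s i ` space M"])
    show "g \<in> borel_measurable M" using s by (rule borel_measurable_simple_limit)
    show "countable (\<Union>i. s i ` space M)"
      by (rule countable_UN[OF countableI_type countable_finite[OF simple_functionD(1)[OF s(1)]]])
    show "g x \<in> closure (\<Union>i. s i ` space M)" if "x \<in> space M" for x
      unfolding closure_sequential
    proof (intro exI conjI allI)
      show "s i x \<in> (\<Union>i. s i ` space M)" for i using that by blast
      show "(\<lambda>i. s i x) \<longlonglongrightarrow> g x" by (rule s(2)[OF that])
    qed
  qed (rule g)
qed

text \<open>Borel measurability and separability of the range both pass to pointwise limits. Going
  through them avoids the choice of a diagonal sequence among the simple functions.\<close>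

lemma strongly_measurable_LIMSEQ:
  fixes f :: "nat \<Rightarrow> 'a \<Rightarrow> 'b::real_normed_vector"
  assumes f: "\<And>i. strongly_measurable M (f i)" and lim: "AE x in M. (\<lambda>i. f i x) \<longlonglongrightarrow> h x"
  shows "strongly_measurable M h"
proof -
  have "\<forall>i. \<exists>g D. g \<in> borel_measurable M \<and> countable D \<and> (\<forall>x\<in>space M. g x \<in> closure D) \<and>
      (AE x in M. f i x = g x)"
  proof
    fix i
    show "\<exists>g D. g \<in> borel_measurable M \<and> countable D \<and> (\<forall>x\<in>space M. g x \<in> closure D) \<and>
      (AE x in M. f i x = g x)"
      by (rule strongly_measurable_imp_separable[OF f[of i]]) blast
  qed
  then obtain g D where gD: "\<forall>i. g i \<in> borel_measurable M \<and> countable (D i) \<and>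
      (\<forall>x\<in>space M. g i x \<in> closure (D i)) \<and> (AE x in M. f i x = g i x)"
    unfolding choice_iff by blast
  then have g: "\<And>i. g i \<in> borel_measurable M" "\<And>i. AE x in M. f i x = g i x"
    and D: "\<And>i. countable (D i)" "\<And>i x. x \<in> space M \<Longrightarrow> g i x \<in> closure (D i)"
    by blast+
  have "AE x in M. \<forall>i. f i x = g i x" using g(2) by (simp add: AE_all_countable)
  with lim have "AE x in M. (\<lambda>i. g i x) \<longlonglongrightarrow> h x"
    by eventually_elim simp
  then obtain N where N: "{x\<in>space M. \<not> (\<lambda>i. g i x) \<longlonglongrightarrow> h x} \<subseteq> N" "emeasure M N = 0" "N \<in> sets M"
    by (rule AE_E)
  define h' where "h' x = (if x \<in> N then 0 else h x)" for x
  have "strongly_measurable M h'"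
  proof (rule borel_measurable_imp_strongly_measurable)
    have "(\<lambda>x. if x \<in> N then 0 else g i x) \<in> borel_measurable M" for i
      using N g(1) by (intro measurable_If_set) auto
    moreover have lim': "(\<lambda>i. if x \<in> N then 0 else g i x) \<longlonglongrightarrow> h' x" if "x \<in> space M" for x
      using N that by (auto simp: h'_def)
    ultimately show "h' \<in> borel_measurable M" by (rule borel_measurable_LIMSEQ_metric)
    show "countable (insert 0 (\<Union>i. D i))" using D by auto
    show "h' x \<in> closure (insert 0 (\<Union>i. D i))" if "x \<in> space M" for x
    proof -
      have "closure (D i) \<subseteq> closure (insert 0 (\<Union>i. D i))" for i by (intro closure_mono) auto
      then have "(if x \<in> N then 0 else g i x) \<in> closure (insert 0 (\<Union>i. D i))" for i
        using D(2)[OF that, of i] closure_subset[of "insert 0 (\<Union>i. D i)"] by auto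
      from closed_sequentially[OF closed_closure this lim'[OF that]] show ?thesis .
    qed
  qed
  moreover have "N \<in> null_sets M" using N by auto
  from AE_not_in[OF this] have "AE x in M. h' x = h x" by eventually_elim (simp add: h'_def)
  ultimately show ?thesis by (rule strongly_measurable_cong_AE)
qed

text \<open>\<open>H\<close> may fail to be measurable in the operator norm, as happens for strongly
  continuous families. A simple \<open>h\<close> reduces the claim to finitely many fixed vectors,
  and limits in \<open>h\<close> are harmless because each \<open>H x\<close> is continuous.\<close>

lemma strongly_measurable_operator_family:
  fixes H :: "'a \<Rightarrow> 'b::real_normed_vector \<Rightarrow>\<^sub>L 'c::real_normed_vector"
  assumes H: "\<And>y. strongly_measurable M (\<lambda>x. H x y)" and h: "strongly_measurable M h"
  shows "strongly_measurable M (\<lambda>x. H x (h x))"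
proof -
  obtain s where s: "\<And>i. simple_function M (s i)" "AE x in M. (\<lambda>i. s i x) \<longlonglongrightarrow> h x"
    using h by (auto simp: strongly_measurable_def)
  have "strongly_measurable M (\<lambda>x. H x (s i x))" for i
  proof -
    have "strongly_measurable M (\<lambda>x. \<Sum>y\<in>s i ` space M. indicat_real (s i -` {y} \<inter> space M) x *\<^sub>R H x y)"
      by (intro strongly_measurable_sum strongly_measurable_scaleR H strongly_measurable_simple
          simple_function_indicator simple_functionD(2)[OF s(1)])
    moreover have "AE x in M. (\<Sum>y\<in>s i ` space M. indicat_real (s i -` {y} \<inter> space M) x *\<^sub>R H x y) = H x (s i x)"
    proof (rule AE_I2)
      fix x assume x: "x \<in> space M"
      then have "(\<Sum>y\<in>s i ` space M. indicat_real (s i -` {y} \<inter> space M) x *\<^sub>R H x y) =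
          (\<Sum>y\<in>s i ` space M. if y = s i x then H x y else 0)"
        by (intro sum.cong) (auto simp: indicator_def)
      also have "\<dots> = H x (s i x)"
        using simple_functionD(1)[OF s(1)[of i]] x by simp
      finally show "(\<Sum>y\<in>s i ` space M. indicat_real (s i -` {y} \<inter> space M) x *\<^sub>R H x y) = H x (s i x)" .
    qed
    ultimately show ?thesis by (rule strongly_measurable_cong_AE)
  qed
  moreover have "AE x in M. (\<lambda>i. H x (s i x)) \<longlonglongrightarrow> H x (h x)"
    using s(2) by eventually_elim (intro tendsto_intros)
  ultimately show ?thesis by (rule strongly_measurable_LIMSEQ)
qed

lemma strongly_measurable_restrict_space:
  assumes f: "strongly_measurable M f" and S: "S \<in> sets M"
  shows "strongly_measurable (restrict_space M S) f"
proof -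
  obtain s where s: "\<And>i. simple_function M (s i)" "AE x in M. (\<lambda>i. s i x) \<longlonglongrightarrow> f x"
    using f by (auto simp: strongly_measurable_def)
  have "simple_function (restrict_space M S) (s i)" for i
    unfolding simple_function_def
  proof (intro conjI ballI)
    show "finite (s i ` space (restrict_space M S))"
      using simple_functionD(1)[OF s(1)[of i]]
      by (rule finite_subset[rotated]) (auto simp: space_restrict_space)
    show "s i -` {y} \<inter> space (restrict_space M S) \<in> sets (restrict_space M S)" for y
    proof -
      have "s i -` {y} \<inter> space (restrict_space M S) = S \<inter> (s i -` {y} \<inter> space M)"
        by (auto simp: space_restrict_space)
      then show ?thesis
        using simple_functionD(2)[OF s(1)[of i], of "{y}"] unfolding sets_restrict_space by blast
    qed
  qed
  moreover have "AE x in restrict_space M S. (\<lambda>i. s i x) \<longlonglongrightarrow> f x"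
    using S s(2) by (subst AE_restrict_space_iff) auto
  ultimately show ?thesis by (auto simp: strongly_measurable_def)
qed

lemma lebesgue_on_restrict:
  fixes a b c d :: real
  assumes "{a..b} \<subseteq> {c..d}"
  shows "lebesgue_on {a..b} = restrict_space (lebesgue_on {c..d}) {a..b}"
proof -
  have "{c..d} \<inter> {a..b} = {a..b}" using assms by blast
  then show ?thesis by (simp add: restrict_restrict_space del: Int_atLeastAtMost)
qed

lemma complete_measure_lebesgue_on:
  assumes "S \<in> sets lebesgue"
  shows "complete_measure (lebesgue_on S)"
proof
  fix A B assume "B \<subseteq> A" "A \<in> null_sets (lebesgue_on S)"
  with assms have *: "B \<subseteq> S" "A \<in> null_sets lebesgue" by (auto simp: null_sets_restrict_space)
  then have "B \<in> sets lebesgue" using \<open>B \<subseteq> A\<close> by (metis completion.complete)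
  with * assms show "B \<in> sets (lebesgue_on S)" by (auto simp: sets_restrict_space image_iff)
qed

text \<open>The image of a countable dense subset of the interval is dense in the range.\<close>

lemma strongly_measurable_continuous_on:
  fixes f :: "real \<Rightarrow> 'b::real_normed_vector"
  assumes f: "continuous_on {a..b} f"
  shows "strongly_measurable (lebesgue_on {a..b}) f"
proof -
  obtain Q where Q: "countable Q" "Q \<subseteq> {a..b}" "{a..b} \<subseteq> closure Q"
    using separable[of "{a..b}"] by metis
  show ?thesis
  proof (rule borel_measurable_imp_strongly_measurable)
    show "f \<in> borel_measurable (lebesgue_on {a..b})"
      using f by (intro continuous_imp_measurable_on_sets_lebesgue) auto
    show "countable (f ` Q)" using Q by simp
    fix x assume "x \<in> space (lebesgue_on {a..b})"
    then have x: "x \<in> {a..b}" by simp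
    with Q have "x \<in> closure Q" by blast
    then obtain q where q: "\<And>n. q n \<in> Q" "q \<longlonglongrightarrow> x" by (auto simp: closure_sequential)
    have "(\<lambda>n. f (q n)) \<longlonglongrightarrow> f x"
    proof (rule continuous_on_tendsto_compose[OF f q(2) x])
      show "\<forall>\<^sub>F n in sequentially. q n \<in> {a..b}" using q(1) Q(2) by (intro always_eventually) blast
    qed
    with q show "f x \<in> closure (f ` Q)"
      unfolding closure_sequential by (intro exI[of _ "\<lambda>n. f (q n)"]) auto
  qed
qed

text \<open>Preimages under \<open>f\<close> and under a Borel version of it differ by subsets of a
  null set, which completeness makes measurable.\<close>

lemma (in complete_measure) borel_measurable_strongly_measurable:
  fixes f :: "'a \<Rightarrow> real"
  assumes "strongly_measurable M f"
  shows "f \<in> borel_measurable M"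
proof -
  obtain g D where g: "g \<in> borel_measurable M" "AE x in M. f x = g x"
    using strongly_measurable_imp_separable[OF assms] by metis
  obtain N where N: "{x\<in>space M. \<not> f x = g x} \<subseteq> N" "emeasure M N = 0" "N \<in> sets M"
    by (rule AE_E[OF g(2)])
  show ?thesis
  proof (rule measurableI)
    fix A :: "real set" assume A: "A \<in> sets borel"
    have null: "(f -` A \<inter> space M) \<inter> N \<in> sets M" using N by (intro complete[of _ N]) auto
    have "(f -` A \<inter> space M) = (g -` A \<inter> space M - N) \<union> ((f -` A \<inter> space M) \<inter> N)"
      using N(1) by auto
    also have "\<dots> \<in> sets M"
      using measurable_sets[OF g(1) A] N null by auto
    finally show "f -` A \<inter> space M \<in> sets M" .
  qed simp
qed

lemma strongly_measurable_norm: "strongly_measurable M f \<Longrightarrow> strongly_measurable M (\<lambda>x. norm (f x))"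
  by (rule strongly_measurable_compose[where h=norm]) (auto intro!: continuous_intros)

section \<open>The Banach-valued integral over a complete measure\<close>

context complete_measure
begin

lemma norm_strongly_measurable:
  "strongly_measurable M f \<Longrightarrow> (\<lambda>x. norm (f x)) \<in> borel_measurable M"
  by (intro borel_measurable_strongly_measurable strongly_measurable_norm)

lemma simple_bochner_integrable_strongly_measurable:
  "Bochner_Integration.simple_bochner_integrable M s \<Longrightarrow> strongly_measurable M s"
  by (auto elim: simple_bochner_integrable.cases intro: strongly_measurable_simple)

lemma simple_bochner_integral_dist:
  fixes f :: "'a \<Rightarrow> 'b::real_normed_vector"
  assumes f: "strongly_measurable M f"
    and s: "Bochner_Integration.simple_bochner_integrable M s" and t: "Bochner_Integration.simple_bochner_integrable M t"
  shows "ennreal (dist (Bochner_Integration.simple_bochner_integral M s) (Bochner_Integration.simple_bochner_integral M t)) \<le>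
    (\<integral>\<^sup>+x. norm (f x - s x) \<partial>M) + (\<integral>\<^sup>+x. norm (f x - t x) \<partial>M)"
proof -
  note meas = f simple_bochner_integrable_strongly_measurable[OF s] simple_bochner_integrable_strongly_measurable[OF t]
  have "Bochner_Integration.simple_bochner_integrable M (\<lambda>x. s x - t x)"
    using simple_bochner_integrable_compose2[OF _ s t, of "(-)"] by simp
  moreover have *: "Bochner_Integration.simple_bochner_integrable M (\<lambda>x. norm (s x - t x))"
    using simple_bochner_integrable_compose2[OF _ s t, of "\<lambda>x y. norm (x - y)"] by simp
  ultimately
  have "ennreal (dist (Bochner_Integration.simple_bochner_integral M s) (Bochner_Integration.simple_bochner_integral M t))
      \<le> ennreal (Bochner_Integration.simple_bochner_integral M (\<lambda>x. norm (s x - t x)))"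
    using simple_bochner_integral_norm_bound[of M "\<lambda>x. s x - t x"]
    by (simp add: dist_norm simple_bochner_integral_diff[OF s t] ennreal_leI)
  also have "\<dots> = (\<integral>\<^sup>+x. norm (s x - t x) \<partial>M)"
    using * by (intro simple_bochner_integral_eq_nn_integral) auto
  also have "\<dots> \<le> (\<integral>\<^sup>+x. ennreal (norm (f x - s x)) + ennreal (norm (f x - t x)) \<partial>M)"
  proof (rule nn_integral_mono)
    fix x
    have "norm (s x - t x) \<le> norm (f x - s x) + norm (f x - t x)"
      using norm_triangle_ineq4[of "f x - t x" "f x - s x"] by simp
    then show "ennreal (norm (s x - t x)) \<le> ennreal (norm (f x - s x)) + ennreal (norm (f x - t x))"
      by (simp flip: ennreal_plus)
  qed
  also have "\<dots> = (\<integral>\<^sup>+x. norm (f x - s x) \<partial>M) + (\<integral>\<^sup>+x. norm (f x - t x) \<partial>M)"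
    using meas by (intro nn_integral_add measurable_compose[OF norm_strongly_measurable measurable_ennreal]
        strongly_measurable_diff) auto
  finally show ?thesis .
qed

lemma has_banach_integral_exists:
  fixes f :: "'a \<Rightarrow> 'b::banach"
  assumes f: "strongly_measurable M f" and fin: "(\<integral>\<^sup>+x. norm (f x) \<partial>M) < \<infinity>"
  obtains x where "has_banach_integral M f x"
proof -
  obtain s g where s: "\<And>i. simple_function M (s i)" "\<And>x. x \<in> space M \<Longrightarrow> (\<lambda>i::nat. s i x) \<longlonglongrightarrow> g x"
    and g: "AE x in M. f x = g x"
    using strongly_measurable_everywhere[OF f] by metis
  have sm_g: "strongly_measurable M g" using f g by (rule strongly_measurable_cong_AE)
  note [measurable] = norm_strongly_measurable[OF sm_g]
  have norm_s: "(\<lambda>x. norm (s i x)) \<in> borel_measurable M" for i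
    by (intro norm_strongly_measurable strongly_measurable_simple s)
  \<comment> \<open>The approximants are cut off so that a multiple of \<open>norm (g x)\<close>
    dominates them. The factor 2 lets them survive eventually wherever \<open>g x\<close> is
    nonzero; where \<open>g x = 0\<close>, the cut-off already equals the limit.\<close>
  define t where "t i x = (if norm (s i x) \<le> 2 * norm (g x) then s i x else 0)" for i x
  have t: "simple_function M (t i)" for i
    unfolding t_def using s(1) norm_s by (intro simple_function_If) (auto intro!: borel_measurable_le)
  have t_le: "norm (t i x) \<le> 2 * norm (g x)" for i x by (simp add: t_def)
  have t_lim: "(\<lambda>i. t i x) \<longlonglongrightarrow> g x" if x: "x \<in> space M" for x
  proof (cases "g x = 0")
    case True
    then have "t i x = g x" for i by (simp add: t_def)
    then show ?thesis by simp
  next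
    case False
    then have "norm (g x) < 2 * norm (g x)" by simp
    with tendsto_norm[OF s(2)[OF x]] have "\<forall>\<^sub>F i in sequentially. norm (s i x) < 2 * norm (g x)"
      by (rule order_tendstoD)
    then have "\<forall>\<^sub>F i in sequentially. s i x = t i x" by eventually_elim (simp add: t_def)
    with s(2)[OF x] show ?thesis by (rule Lim_transform_eventually)
  qed
  have fin_g: "(\<integral>\<^sup>+x. norm (g x) \<partial>M) < \<infinity>"
    using fin g by (subst nn_integral_cong_AE[of _ "\<lambda>x. ennreal (norm (f x))"]) auto
  have fin_c: "(\<integral>\<^sup>+x. ennreal (c * norm (g x)) \<partial>M) < \<infinity>" if "0 \<le> c" for c
    using that fin_g by (simp add: ennreal_mult nn_integral_cmult ennreal_mult_less_top)
  have t_int: "Bochner_Integration.simple_bochner_integrable M (t i)" for i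
  proof (rule simple_bochner_integrableI_bounded[OF t])
    have "(\<integral>\<^sup>+x. norm (t i x) \<partial>M) \<le> (\<integral>\<^sup>+x. ennreal (2 * norm (g x)) \<partial>M)"
      by (intro nn_integral_mono ennreal_leI t_le)
    with fin_c[of 2] show "(\<integral>\<^sup>+x. norm (t i x) \<partial>M) < \<infinity>" by simp
  qed
  have "(\<lambda>i. \<integral>\<^sup>+x. norm (g x - t i x) \<partial>M) \<longlonglongrightarrow> (\<integral>\<^sup>+x. 0 \<partial>M)"
  proof (rule nn_integral_dominated_convergence)
    show "(\<lambda>x. ennreal (norm (g x - t i x))) \<in> borel_measurable M" for i
      using t by (intro measurable_compose[OF norm_strongly_measurable measurable_ennreal] strongly_measurable_diff
          sm_g strongly_measurable_simple)
    \<comment> \<open>The 3 is 1 for \<open>g\<close> plus 2 for the truncated approximant.\<close>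
    show "(\<integral>\<^sup>+x. ennreal (3 * norm (g x)) \<partial>M) < \<infinity>" by (rule fin_c) simp
    show "AE x in M. ennreal (norm (g x - t i x)) \<le> ennreal (3 * norm (g x))" for i
      using norm_triangle_ineq4[of "g x" "t i x" for x] t_le[of i]
      by (intro AE_I2 ennreal_leI) (smt (verit))
    show "AE x in M. (\<lambda>i. ennreal (norm (g x - t i x))) \<longlonglongrightarrow> 0"
    proof (rule AE_I2)
      fix x assume "x \<in> space M"
      from tendsto_norm[OF tendsto_diff[OF tendsto_const t_lim[OF this], of "g x"]]
      have "(\<lambda>i. norm (g x - t i x)) \<longlonglongrightarrow> 0" by simp
      then show "(\<lambda>i. ennreal (norm (g x - t i x))) \<longlonglongrightarrow> 0"
        using tendsto_ennrealI by fastforce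
    qed
  qed auto
  then have lim0: "(\<lambda>i. \<integral>\<^sup>+x. norm (g x - t i x) \<partial>M) \<longlonglongrightarrow> 0" by simp
  let ?I = "\<lambda>i. Bochner_Integration.simple_bochner_integral M (t i)"
  have "Cauchy ?I"
  proof (rule metric_CauchyI)
    fix e :: real assume "0 < e"
    then have "\<forall>\<^sub>F i in sequentially. (\<integral>\<^sup>+x. norm (g x - t i x) \<partial>M) < ennreal (e / 2)"
      by (intro order_tendstoD(2)[OF lim0]) simp
    then obtain n where n: "\<And>i. i \<ge> n \<Longrightarrow> (\<integral>\<^sup>+x. norm (g x - t i x) \<partial>M) < ennreal (e / 2)"
      by (auto simp: eventually_sequentially)
    have "dist (?I i) (?I j) < e" if "i \<ge> n" "j \<ge> n" for i j
    proof -
      have "ennreal (dist (?I i) (?I j)) \<le> (\<integral>\<^sup>+x. norm (g x - t i x) \<partial>M) + (\<integral>\<^sup>+x. norm (g x - t j x) \<partial>M)"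
        by (intro simple_bochner_integral_dist sm_g t_int)
      also have "\<dots> < ennreal (e / 2) + ennreal (e / 2)" by (intro add_strict_mono n that)
      also have "\<dots> = ennreal e" using \<open>0 < e\<close> by (simp flip: ennreal_plus)
      finally show ?thesis by (subst (asm) ennreal_less_iff) auto
    qed
    then show "\<exists>n. \<forall>i\<ge>n. \<forall>j\<ge>n. dist (?I i) (?I j) < e" by blast
  qed
  then obtain x where x: "?I \<longlonglongrightarrow> x" by (auto simp: Cauchy_convergent_iff convergent_def)
  have "(\<integral>\<^sup>+x. norm (f x - t i x) \<partial>M) = (\<integral>\<^sup>+x. norm (g x - t i x) \<partial>M)" for i
    using g by (intro nn_integral_cong_AE) auto
  with lim0 x t_int f have "has_banach_integral M f x"
    unfolding has_banach_integral_def by (intro conjI exI[of _ t]) auto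
  then show thesis by (rule that)
qed

text \<open>Transfers the integral to scalars. As functionals separate points, uniqueness, linearity
  and exchange of integrals reduce to real functions.\<close>

lemma has_banach_integral_functional:
  fixes f :: "'a \<Rightarrow> 'b::real_normed_vector" and \<psi> :: "'b \<Rightarrow>\<^sub>L real"
  assumes "has_banach_integral M f x"
  shows "has_bochner_integral M (\<lambda>t. \<psi> (f t)) (\<psi> x)"
proof -
  obtain s where f: "strongly_measurable M f" and s: "\<And>i::nat. Bochner_Integration.simple_bochner_integrable M (s i)"
    and lim: "(\<lambda>i. \<integral>\<^sup>+x. norm (f x - s i x) \<partial>M) \<longlonglongrightarrow> 0"
    and x: "(\<lambda>i. Bochner_Integration.simple_bochner_integral M (s i)) \<longlonglongrightarrow> x"
    using assms by (auto simp: has_banach_integral_def)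
  show ?thesis
  proof (rule has_bochner_integral.intros[where s="\<lambda>i t. \<psi> (s i t)"])
    show "(\<lambda>t. \<psi> (f t)) \<in> borel_measurable M"
      by (intro borel_measurable_strongly_measurable strongly_measurable_blinfun_apply f) simp
    show "Bochner_Integration.simple_bochner_integrable M (\<lambda>t. \<psi> (s i t))" for i
      using simple_bochner_integrable_compose2[OF _ s[of i] s[of i], of "\<lambda>x y. \<psi> x"] by simp
    have "Bochner_Integration.simple_bochner_integral M (\<lambda>t. \<psi> (s i t)) =
        \<psi> (Bochner_Integration.simple_bochner_integral M (s i))" for i
      by (intro simple_bochner_integral_linear s bounded_linear.linear[OF blinfun.bounded_linear_right])
    then show "(\<lambda>i. Bochner_Integration.simple_bochner_integral M (\<lambda>t. \<psi> (s i t))) \<longlonglongrightarrow> \<psi> x"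
      using x by (auto intro: tendsto_intros)
    show "(\<lambda>i. \<integral>\<^sup>+t. ennreal (norm (\<psi> (f t) - \<psi> (s i t))) \<partial>M) \<longlonglongrightarrow> 0"
    proof (rule tendsto_sandwich[OF _ _ tendsto_const])
      have "(\<lambda>i. ennreal (norm \<psi>) * (\<integral>\<^sup>+x. norm (f x - s i x) \<partial>M)) \<longlonglongrightarrow> ennreal (norm \<psi>) * 0"
        by (intro ennreal_tendsto_cmult lim) simp
      then show "(\<lambda>i. ennreal (norm \<psi>) * (\<integral>\<^sup>+x. norm (f x - s i x) \<partial>M)) \<longlonglongrightarrow> 0" by simp
      have "(\<integral>\<^sup>+t. ennreal (norm (\<psi> (f t) - \<psi> (s i t))) \<partial>M) \<le> ennreal (norm \<psi>) * (\<integral>\<^sup>+x. norm (f x - s i x) \<partial>M)" for i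
      proof -
        have "(\<integral>\<^sup>+t. ennreal (norm (\<psi> (f t) - \<psi> (s i t))) \<partial>M) \<le> (\<integral>\<^sup>+t. ennreal (norm \<psi>) * ennreal (norm (f t - s i t)) \<partial>M)"
        proof (rule nn_integral_mono)
          fix t
          show "ennreal (norm (\<psi> (f t) - \<psi> (s i t))) \<le> ennreal (norm \<psi>) * ennreal (norm (f t - s i t))"
            using norm_blinfun[of \<psi> "f t - s i t"]
            by (simp add: blinfun.diff_right ennreal_mult[symmetric] ennreal_leI)
        qed
        also have "\<dots> = ennreal (norm \<psi>) * (\<integral>\<^sup>+x. norm (f x - s i x) \<partial>M)"
          by (intro nn_integral_cmult measurable_compose[OF norm_strongly_measurable measurable_ennreal]
              strongly_measurable_diff f simple_bochner_integrable_strongly_measurable s)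
        finally show ?thesis .
      qed
      then show "\<forall>\<^sub>F i in sequentially. (\<integral>\<^sup>+t. ennreal (norm (\<psi> (f t) - \<psi> (s i t))) \<partial>M)
          \<le> ennreal (norm \<psi>) * (\<integral>\<^sup>+x. norm (f x - s i x) \<partial>M)" by simp
    qed simp
  qed
qed

lemma has_banach_integral_unique:
  fixes f :: "'a \<Rightarrow> 'b::real_normed_vector"
  assumes "has_banach_integral M f x" "has_banach_integral M f y"
  shows "x = y"
  by (rule functional_eqI) (rule has_bochner_integral_eq[OF assms[THEN has_banach_integral_functional]])

lemma has_banach_integral_norm_le:
  fixes f :: "'a \<Rightarrow> 'b::real_normed_vector"
  assumes "has_banach_integral M f x"
  shows "ennreal (norm x) \<le> (\<integral>\<^sup>+t. norm (f t) \<partial>M)"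
proof -
  obtain \<psi> :: "'b \<Rightarrow>\<^sub>L real" where \<psi>: "norm \<psi> \<le> 1" "\<psi> x = norm x"
    by (rule norming_functional)
  have *: "has_bochner_integral M (\<lambda>t. \<psi> (f t)) (\<psi> x)"
    using assms by (rule has_banach_integral_functional)
  have "ennreal (norm x) = ennreal (norm (\<integral>t. \<psi> (f t) \<partial>M))"
    using has_bochner_integral_integral_eq[OF *] \<psi> by simp
  also have "\<dots> \<le> (\<integral>\<^sup>+t. norm (\<psi> (f t)) \<partial>M)"
    using * by (intro integral_norm_bound_ennreal) (auto simp: integrable.simps)
  also have "\<dots> \<le> (\<integral>\<^sup>+t. norm (f t) \<partial>M)"
  proof (intro nn_integral_mono ennreal_leI)
    fix t
    show "norm (\<psi> (f t)) \<le> norm (f t)"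
      using norm_blinfun[of \<psi> "f t"] mult_right_mono[OF \<psi>(1), of "norm (f t)"] by simp
  qed
  finally show ?thesis .
qed

text \<open>Absolute integrability supplies some value of the integral, and testing with functionals
  then identifies it.\<close>

lemma has_banach_integralI:
  fixes f :: "'a \<Rightarrow> 'b::banach"
  assumes f: "strongly_measurable M f" "(\<integral>\<^sup>+x. norm (f x) \<partial>M) < \<infinity>"
    and x: "\<And>\<psi> :: 'b \<Rightarrow>\<^sub>L real. (\<integral>t. blinfun_apply \<psi> (f t) \<partial>M) = blinfun_apply \<psi> x"
  shows "has_banach_integral M f x"
proof -
  obtain y where y: "has_banach_integral M f y" using has_banach_integral_exists[OF f] .
  have "y = x"
  proof (rule functional_eqI)
    fix \<psi> :: "'b \<Rightarrow>\<^sub>L real"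
    show "blinfun_apply \<psi> y = blinfun_apply \<psi> x"
      using has_bochner_integral_integral_eq[OF has_banach_integral_functional[OF y, of \<psi>]] x[of \<psi>]
      by (rule trans[OF sym])
  qed
  with y show ?thesis by simp
qed

end

section \<open>Strongly continuous semigroups and their adjoints\<close>

text \<open>Generators are defined by limits from the right at 0; this connects them with
  derivatives within an interval, as the fundamental theorem of calculus delivers them.\<close>

lemma right_difference_quotient:
  fixes f :: "real \<Rightarrow> 'a::real_normed_vector"
  assumes f: "(f has_vector_derivative D) (at x within {x..b})" and xb: "x < b"
  shows "((\<lambda>h. (f (x + h) - f x) /\<^sub>R h) \<longlongrightarrow> D) (at_right 0)"
proof (rule tendstoI)
  fix e :: real assume e: "0 < e"
  then obtain d where d: "0 < d" "\<And>y. y \<in> {x..b} \<Longrightarrow> norm (y - x) < d \<Longrightarrow>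
      norm (f y - f x - (y - x) *\<^sub>R D) \<le> e / 2 * norm (y - x)"
    using f unfolding has_vector_derivative_def has_derivative_within_alt by (metis half_gt_zero)
  have "dist ((f (x + h) - f x) /\<^sub>R h) D < e" if h: "0 < h" "h < min d (b - x)" for h
  proof -
    have "norm (f (x + h) - f x - h *\<^sub>R D) \<le> e / 2 * h" using d(2)[of "x + h"] h by simp
    moreover have "(f (x + h) - f x) /\<^sub>R h - D = (f (x + h) - f x - h *\<^sub>R D) /\<^sub>R h"
      using h by (simp add: scaleR_diff_right)
    ultimately have "dist ((f (x + h) - f x) /\<^sub>R h) D \<le> e / 2"
      using h by (simp add: dist_norm divide_simps)
    with e show ?thesis by simp
  qed
  then show "\<forall>\<^sub>F h in at_right 0. dist ((f (x + h) - f x) /\<^sub>R h) D < e"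
    unfolding eventually_at_right_field using d(1) xb by (intro exI[of _ "min d (b - x)"]) auto
qed

lemma bounded_linear_eq_on_dense:
  fixes f g :: "'a::real_normed_vector \<Rightarrow>\<^sub>L 'b::real_normed_vector"
  assumes "closure D = UNIV" "\<And>y. y \<in> D \<Longrightarrow> blinfun_apply f y = blinfun_apply g y"
  shows "f = g"
proof (rule blinfun_eqI)
  fix y
  have "closed {y. blinfun_apply f y = blinfun_apply g y}"
    by (intro closed_Collect_eq continuous_intros)
  moreover have "D \<subseteq> {y. blinfun_apply f y = blinfun_apply g y}" using assms(2) by auto
  ultimately have "closure D \<subseteq> {y. blinfun_apply f y = blinfun_apply g y}" by (rule closure_minimal[rotated])
  then show "blinfun_apply f y = blinfun_apply g y" using assms(1) by auto
qed

locale strongly_continuous_semigroup =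
  fixes G :: "real \<Rightarrow> 'a::banach \<Rightarrow>\<^sub>L 'a"
  assumes C0: "C0_semigroup G"
begin

lemma G_zero: "G 0 = id_blinfun"
  and G_add: "0 \<le> s \<Longrightarrow> 0 \<le> t \<Longrightarrow> G (s + t) = G s o\<^sub>L G t"
  and G_right: "((\<lambda>t. G t y) \<longlongrightarrow> y) (at_right 0)"
  using C0 by (auto simp: C0_semigroup_def)

lemma G_add_apply: "0 \<le> s \<Longrightarrow> 0 \<le> t \<Longrightarrow> G (s + t) y = G s (G t y)"
  by (simp add: G_add)

text \<open>Otherwise there are times tending to 0 along which the norms exceed every
  \<open>n\<close>, although each orbit converges along them, against uniform boundedness.\<close>

lemma bounded_near_zero: obtains \<delta> M where "0 < \<delta>" "1 \<le> M" "\<And>t. t \<in> {0..\<delta>} \<Longrightarrow> norm (G t) \<le> M"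
proof -
  have "\<exists>n. \<forall>t\<in>{0..1 / Suc n}. norm (G t) \<le> real n"
  proof (rule ccontr)
    assume "\<not> ?thesis"
    then have "\<forall>n. \<exists>t. 0 \<le> t \<and> t \<le> 1 / Suc n \<and> real n < norm (G t)"
      by (meson atLeastAtMost_iff not_le)
    then obtain t where t: "\<And>n. 0 \<le> t n" "\<And>n. t n \<le> 1 / Suc n" "\<And>n. real n < norm (G (t n))"
      unfolding choice_iff by auto
    \<comment> \<open>The shift to \<open>Suc n\<close> rules out the time 0: the identity has norm
      at most 1, which contradicts a norm above \<open>n\<close> only from \<open>n = 1\<close>
      on.\<close>
    have pos: "0 < t (Suc n)" for n
    proof (rule ccontr)
      assume "\<not> 0 < t (Suc n)"
      with t(1)[of "Suc n"] have "t (Suc n) = 0" by simp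
      with t(3)[of "Suc n"] have "real (Suc n) < norm (id_blinfun :: 'a \<Rightarrow>\<^sub>L 'a)" by (simp add: G_zero)
      also have "\<dots> \<le> 1" by (rule norm_blinfun_bound) auto
      finally show False by simp
    qed
    have "(\<lambda>n. t (Suc n)) \<longlonglongrightarrow> 0"
    proof (rule tendsto_sandwich[OF _ _ tendsto_const LIMSEQ_inverse_real_of_nat])
      show "\<forall>\<^sub>F n in sequentially. 0 \<le> t (Suc n)" using t(1) by simp
      have "t (Suc n) \<le> inverse (real (Suc n))" for n
        using t(2)[of "Suc n"] by (rule order_trans) (simp add: field_simps)
      then show "\<forall>\<^sub>F n in sequentially. t (Suc n) \<le> inverse (real (Suc n))" by simp
    qed
    then have lim: "filterlim (\<lambda>n. t (Suc n)) (at_right 0) sequentially"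
      using pos by (intro tendsto_imp_filterlim_at_right) auto
    obtain M where M: "\<And>n. norm (G (t (Suc n))) \<le> M"
    proof (rule uniform_boundedness[of UNIV "\<lambda>n. G (t (Suc n))"])
      fix y
      have "(\<lambda>n. G (t (Suc n)) y) \<longlonglongrightarrow> y" by (rule filterlim_compose[OF G_right lim])
      then have "Bseq (\<lambda>n. G (t (Suc n)) y)" by (intro convergent_imp_Bseq convergentI)
      then show "\<exists>K. \<forall>n\<in>UNIV. norm (G (t (Suc n)) y) \<le> K" by (auto simp: Bseq_def)
    qed blast
    obtain n where "M \<le> real n" using real_arch_simple by blast
    with t(3)[of "Suc n"] M[of n] show False by simp
  qed
  then obtain n where n: "\<forall>t\<in>{0..1 / Suc n}. norm (G t) \<le> real n" ..
  show thesis by (rule that[of "1 / Suc n" "max 1 (real n)"]) (use n in fastforce)+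
qed

lemma bounded_on: obtains M where "1 \<le> M" "\<And>t. t \<in> {0..b} \<Longrightarrow> norm (G t) \<le> M"
proof -
  obtain \<delta> M where M: "0 < \<delta>" "1 \<le> M" "\<And>t. t \<in> {0..\<delta>} \<Longrightarrow> norm (G t) \<le> M" using bounded_near_zero by metis
  \<comment> \<open>The semigroup law peels off steps of length \<delta>; \<open>1 \<le> M\<close>
    lets a higher power absorb a shorter remaining time.\<close>
  have power: "norm (G t) \<le> M ^ Suc k" if "0 \<le> t" "t \<le> \<delta> * real (Suc k)" for t k
    using that
  proof (induction k arbitrary: t)
    case (Suc k)
    show ?case
    proof (cases "t \<le> \<delta>")
      case True
      then have "norm (G t) \<le> M ^ 1" using M(3)[of t] Suc by simp
      also have "\<dots> \<le> M ^ Suc (Suc k)" using M(2) by (intro power_increasing) auto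
      finally show ?thesis .
    next
      case False
      have "G t = G \<delta> o\<^sub>L G (t - \<delta>)" using G_add[of \<delta> "t - \<delta>"] False M(1) by simp
      then have "norm (G t) \<le> norm (G \<delta>) * norm (G (t - \<delta>))" by (simp add: norm_blinfun_compose)
      also have "\<dots> \<le> M * M ^ Suc k"
        using False Suc.prems M by (intro mult_mono Suc.IH) (auto simp: algebra_simps)
      finally show ?thesis by simp
    qed
  qed (use M(3) in simp)
  obtain k where k: "b / \<delta> \<le> real k" using real_arch_simple by blast
  then have "b \<le> \<delta> * real (Suc k)" using M(1) by (simp add: field_simps)
  then show thesis
    using power[of _ k] M(2) by (intro that[of "M ^ Suc k"]) (auto intro: one_le_power simp del: power_Suc)
qed

lemma continuous: "continuous_on {0..} (\<lambda>t. G t y)"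
  unfolding continuous_on_iff
proof (intro ballI allI impI)
  fix t e :: real assume t: "t \<in> {0..}" and e: "0 < e"
  obtain M where M: "1 \<le> M" "\<And>s. s \<in> {0..t + 1} \<Longrightarrow> norm (G s) \<le> M" using bounded_on by metis
  have "\<forall>\<^sub>F h in at_right 0. dist (G h y) y < e / M"
    using e M(1) by (intro tendstoD G_right) simp
  then obtain d where d: "0 < d" "\<And>h. 0 < h \<Longrightarrow> h < d \<Longrightarrow> dist (G h y) y < e / M"
    by (auto simp: eventually_at_right_field)
  have small: "norm (G h y - y) < e / M" if "0 \<le> h" "h < d" for h
    using d(2)[of h] that e M(1) by (cases "h = 0") (auto simp: G_zero dist_norm)
  \<comment> \<open>Factoring out the earlier of the two times treats continuity from the left and
    from the right at once, using only boundedness near \<open>t\<close>.\<close>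
  have *: "dist (G r y) (G s y) < e" if "0 \<le> s" "s \<le> r" "r - s < d" "s \<le> t + 1" for r s
  proof -
    have "G r y - G s y = G s (G (r - s) y - y)"
      using G_add_apply[of s "r - s" y] that by (simp add: blinfun.diff_right)
    then have "dist (G r y) (G s y) \<le> norm (G s) * norm (G (r - s) y - y)"
      by (simp add: dist_norm norm_blinfun)
    also have "\<dots> \<le> M * norm (G (r - s) y - y)" using that by (intro mult_right_mono M) auto
    also have "\<dots> < M * (e / M)" using small[of "r - s"] M(1) that by (intro mult_strict_left_mono) auto
    also have "\<dots> = e" using M(1) by simp
    finally show ?thesis .
  qed
  show "\<exists>d>0. \<forall>s\<in>{0..}. dist s t < d \<longrightarrow> dist (G s y) (G t y) < e"
  proof (intro exI[of _ "min d 1"] conjI ballI impI)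
    fix s :: real assume s: "s \<in> {0..}" "dist s t < min d 1"
    show "dist (G s y) (G t y) < e"
      using *[of s t] *[of t s] s t by (cases "s \<le> t") (auto simp: dist_real_def dist_commute)
  qed (use d in simp)
qed

lemma continuous_on_compose:
  assumes "continuous_on S g" "\<And>t. t \<in> S \<Longrightarrow> 0 \<le> g t"
  shows "continuous_on S (\<lambda>t. G (g t) y)"
  using continuous_on_compose2[OF continuous assms(1)] assms(2) by auto

text \<open>The integrated semigroup. The Henstock-Kurzweil integral is adequate because the orbits
  are continuous.\<close>

definition V :: "real \<Rightarrow> 'a \<Rightarrow>\<^sub>L 'a" where
  "V h = Blinfun (\<lambda>y. integral {0..h} (\<lambda>s. G s y))"

lemma integrable: "0 \<le> a \<Longrightarrow> (\<lambda>s. G s y) integrable_on {a..b}"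
  by (intro integrable_continuous_interval continuous_on_subset[OF continuous]) auto

lemma V_apply: "V h y = integral {0..h} (\<lambda>s. G s y)"
proof -
  obtain M where M: "1 \<le> M" "\<And>t. t \<in> {0..h} \<Longrightarrow> norm (G t) \<le> M" using bounded_on by metis
  have "bounded_linear (\<lambda>y. integral {0..h} (\<lambda>s. G s y))"
  proof (rule bounded_linear_intro)
    show "integral {0..h} (\<lambda>s. G s (x + y)) = integral {0..h} (\<lambda>s. G s x) + integral {0..h} (\<lambda>s. G s y)" for x y
      by (simp add: blinfun.add_right integral_add integrable)
    show "integral {0..h} (\<lambda>s. G s (r *\<^sub>R x)) = r *\<^sub>R integral {0..h} (\<lambda>s. G s x)" for r x
      by (simp add: blinfun.scaleR_right)
    show "norm (integral {0..h} (\<lambda>s. G s x)) \<le> norm x * (M * \<bar>h\<bar>)" for x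
    proof (cases "0 \<le> h")
      case True
      have "norm (integral {0..h} (\<lambda>s. G s x)) \<le> (M * norm x) * (h - 0)"
      proof (rule integral_bound)
        show "norm (G t x) \<le> M * norm x" if "t \<in> {0..h}" for t
          using norm_blinfun[of "G t" x] mult_right_mono[OF M(2)[OF that] norm_ge_zero[of x]] by simp
      qed (use True in \<open>auto intro: continuous_on_subset[OF continuous]\<close>)
      with True show ?thesis by (simp add: mult_ac)
    qed (use M in \<open>simp add: mult_nonneg_nonpos\<close>)
  qed
  then show ?thesis by (simp add: V_def bounded_linear_Blinfun_apply)
qed

lemma V_zero: "V 0 y = 0" by (simp add: V_apply)

lemma V_derivative:
  assumes "0 \<le> x"
  shows "((\<lambda>h. V h y) has_vector_derivative G x y) (at x within {x..x + 1})"
proof -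
  have "((\<lambda>h. V h y) has_vector_derivative G x y) (at x within {0..x + 1})"
    unfolding V_apply using assms
    by (intro integral_has_vector_derivative continuous_on_subset[OF continuous]) auto
  then show ?thesis by (rule has_vector_derivative_within_subset) (use assms in auto)
qed

lemma V_quotient: "0 \<le> x \<Longrightarrow> ((\<lambda>h. (V (x + h) y - V x y) /\<^sub>R h) \<longlongrightarrow> G x y) (at_right 0)"
  by (rule right_difference_quotient[OF V_derivative]) auto

lemma V_quotient_zero: "((\<lambda>h. V h y /\<^sub>R h) \<longlongrightarrow> y) (at_right 0)"
  using V_quotient[of 0 y] by (simp add: V_zero G_zero)

lemma G_V:
  assumes "0 \<le> h" "0 \<le> k"
  shows "G k (V h y) = V (h + k) y - V k y"
proof -
  have "G k (V h y) = integral {0..h} (blinfun_apply (G k) \<circ> (\<lambda>s. G s y))"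
    unfolding V_apply by (intro integral_linear[symmetric] integrable blinfun.bounded_linear_right) simp
  also have "\<dots> = integral {0..h} ((\<lambda>s. G s y) \<circ> (+) k)"
    using assms by (intro integral_cong) (auto simp: G_add_apply)
  also have "\<dots> = integral {k..h + k} (\<lambda>s. G s y)"
    by (subst integral_shift_Icc_real) simp
  also have "\<dots> = V (h + k) y - V k y"
    unfolding V_apply
    using Henstock_Kurzweil_Integration.integral_combine[of 0 k "h + k" "\<lambda>s. G s y"] assms
    by (simp add: integrable eq_diff_eq add.commute)
  finally show ?thesis .
qed

text \<open>By the semigroup law \<open>G k (V h y) - V h y\<close> is the difference of two
  integrals over intervals of length \<open>k\<close>, starting at \<open>h\<close> and at
  0.\<close>

lemma V_in_domain:
  assumes "0 \<le> h"
  shows "((\<lambda>k. (G k (V h y) - V h y) /\<^sub>R k) \<longlongrightarrow> G h y - y) (at_right 0)"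
proof -
  have "((\<lambda>k. (V (h + k) y - V h y) /\<^sub>R k - V k y /\<^sub>R k) \<longlongrightarrow> G h y - y) (at_right 0)"
    by (intro tendsto_diff V_quotient V_quotient_zero assms)
  moreover have "\<forall>\<^sub>F k in at_right 0. (V (h + k) y - V h y) /\<^sub>R k - V k y /\<^sub>R k = (G k (V h y) - V h y) /\<^sub>R k"
    unfolding eventually_at_right_field
    by (intro exI[of _ 1]) (simp add: G_V assms algebra_simps)
  ultimately show ?thesis by (rule Lim_transform_eventually)
qed

end

section \<open>The generator and its domain\<close>

locale semigroup_generator =
  fixes D :: "'a::banach set" and A :: "'a \<Rightarrow> 'a" and G :: "real \<Rightarrow> 'a \<Rightarrow>\<^sub>L 'a"
  assumes gen: "generates_C0_semigroup D A G"
begin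

sublocale strongly_continuous_semigroup G
  using gen by unfold_locales (simp add: generates_C0_semigroup_def)

lemma quotient: "y \<in> D \<Longrightarrow> ((\<lambda>h. (G h y - y) /\<^sub>R h) \<longlongrightarrow> A y) (at_right 0)"
  using gen by (auto simp: generates_C0_semigroup_def)

lemma domainI:
  assumes "((\<lambda>h. (G h y - y) /\<^sub>R h) \<longlongrightarrow> z) (at_right 0)"
  shows "y \<in> D" "A y = z"
proof -
  show "y \<in> D" using gen assms by (auto simp: generates_C0_semigroup_def)
  from tendsto_unique[OF _ quotient[OF this] assms] show "A y = z" by simp
qed

text \<open>The averages \<open>V h y /\<^sub>R h\<close> lie in the domain and tend to
  \<open>y\<close>.\<close>

lemma dense: "closure D = UNIV"
proof -
  have "y \<in> closure D" for y
  proof (rule Lim_in_closed_set)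
    show "((\<lambda>h. V h y /\<^sub>R h) \<longlongrightarrow> y) (at_right 0)" by (rule V_quotient_zero)
    have "V h y /\<^sub>R h \<in> D" if "0 < h" for h
    proof (rule domainI(1))
      have "((\<lambda>k. ((G k (V h y) - V h y) /\<^sub>R k) /\<^sub>R h) \<longlongrightarrow> (G h y - y) /\<^sub>R h) (at_right 0)"
        by (intro tendsto_scaleR tendsto_const V_in_domain) (use that in simp)
      then show "((\<lambda>k. (G k (V h y /\<^sub>R h) - V h y /\<^sub>R h) /\<^sub>R k) \<longlongrightarrow> (G h y - y) /\<^sub>R h) (at_right 0)"
        by (simp add: blinfun.scaleR_right scaleR_diff_right mult.commute)
    qed
    then show "\<forall>\<^sub>F h in at_right 0. V h y /\<^sub>R h \<in> closure D"
      unfolding eventually_at_right_field using closure_subset by (intro exI[of _ 1]) auto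
  qed auto
  then show ?thesis by auto
qed

lemma G_domain:
  assumes y: "y \<in> D" and t: "0 \<le> t"
  shows "G t y \<in> D" "A (G t y) = G t (A y)"
proof -
  have "((\<lambda>h. G t ((G h y - y) /\<^sub>R h)) \<longlongrightarrow> G t (A y)) (at_right 0)"
    by (intro tendsto_intros quotient y)
  moreover have "\<forall>\<^sub>F h in at_right 0. G t ((G h y - y) /\<^sub>R h) = (G h (G t y) - G t y) /\<^sub>R h"
    unfolding eventually_at_right_field
  proof (intro exI[of _ 1] conjI allI impI)
    fix h :: real assume "0 < h"
    then have "G t (G h y) = G h (G t y)"
      using G_add_apply[of t h y] G_add_apply[of h t y] t by (simp add: add.commute)
    then show "G t ((G h y - y) /\<^sub>R h) = (G h (G t y) - G t y) /\<^sub>R h"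
      by (simp add: blinfun.scaleR_right blinfun.diff_right)
  qed simp
  ultimately have "((\<lambda>h. (G h (G t y) - G t y) /\<^sub>R h) \<longlongrightarrow> G t (A y)) (at_right 0)"
    by (rule Lim_transform_eventually)
  from domainI[OF this] show "G t y \<in> D" "A (G t y) = G t (A y)" .
qed

text \<open>The generator supplies only a derivative from the right. From the left, the quotient
  between \<open>s < t\<close> is compared with the derivative at \<open>s\<close>, and continuity
  of the orbit of \<open>A y\<close> carries the result to \<open>t\<close>.\<close>

lemma derivative:
  assumes y: "y \<in> D" and t: "0 \<le> t"
  shows "((\<lambda>t. G t y) has_vector_derivative G t (A y)) (at t within {0..})"
  unfolding has_vector_derivative_def has_derivative_within_alt
proof (intro conjI allI impI)
  fix e :: real assume e: "0 < e"
  obtain M where M: "1 \<le> M" "\<And>s. s \<in> {0..t + 1} \<Longrightarrow> norm (G s) \<le> M" using bounded_on by metis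
  have "\<forall>\<^sub>F h in at_right 0. dist ((G h y - y) /\<^sub>R h) (A y) < e / (2 * M)"
    using e M(1) by (intro tendstoD quotient y) simp
  then obtain d1 where d1: "0 < d1" "\<And>h. 0 < h \<Longrightarrow> h < d1 \<Longrightarrow> dist ((G h y - y) /\<^sub>R h) (A y) < e / (2 * M)"
    by (auto simp: eventually_at_right_field)
  obtain d2 where d2: "0 < d2" "\<And>s. s \<in> {0..} \<Longrightarrow> dist s t < d2 \<Longrightarrow> dist (G s (A y)) (G t (A y)) < e / 2"
    using continuous[of "A y"] t e unfolding continuous_on_iff by (metis atLeast_iff half_gt_zero)
  have *: "norm (G r y - G s y - (r - s) *\<^sub>R G s (A y)) \<le> e / 2 * (r - s)"
    if "0 \<le> s" "s < r" "r - s < d1" "s \<le> t + 1" for r s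
  proof -
    let ?q = "(G (r - s) y - y) /\<^sub>R (r - s) - A y"
    have "G r y = G s (G (r - s) y)" using G_add_apply[of s "r - s" y] that by simp
    then have "G r y - G s y - (r - s) *\<^sub>R G s (A y) = (r - s) *\<^sub>R G s ?q"
      using that by (simp add: blinfun.diff_right blinfun.scaleR_right scaleR_diff_right)
    moreover have "norm (G s ?q) \<le> M * (e / (2 * M))"
    proof -
      have "norm (G s ?q) \<le> norm (G s) * norm ?q" by (rule norm_blinfun)
      also have "\<dots> \<le> M * (e / (2 * M))"
        using M(1) that d1(2)[of "r - s"] by (intro mult_mono M(2)) (auto simp: dist_norm)
      finally show ?thesis .
    qed
    ultimately show ?thesis using that M(1) by (simp add: mult_left_mono mult.commute)
  qed
  show "\<exists>d>0. \<forall>s\<in>{0..}. norm (s - t) < d \<longrightarrow>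
      norm (G s y - G t y - (s - t) *\<^sub>R G t (A y)) \<le> e * norm (s - t)"
  proof (intro exI[of _ "Min {d1, d2, 1}"] conjI ballI impI)
    show "0 < Min {d1, d2, 1}" using d1 d2 by simp
    fix s :: real assume s: "s \<in> {0..}" "norm (s - t) < Min {d1, d2, 1}"
    consider "s = t" | "t < s" | "s < t" by linarith
    then show "norm (G s y - G t y - (s - t) *\<^sub>R G t (A y)) \<le> e * norm (s - t)"
    proof cases
      case 2
      then have "norm (G s y - G t y - (s - t) *\<^sub>R G t (A y)) \<le> e / 2 * (s - t)" using s t by (intro *) auto
      also have "\<dots> \<le> e * (s - t)" using e 2 by (intro mult_right_mono) auto
      finally show ?thesis using 2 by simp
    next
      case 3
      have "norm (G t y - G s y - (t - s) *\<^sub>R G s (A y)) \<le> e / 2 * (t - s)" using 3 s t by (intro *) auto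
      moreover have "norm ((t - s) *\<^sub>R (G s (A y) - G t (A y))) \<le> (t - s) * (e / 2)"
        using d2(2)[of s] s 3 by (simp add: dist_norm mult_left_mono)
      moreover have "G s y - G t y - (s - t) *\<^sub>R G t (A y) =
          - (G t y - G s y - (t - s) *\<^sub>R G s (A y)) - (t - s) *\<^sub>R (G s (A y) - G t (A y))"
        by (simp add: algebra_simps)
      ultimately have "norm (G s y - G t y - (s - t) *\<^sub>R G t (A y)) \<le> e / 2 * (t - s) + (t - s) * (e / 2)"
        using norm_triangle_ineq4[of "- (G t y - G s y - (t - s) *\<^sub>R G s (A y))" "(t - s) *\<^sub>R (G s (A y) - G t (A y))"]
        by (simp only: norm_minus_cancel)
      with 3 show ?thesis by (simp add: algebra_simps)
    qed simp
  qed
qed (rule bounded_linear_scaleR_left)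

lemma G_minus_id:
  assumes "y \<in> D" "0 \<le> h"
  shows "G h y - y = V h (A y)"
proof -
  have "((\<lambda>s. G s (A y)) has_integral (G h y - G 0 y)) {0..h}"
    using assms
    by (intro fundamental_theorem_of_calculus has_vector_derivative_within_subset[OF derivative]) auto
  then show ?thesis by (simp add: V_apply G_zero integral_unique)
qed

end

section \<open>The adjoint semigroup\<close>

lemma adjoint_op_eqI:
  assumes dense: "closure D = UNIV" and \<psi>: "\<And>y. y \<in> D \<Longrightarrow> blinfun_apply \<phi> (A y) = blinfun_apply \<psi> y"
  shows "\<phi> \<in> adjoint_domain D A" "adjoint_op D A \<phi> = \<psi>"
proof -
  show "\<phi> \<in> adjoint_domain D A" using \<psi> by (auto simp: adjoint_domain_def)
  show "adjoint_op D A \<phi> = \<psi>"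
    unfolding adjoint_op_def
  proof (rule the_equality)
    show "\<psi>' = \<psi>" if "\<forall>y\<in>D. blinfun_apply \<phi> (A y) = blinfun_apply \<psi>' y" for \<psi>'
      using that \<psi> by (intro bounded_linear_eq_on_dense[OF dense]) auto
  qed (use \<psi> in blast)
qed

context semigroup_generator
begin

lemma adjoint_op:
  assumes "\<phi> \<in> adjoint_domain D A" "y \<in> D"
  shows "adjoint_op D A \<phi> y = \<phi> (A y)"
proof -
  obtain \<psi> where \<psi>: "\<And>y. y \<in> D \<Longrightarrow> blinfun_apply \<phi> (A y) = blinfun_apply \<psi> y"
    using assms(1) by (auto simp: adjoint_domain_def)
  then show ?thesis using adjoint_op_eqI(2)[OF dense, of \<phi> A \<psi>] assms(2) by simp
qed

text \<open>The dual form of \<open>G_minus_id\<close>, checked on the dense domain of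
  \<open>A\<close>. As \<open>norm (V h)\<close> is of order \<open>h\<close>, orbits that start in
  the adjoint domain are norm continuous at 0.\<close>

lemma adjoint_minus_id:
  assumes \<phi>: "\<phi> \<in> adjoint_domain D A" and h: "0 \<le> h"
  shows "adjoint_blinfun (G h) \<phi> - \<phi> = adjoint_op D A \<phi> o\<^sub>L V h"
proof (rule bounded_linear_eq_on_dense[OF dense])
  fix y assume y: "y \<in> D"
  have "(adjoint_blinfun (G h) \<phi> - \<phi>) y = \<phi> (G h y - y)" by (simp add: blinfun.diff_left blinfun.diff_right)
  also have "\<dots> = \<phi> (V h (A y))" using G_minus_id[OF y h] by simp
  also have "\<dots> = \<phi> (integral {0..h} (\<lambda>s. A (G s y)))"
    unfolding V_apply using y by (intro arg_cong[of _ _ \<phi>] integral_cong) (simp add: G_domain)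
  also have "\<dots> = integral {0..h} (blinfun_apply \<phi> \<circ> (\<lambda>s. A (G s y)))"
  proof (intro integral_linear[symmetric] blinfun.bounded_linear_right)
    have "(\<lambda>s. G s (A y)) integrable_on {0..h}" by (rule integrable) simp
    then show "(\<lambda>s. A (G s y)) integrable_on {0..h}"
      by (rule integrable_eq) (use y in \<open>simp add: G_domain\<close>)
  qed
  also have "\<dots> = integral {0..h} (blinfun_apply (adjoint_op D A \<phi>) \<circ> (\<lambda>s. G s y))"
    using y by (intro integral_cong) (simp add: adjoint_op[OF \<phi>] G_domain)
  also have "\<dots> = adjoint_op D A \<phi> (V h y)"
    unfolding V_apply by (intro integral_linear blinfun.bounded_linear_right integrable) simp
  finally show "(adjoint_blinfun (G h) \<phi> - \<phi>) y = (adjoint_op D A \<phi> o\<^sub>L V h) y" by simp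
qed

lemma norm_adjoint: "norm (adjoint_blinfun (G h) \<phi>) \<le> norm (G h) * norm \<phi>"
  by (simp add: norm_blinfun_compose mult.commute)

lemma V_norm_le:
  obtains M where "1 \<le> M" "\<And>h. h \<in> {0..b} \<Longrightarrow> norm (V h) \<le> M * h"
proof -
  obtain M where M: "1 \<le> M" "\<And>t. t \<in> {0..b} \<Longrightarrow> norm (G t) \<le> M" using bounded_on by metis
  have "norm (V h) \<le> M * h" if h: "h \<in> {0..b}" for h
  proof (rule norm_blinfun_bound)
    fix x
    have "norm (integral {0..h} (\<lambda>s. G s x)) \<le> (M * norm x) * (h - 0)"
    proof (rule integral_bound)
      show "norm (G t x) \<le> M * norm x" if "t \<in> {0..h}" for t
        using norm_blinfun[of "G t" x] mult_right_mono[OF M(2)[of t] norm_ge_zero[of x]] that h by simp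
    qed (use h in \<open>auto intro: continuous_on_subset[OF continuous]\<close>)
    then show "norm (V h x) \<le> M * h * norm x" by (simp add: V_apply mult_ac)
  qed (use M h in simp)
  with M(1) show thesis by (rule that)
qed

text \<open>A separating functional is, by reflexivity, evaluation at some \<open>y\<close>. Every
  \<open>\<psi> o\<^sub>L V h\<close> belongs to the adjoint domain, so \<open>V h y = 0\<close> for
  all \<open>h > 0\<close>, and division by \<open>h\<close> gives \<open>y = 0\<close> in the
  limit.\<close>

lemma adjoint_dense:
  assumes refl: "reflexive_space TYPE('a)"
  shows "closure (adjoint_domain D A) = UNIV"
proof (rule ccontr)
  assume "closure (adjoint_domain D A) \<noteq> UNIV"
  then obtain \<phi> where \<phi>: "\<phi> \<notin> closure (adjoint_domain D A)" by auto
  have "subspace (adjoint_domain D A)"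
  proof (rule subspaceI)
    show "0 \<in> adjoint_domain D A" by (auto simp: adjoint_domain_def intro!: exI[of _ 0])
    fix x y :: "'a \<Rightarrow>\<^sub>L real" and c :: real assume x: "x \<in> adjoint_domain D A"
    then obtain x' where x': "\<forall>z\<in>D. blinfun_apply x (A z) = blinfun_apply x' z" by (auto simp: adjoint_domain_def)
    then show "c *\<^sub>R x \<in> adjoint_domain D A"
      unfolding adjoint_domain_def by (auto simp: blinfun.scaleR_left intro!: exI[of _ "c *\<^sub>R x'"])
    assume "y \<in> adjoint_domain D A"
    then obtain y' where "\<forall>z\<in>D. blinfun_apply y (A z) = blinfun_apply y' z" by (auto simp: adjoint_domain_def)
    with x' show "x + y \<in> adjoint_domain D A"
      unfolding adjoint_domain_def by (auto simp: blinfun.add_left intro!: exI[of _ "x' + y'"])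
  qed
  then obtain \<Lambda> :: "('a \<Rightarrow>\<^sub>L real) \<Rightarrow>\<^sub>L real"
    where \<Lambda>: "\<And>v. v \<in> adjoint_domain D A \<Longrightarrow> \<Lambda> v = 0" "\<Lambda> \<phi> = 1"
    using separating_functional[OF _ \<phi>] by metis
  obtain y where y: "\<Lambda> = bidual_embedding y" using refl by (auto simp: reflexive_space_def)
  have V0: "V h y = 0" if h: "0 < h" for h
  proof (rule functional_eqI)
    fix \<psi> :: "'a \<Rightarrow>\<^sub>L real"
    have "(\<psi> o\<^sub>L V h) (A z) = (\<psi> o\<^sub>L (G h - id_blinfun)) z" if "z \<in> D" for z
      using G_minus_id[OF that, of h] h by (simp add: blinfun.diff_left)
    then have "\<psi> o\<^sub>L V h \<in> adjoint_domain D A" unfolding adjoint_domain_def by blast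
    then show "\<psi> (V h y) = \<psi> 0" using \<Lambda>(1)[of "\<psi> o\<^sub>L V h"] y by simp
  qed
  have "((\<lambda>h. V h y /\<^sub>R h) \<longlongrightarrow> 0) (at_right 0)"
    by (rule tendsto_eventually) (auto simp: eventually_at_right_field V0 intro!: exI[of _ 1])
  with V_quotient_zero[of y] have "y = 0" by (intro tendsto_unique[of "at_right (0::real)"]) auto
  with \<Lambda>(2) y show False by simp
qed

text \<open>Reflexivity enters through the norm density of the domain of the adjoint operator.\<close>

lemma adjoint_C0:
  assumes refl: "reflexive_space TYPE('a)"
  shows "C0_semigroup (\<lambda>t. adjoint_blinfun (G t))"
  unfolding C0_semigroup_def
proof (intro conjI allI impI)
  show "adjoint_blinfun (G 0) = id_blinfun" by (rule blinfun_eqI, rule blinfun_eqI) (simp add: G_zero)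
  show "adjoint_blinfun (G (s + t)) = adjoint_blinfun (G s) o\<^sub>L adjoint_blinfun (G t)" if "0 \<le> s" "0 \<le> t" for s t
    using G_add_apply[of t s] that by (intro blinfun_eqI) (simp add: add.commute)
  fix \<phi> :: "'a \<Rightarrow>\<^sub>L real"
  obtain M where M: "1 \<le> M" "\<And>t. t \<in> {0..1} \<Longrightarrow> norm (G t) \<le> M" using bounded_on by metis
  obtain M' where M': "1 \<le> M'" "\<And>t. t \<in> {0..1} \<Longrightarrow> norm (V t) \<le> M' * t" using V_norm_le by metis
  show "((\<lambda>t. adjoint_blinfun (G t) \<phi>) \<longlongrightarrow> \<phi>) (at_right 0)"
  proof (rule tendstoI)
    fix e :: real assume e: "0 < e"
    have "0 < e / (2 * (M + 1))" using e M(1) by simp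
    moreover have "\<phi> \<in> closure (adjoint_domain D A)" using adjoint_dense[OF refl] by simp
    ultimately obtain \<eta> where \<eta>: "\<eta> \<in> adjoint_domain D A" "dist \<eta> \<phi> < e / (2 * (M + 1))"
      unfolding closure_approachable by blast
    define \<psi> where "\<psi> = adjoint_op D A \<eta>"
    \<comment> \<open>This bound on \<open>h\<close> makes the middle term of the splitting below at
      most \<open>e / 2\<close>; the summand 1 avoids a division by zero.\<close>
    define d where "d = min 1 (e / (2 * M' * (norm \<psi> + 1)))"
    have d: "0 < d" using e M'(1) by (auto simp: d_def intro!: divide_pos_pos mult_pos_pos add_nonneg_pos)
    have "dist (adjoint_blinfun (G h) \<phi>) \<phi> < e" if h: "0 < h" "h < d" for h
    proof -
      have h1: "h \<in> {0..1}" using h by (simp add: d_def)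
      have "adjoint_blinfun (G h) \<phi> - \<phi> =
          adjoint_blinfun (G h) (\<phi> - \<eta>) + (adjoint_blinfun (G h) \<eta> - \<eta>) + (\<eta> - \<phi>)"
        by (simp add: blinfun.diff_right)
      then have "dist (adjoint_blinfun (G h) \<phi>) \<phi> =
          norm (adjoint_blinfun (G h) (\<phi> - \<eta>) + (adjoint_blinfun (G h) \<eta> - \<eta>) + (\<eta> - \<phi>))"
        by (simp only: dist_norm)
      then have "dist (adjoint_blinfun (G h) \<phi>) \<phi> \<le>
          norm (adjoint_blinfun (G h) (\<phi> - \<eta>)) + norm (adjoint_blinfun (G h) \<eta> - \<eta>) + norm (\<eta> - \<phi>)"
        using norm_triangle_ineq[of "adjoint_blinfun (G h) (\<phi> - \<eta>) + (adjoint_blinfun (G h) \<eta> - \<eta>)" "\<eta> - \<phi>"]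
          norm_triangle_ineq[of "adjoint_blinfun (G h) (\<phi> - \<eta>)" "adjoint_blinfun (G h) \<eta> - \<eta>"]
        by linarith
      also have "norm (adjoint_blinfun (G h) (\<phi> - \<eta>)) \<le> M * norm (\<phi> - \<eta>)"
        using norm_adjoint[of h "\<phi> - \<eta>"] mult_right_mono[OF M(2)[OF h1] norm_ge_zero[of "\<phi> - \<eta>"]] by linarith
      also have "norm (adjoint_blinfun (G h) \<eta> - \<eta>) \<le> e / 2"
      proof -
        have "adjoint_blinfun (G h) \<eta> - \<eta> = \<psi> o\<^sub>L V h"
          using adjoint_minus_id[OF \<eta>(1), of h] h by (simp add: \<psi>_def)
        then have "norm (adjoint_blinfun (G h) \<eta> - \<eta>) \<le> norm \<psi> * norm (V h)"
          by (simp only: norm_blinfun_compose)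
        also have "\<dots> \<le> (norm \<psi> + 1) * (M' * h)" using M'(2)[OF h1] by (intro mult_mono) auto
        also have "\<dots> \<le> (norm \<psi> + 1) * (M' * (e / (2 * M' * (norm \<psi> + 1))))"
          using h M'(1) by (intro mult_left_mono) (auto simp: d_def)
        also have "\<dots> = e / 2"
        proof -
          have *: "a * (b * (e / (2 * b * a))) = e / 2" if "a \<noteq> 0" "b \<noteq> 0" for a b :: real
            using that by (simp add: field_simps)
          show ?thesis
          proof (rule *)
            show "norm \<psi> + 1 \<noteq> 0" using norm_ge_zero[of \<psi>] by linarith
          qed (use M'(1) in simp)
        qed
        finally show ?thesis .
      qed
      also have "M * norm (\<phi> - \<eta>) + e / 2 + norm (\<eta> - \<phi>) = (M + 1) * dist \<eta> \<phi> + e / 2"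
        by (simp add: dist_norm norm_minus_commute algebra_simps)
      also have "\<dots> < (M + 1) * (e / (2 * (M + 1))) + e / 2"
        using \<eta>(2) M(1) by (intro add_strict_right_mono mult_strict_left_mono) auto
      also have "\<dots> = e" using M(1) by (simp add: field_simps)
      finally show ?thesis by simp
    qed
    then show "\<forall>\<^sub>F h in at_right 0. dist (adjoint_blinfun (G h) \<phi>) \<phi> < e"
      unfolding eventually_at_right_field using d by blast
  qed
qed

text \<open>For \<phi> in the adjoint domain the increment of its orbit is an integral of the orbit
  of its image, and dividing by \<open>h\<close> gives a limit in norm. Conversely, a limit of the
  quotients is tested against vectors of \<open>D\<close>, which exhibits it as the value of the
  adjoint operator.\<close>

theorem adjoint_generates:
  assumes refl: "reflexive_space TYPE('a)"
  shows "generates_C0_semigroup (adjoint_domain D A) (adjoint_op D A) (\<lambda>t. adjoint_blinfun (G t))"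
proof -
  interpret H: strongly_continuous_semigroup "\<lambda>t. adjoint_blinfun (G t)"
    by unfold_locales (rule adjoint_C0[OF refl])
  have domain: "((\<lambda>h. (adjoint_blinfun (G h) \<phi> - \<phi>) /\<^sub>R h) \<longlongrightarrow> adjoint_op D A \<phi>) (at_right 0)"
    if \<phi>: "\<phi> \<in> adjoint_domain D A" for \<phi>
  proof -
    have "H.V h (adjoint_op D A \<phi>) = adjoint_blinfun (G h) \<phi> - \<phi>" if h: "0 < h" for h
    proof (rule blinfun_eqI)
      fix y
      have "H.V h (adjoint_op D A \<phi>) y =
          integral {0..h} ((\<lambda>\<psi>. blinfun_apply \<psi> y) \<circ> (\<lambda>s. adjoint_blinfun (G s) (adjoint_op D A \<phi>)))"
        unfolding H.V_apply by (intro integral_linear[symmetric] H.integrable blinfun.bounded_linear_left) simp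
      also have "\<dots> = integral {0..h} (blinfun_apply (adjoint_op D A \<phi>) \<circ> (\<lambda>s. G s y))"
        by (simp add: o_def)
      also have "\<dots> = adjoint_op D A \<phi> (V h y)"
        unfolding V_apply by (intro integral_linear blinfun.bounded_linear_right integrable) simp
      finally show "H.V h (adjoint_op D A \<phi>) y = (adjoint_blinfun (G h) \<phi> - \<phi>) y"
        using adjoint_minus_id[OF \<phi>, of h] h by simp
    qed
    then have "\<forall>\<^sub>F h in at_right 0. H.V h (adjoint_op D A \<phi>) /\<^sub>R h = (adjoint_blinfun (G h) \<phi> - \<phi>) /\<^sub>R h"
      unfolding eventually_at_right_field by (intro exI[of _ 1]) simp
    with H.V_quotient_zero[of "adjoint_op D A \<phi>"] show ?thesis by (rule Lim_transform_eventually)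
  qed
  have "\<phi> \<in> adjoint_domain D A"
    if \<psi>: "((\<lambda>h. (adjoint_blinfun (G h) \<phi> - \<phi>) /\<^sub>R h) \<longlongrightarrow> \<psi>) (at_right 0)" for \<phi> \<psi> :: "'a \<Rightarrow>\<^sub>L real"
  proof (rule adjoint_op_eqI(1)[OF dense])
    fix y assume y: "y \<in> D"
    have "((\<lambda>h. \<phi> ((G h y - y) /\<^sub>R h)) \<longlongrightarrow> \<phi> (A y)) (at_right 0)"
      by (intro tendsto_intros quotient y)
    moreover have "((\<lambda>h. ((adjoint_blinfun (G h) \<phi> - \<phi>) /\<^sub>R h) y) \<longlongrightarrow> \<psi> y) (at_right 0)"
      by (intro tendsto_intros \<psi>)
    then have "((\<lambda>h. \<phi> ((G h y - y) /\<^sub>R h)) \<longlongrightarrow> \<psi> y) (at_right 0)"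
      by (simp add: blinfun.scaleR_left blinfun.diff_left blinfun.scaleR_right blinfun.diff_right)
    ultimately show "\<phi> (A y) = \<psi> y" by (intro tendsto_unique[of "at_right (0::real)"]) auto
  qed
  with domain have "adjoint_domain D A =
      {\<phi>. \<exists>\<psi>. ((\<lambda>h. (adjoint_blinfun (G h) \<phi> - \<phi>) /\<^sub>R h) \<longlongrightarrow> \<psi>) (at_right 0)}" by blast
  with domain adjoint_C0[OF refl] show ?thesis by (simp add: generates_C0_semigroup_def)
qed

text \<open>For vectors in both domains the pairing of \<open>G' r \<phi>\<close> with \<open>G (t - r) y\<close> has vanishing
  derivative in \<open>r\<close>.\<close>

lemma adjoint_semigroup_unique:
  assumes G': "generates_C0_semigroup (adjoint_domain D A) (adjoint_op D A) G'" and t: "0 \<le> t"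
  shows "G' t = adjoint_blinfun (G t)"
proof -
  interpret G': semigroup_generator "adjoint_domain D A" "adjoint_op D A" G'
    by unfold_locales (rule G')
  show ?thesis
  proof (rule bounded_linear_eq_on_dense[OF G'.dense], rule bounded_linear_eq_on_dense[OF dense])
    fix \<phi> y assume \<phi>: "\<phi> \<in> adjoint_domain D A" and y: "y \<in> D"
    let ?f = "\<lambda>r. blinfun_apply (G' r \<phi>) (G (t - r) y)"
    have "(?f has_vector_derivative 0) (at r within {0..t})" if r: "r \<in> {0..t}" for r
    proof -
      have 1: "((\<lambda>r. G' r \<phi>) has_vector_derivative G' r (adjoint_op D A \<phi>)) (at r within {0..t})"
        by (rule has_vector_derivative_within_subset[OF G'.derivative[OF \<phi>]]) (use r in auto)
      have "((\<lambda>s. G s y) has_vector_derivative G (t - r) (A y)) (at (t - r) within (\<lambda>r. t - r) ` {0..t})"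
        by (rule has_vector_derivative_within_subset[OF derivative[OF y]]) (use r in auto)
      moreover have "((\<lambda>r. t - r) has_vector_derivative - 1) (at r within {0..t})"
        by (auto intro!: derivative_eq_intros)
      ultimately have "((\<lambda>s. G s y) \<circ> (\<lambda>r. t - r) has_vector_derivative (- 1) *\<^sub>R G (t - r) (A y)) (at r within {0..t})"
        by (rule vector_diff_chain_within[rotated])
      then have 2: "((\<lambda>r. G (t - r) y) has_vector_derivative - G (t - r) (A y)) (at r within {0..t})"
        by (simp add: o_def)
      have "(?f has_vector_derivative G' r \<phi> (- G (t - r) (A y)) + G' r (adjoint_op D A \<phi>) (G (t - r) y)) (at r within {0..t})"
        by (rule bounded_bilinear.has_vector_derivative[OF bounded_bilinear_blinfun_apply 1 2])
      moreover have "G' r (adjoint_op D A \<phi>) (G (t - r) y) = G' r \<phi> (G (t - r) (A y))"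
        using adjoint_op[of "G' r \<phi>" "G (t - r) y"] G'.G_domain[OF \<phi>, of r] G_domain[OF y, of "t - r"] r by simp
      ultimately show ?thesis by (simp add: blinfun.minus_right)
    qed
    then have "(?f has_derivative (\<lambda>h. 0)) (at r within {0..t})" if "r \<in> {0..t}" for r
      using that by (simp add: has_vector_derivative_def)
    then obtain c where "\<forall>r\<in>{0..t}. ?f r = c"
      using has_derivative_zero_constant[of "{0..t}" ?f] by auto
    then have "?f t = c" "?f 0 = c" using t by (metis atLeastAtMost_iff order_refl)+
    then have "?f t = ?f 0" by simp
    then show "blinfun_apply (G' t \<phi>) y = blinfun_apply (adjoint_blinfun (G t) \<phi>) y"
      by (simp add: G_zero G'.G_zero)
  qed
qed

end

section \<open>Integrals over intervals\<close>

definition banach_integral :: "'a measure \<Rightarrow> ('a \<Rightarrow> 'b::real_normed_vector) \<Rightarrow> 'b" where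
  "banach_integral M f = (THE x. has_banach_integral M f x)"

text \<open>The two properties of Lebesgue measure on an interval on which the rest relies:
  completeness makes real strongly measurable functions Borel measurable, finiteness makes bounded
  ones integrable.\<close>

locale finite_complete_measure = complete_measure M + finite_measure M for M :: "'a measure"
begin

lemma has_banach_integral_banach_integral:
  fixes f :: "'a \<Rightarrow> 'b::banach"
  assumes "strongly_measurable M f" "(\<integral>\<^sup>+x. norm (f x) \<partial>M) < \<infinity>"
  shows "has_banach_integral M f (banach_integral M f)"
proof -
  obtain x where "has_banach_integral M f x" using has_banach_integral_exists[OF assms] .
  then show ?thesis
    unfolding banach_integral_def by (rule theI) (rule has_banach_integral_unique[OF _ \<open>has_banach_integral M f x\<close>])
qed

lemma banach_integral_eq: "has_banach_integral M f x \<Longrightarrow> banach_integral M f = x"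
  unfolding banach_integral_def using has_banach_integral_unique by (intro the_equality)

lemma nn_integral_bounded:
  assumes "AE x in M. f x \<le> ennreal c" "0 \<le> c"
  shows "(\<integral>\<^sup>+x. f x \<partial>M) \<le> ennreal (c * measure M (space M))"
proof -
  have "(\<integral>\<^sup>+x. f x \<partial>M) \<le> (\<integral>\<^sup>+x. ennreal c \<partial>M)" using assms(1) by (rule nn_integral_mono_AE)
  also have "\<dots> = ennreal (c * measure M (space M))"
    using assms(2) by (simp add: emeasure_eq_measure ennreal_mult)
  finally show ?thesis .
qed

lemma nn_integral_norm_bounded:
  assumes "AE x in M. norm (f x) \<le> c" "0 \<le> c"
  shows "(\<integral>\<^sup>+x. norm (f x) \<partial>M) \<le> ennreal (c * measure M (space M))"
  by (rule nn_integral_bounded[OF _ assms(2)]) (use assms(1) in \<open>auto intro: ennreal_leI elim: eventually_mono\<close>)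

lemma has_banach_integral_bounded:
  fixes f :: "'a \<Rightarrow> 'b::banach"
  assumes f: "strongly_measurable M f" and c: "AE x in M. norm (f x) \<le> c"
  shows "has_banach_integral M f (banach_integral M f)"
proof (rule has_banach_integral_banach_integral[OF f])
  have "AE x in M. norm (f x) \<le> max 0 c" using c by eventually_elim simp
  then have "(\<integral>\<^sup>+x. norm (f x) \<partial>M) \<le> ennreal (max 0 c * measure M (space M))"
    by (rule nn_integral_norm_bounded) simp
  also have "\<dots> < \<infinity>" by simp
  finally show "(\<integral>\<^sup>+x. norm (f x) \<partial>M) < \<infinity>" .
qed

lemma integrable_strongly_measurable_bounded:
  fixes f :: "'a \<Rightarrow> real"
  assumes "strongly_measurable M f" "AE x in M. \<bar>f x\<bar> \<le> c"
  shows "integrable M f"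
  using assms borel_measurable_strongly_measurable by (intro integrable_const_bound[of f c]) auto

end

text \<open>Strong measurability is insensitive to null sets, and for real functions on a complete
  measure space it coincides with Borel measurability.\<close>

lemma (in complete_measure) borel_measurable_cong_AE_real:
  fixes f g :: "'a \<Rightarrow> real"
  assumes f: "f \<in> borel_measurable M" and AE: "AE x in M. f x = g x"
  shows "g \<in> borel_measurable M"
proof -
  obtain Q :: "real set" where Q: "countable Q" "UNIV \<subseteq> closure Q" using separable[of UNIV] by metis
  have "strongly_measurable M f" by (rule borel_measurable_imp_strongly_measurable[OF f Q(1)]) (use Q in auto)
  then show ?thesis using AE by (rule borel_measurable_strongly_measurable[OF strongly_measurable_cong_AE])
qed

lemma (in complete_measure) integral_cong_AE_complete:
  fixes f g :: "'a \<Rightarrow> real"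
  assumes "f \<in> borel_measurable M" "AE x in M. f x = g x"
  shows "(\<integral>x. f x \<partial>M) = (\<integral>x. g x \<partial>M)"
  by (rule integral_cong_AE[OF assms(1) borel_measurable_cong_AE_real[OF assms] assms(2)])

lemma finite_complete_measure_interval: "finite_complete_measure (lebesgue_on {a..b::real})"
proof -
  interpret complete_measure "lebesgue_on {a..b}" by (rule complete_measure_lebesgue_on) simp
  interpret finite_measure "lebesgue_on {a..b}" by (rule finite_measure_lebesgue_on) simp
  show ?thesis by unfold_locales
qed

lemma AE_interval_subset:
  fixes a b c d :: real
  assumes "AE x in lebesgue_on {a..b}. P x" "{c..d} \<subseteq> {a..b}"
  shows "AE x in lebesgue_on {c..d}. P x"
  using assms(1) unfolding AE_restrict_space_iff[of "{a..b}" lebesgue, simplified]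
    AE_restrict_space_iff[of "{c..d}" lebesgue, simplified]
  by eventually_elim (use assms(2) in auto)

lemma interval_in_sets_lebesgue_on:
  fixes a b c d :: real
  shows "{c..d} \<subseteq> {a..b} \<Longrightarrow> {c..d} \<in> sets (lebesgue_on {a..b})"
  by (subst sets_restrict_space_iff) auto

lemma strongly_measurable_interval_subset:
  fixes a b c d :: real
  assumes "strongly_measurable (lebesgue_on {a..b}) f" "{c..d} \<subseteq> {a..b}"
  shows "strongly_measurable (lebesgue_on {c..d}) f"
  using strongly_measurable_restrict_space[OF assms(1) interval_in_sets_lebesgue_on[OF assms(2)]]
    lebesgue_on_restrict[OF assms(2)] by metis

lemma strongly_measurable_everywhere_bounded:
  fixes f :: "'a \<Rightarrow> 'b::real_normed_vector"
  assumes M: "complete_measure M" and f: "strongly_measurable M f" and c: "AE x in M. norm (f x) \<le> c" "0 \<le> c"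
  obtains s g where "\<And>i. simple_function M (s i)" "\<And>x. x \<in> space M \<Longrightarrow> (\<lambda>i::nat. s i x) \<longlonglongrightarrow> g x"
    "AE x in M. f x = g x" "\<And>x. norm (g x) \<le> c"
proof -
  interpret complete_measure M by (rule M)
  obtain s g where s: "\<And>i. simple_function M (s i)" "\<And>x. x \<in> space M \<Longrightarrow> (\<lambda>i::nat. s i x) \<longlonglongrightarrow> g x"
    and g: "AE x in M. f x = g x"
    using strongly_measurable_everywhere[OF f] by metis
  have "strongly_measurable M g" using f g by (rule strongly_measurable_cong_AE)
  then have gm: "(\<lambda>x. norm (g x)) \<in> borel_measurable M" by (rule norm_strongly_measurable)
  show thesis
  \<comment> \<open>Cutting off by the norm of the limit, rather than of the approximants, preserves
    the convergence.\<close>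
  proof (rule that[of "\<lambda>i x. if norm (g x) \<le> c then s i x else 0" "\<lambda>x. if norm (g x) \<le> c then g x else 0"])
    show "simple_function M (\<lambda>x. if norm (g x) \<le> c then s i x else 0)" for i
      using s(1) gm by (intro simple_function_If) (auto intro!: borel_measurable_le)
    show "(\<lambda>i. if norm (g x) \<le> c then s i x else 0) \<longlonglongrightarrow> (if norm (g x) \<le> c then g x else 0)"
      if "x \<in> space M" for x
      using s(2)[OF that] by simp
    show "AE x in M. f x = (if norm (g x) \<le> c then g x else 0)"
      using g c(1) by eventually_elim simp
  qed (use c in auto)
qed

section \<open>Exchange of integrals over a triangle\<close>

lemma measurable_simple_function_count_space:
  "simple_function M s \<Longrightarrow> s \<in> measurable M (count_space (s ` space M))"
  by (subst measurable_count_space_eq2) (auto simp: simple_function_def)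

text \<open>The obstacle is joint measurability: the product measure need not be complete, and
  \<open>K\<close> is only strongly continuous. Therefore \<open>g\<close> and \<open>h\<close> are
  replaced by everywhere limits of simple functions, for which the integrand reduces to finitely
  many fixed functionals and vectors.\<close>

lemma fubini_triangle:
  fixes g :: "real \<Rightarrow> 'a::real_normed_vector \<Rightarrow>\<^sub>L real" and K :: "real \<Rightarrow> 'b::real_normed_vector \<Rightarrow>\<^sub>L 'a"
  assumes g: "strongly_measurable (lebesgue_on {a..b}) g" "AE r in lebesgue_on {a..b}. norm (g r) \<le> c"
    and h: "strongly_measurable (lebesgue_on {a..b}) h" "AE q in lebesgue_on {a..b}. norm (h q) \<le> d"
    and K: "\<And>x. continuous_on {0..} (\<lambda>t. K t x)" "\<And>t. t \<in> {0..b - a} \<Longrightarrow> norm (K t) \<le> m"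
  shows "(\<integral>r. (\<integral>q. g r (K (r - q) (h q)) \<partial>lebesgue_on {a..r}) \<partial>lebesgue_on {a..b}) =
    (\<integral>q. (\<integral>r. g r (K (r - q) (h q)) \<partial>lebesgue_on {q..b}) \<partial>lebesgue_on {a..b})"
proof (cases "a \<le> b")
  case False
  then have "{a..b} = {}" by simp
  then show ?thesis by (simp only: integral_lebesgue_on_empty)
next
  case True
  let ?M = "lebesgue_on {a..b}"
  interpret finite_complete_measure ?M by (rule finite_complete_measure_interval)
  interpret P: pair_sigma_finite ?M ?M ..
  have cp: "complete_measure ?M" ..
  define c' d' where "c' = max 0 c" "d' = max 0 d"
  have m: "0 \<le> m" using K(2)[of 0] True norm_ge_zero[of "K 0"] by (auto simp del: norm_ge_zero)
  obtain s g' where s: "\<And>i. simple_function ?M (s i)" "\<And>x. x \<in> space ?M \<Longrightarrow> (\<lambda>i::nat. s i x) \<longlonglongrightarrow> g' x"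
    and g': "AE x in ?M. g x = g' x" "\<And>x. norm (g' x) \<le> c'"
    by (rule strongly_measurable_everywhere_bounded[OF cp g(1), of c'])
      (use g(2) in \<open>auto simp: c'_d'_def elim: eventually_mono\<close>)
  obtain u h' where u: "\<And>i. simple_function ?M (u i)" "\<And>x. x \<in> space ?M \<Longrightarrow> (\<lambda>i::nat. u i x) \<longlonglongrightarrow> h' x"
    and h': "AE x in ?M. h x = h' x" "\<And>x. norm (h' x) \<le> d'"
    by (rule strongly_measurable_everywhere_bounded[OF cp h(1), of d'])
      (use h(2) in \<open>auto simp: c'_d'_def elim: eventually_mono\<close>)
  \<comment> \<open>\<open>max 0\<close> keeps the argument of \<open>K\<close> where it is
    continuous on the whole square; the indicator then discards the part with
    \<open>q > r\<close>.\<close>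
  define F where "F r q = indicat_real {..r} q * g' r (K (max 0 (r - q)) (h' q))" for r q
  have fst_meas: "fst \<in> borel_measurable (?M \<Otimes>\<^sub>M ?M)" and snd_meas: "snd \<in> borel_measurable (?M \<Otimes>\<^sub>M ?M)"
    using measurable_compose[OF measurable_fst id_borel_measurable_lebesgue_on, of "{a..b}" ?M]
      measurable_compose[OF measurable_snd id_borel_measurable_lebesgue_on, of ?M "{a..b}"]
    by (simp_all add: id_def)
  have ind_meas: "(\<lambda>p. indicat_real {..fst p} (snd p)) \<in> borel_measurable (?M \<Otimes>\<^sub>M ?M)"
  proof -
    have "{p \<in> space (?M \<Otimes>\<^sub>M ?M). snd p \<le> fst p} \<in> sets (?M \<Otimes>\<^sub>M ?M)"
      using snd_meas fst_meas by (rule borel_measurable_le)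
    then have "(\<lambda>p. if snd p \<le> fst p then 1 else 0 :: real) \<in> borel_measurable (?M \<Otimes>\<^sub>M ?M)"
      by (intro measurable_If) auto
    moreover have "indicat_real {..fst p} (snd p) = (if snd p \<le> fst p then 1 else 0)" for p :: "real \<times> real"
      by (simp add: indicator_def)
    ultimately show ?thesis by (simp only:)
  qed
  have K_meas: "(\<lambda>p. blinfun_apply \<alpha> (K (max 0 (fst p - snd p)) x)) \<in> borel_measurable (?M \<Otimes>\<^sub>M ?M)" for \<alpha> x
  proof -
    have "continuous_on UNIV (\<lambda>t. K (max 0 t) x)"
      by (rule continuous_on_compose2[OF K(1)]) (auto intro!: continuous_intros)
    then have "(\<lambda>t. blinfun_apply \<alpha> (K (max 0 t) x)) \<in> borel_measurable borel"
      by (intro borel_measurable_continuous_onI bounded_linear.continuous_on[OF blinfun.bounded_linear_right])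
    from measurable_compose[OF borel_measurable_diff[OF fst_meas snd_meas] this] show ?thesis .
  qed
  have F_meas: "(\<lambda>p. F (fst p) (snd p)) \<in> borel_measurable (?M \<Otimes>\<^sub>M ?M)"
  proof (rule borel_measurable_LIMSEQ_real)
    fix i
    have s_meas: "(\<lambda>p. s i (fst p)) \<in> measurable (?M \<Otimes>\<^sub>M ?M) (count_space (s i ` space ?M))"
      using measurable_compose[OF measurable_fst measurable_simple_function_count_space[OF s(1)]] .
    have u_meas: "(\<lambda>p. u i (snd p)) \<in> measurable (?M \<Otimes>\<^sub>M ?M) (count_space (u i ` space ?M))"
      using measurable_compose[OF measurable_snd measurable_simple_function_count_space[OF u(1)]] .
    have "(\<lambda>p. blinfun_apply (s i (fst p)) (K (max 0 (fst p - snd p)) (u i (snd p)))) \<in> borel_measurable (?M \<Otimes>\<^sub>M ?M)"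
    proof (rule measurable_compose_countable'[OF _ s_meas])
      show "countable (s i ` space ?M)" using s(1)[of i] by (auto simp: simple_function_def intro: countable_finite)
      fix \<alpha>
      show "(\<lambda>p. blinfun_apply \<alpha> (K (max 0 (fst p - snd p)) (u i (snd p)))) \<in> borel_measurable (?M \<Otimes>\<^sub>M ?M)"
        by (rule measurable_compose_countable'[OF K_meas u_meas])
          (use u(1)[of i] in \<open>auto simp: simple_function_def intro: countable_finite\<close>)
    qed
    with ind_meas show "(\<lambda>p. indicat_real {..fst p} (snd p) *
        blinfun_apply (s i (fst p)) (K (max 0 (fst p - snd p)) (u i (snd p)))) \<in> borel_measurable (?M \<Otimes>\<^sub>M ?M)"
      by (rule borel_measurable_times)
  next
    fix p assume "p \<in> space (?M \<Otimes>\<^sub>M ?M)"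
    then have "fst p \<in> space ?M" "snd p \<in> space ?M" by (auto simp: space_pair_measure)
    then show "(\<lambda>i. indicat_real {..fst p} (snd p) *
        blinfun_apply (s i (fst p)) (K (max 0 (fst p - snd p)) (u i (snd p)))) \<longlonglongrightarrow> F (fst p) (snd p)"
      unfolding F_def by (intro tendsto_intros s(2) u(2))
  qed
  have F_bound: "\<bar>F r q\<bar> \<le> c' * (m * d')" if "r \<in> {a..b}" "q \<in> {a..b}" for r q
  proof -
    have "\<bar>F r q\<bar> \<le> \<bar>g' r (K (max 0 (r - q)) (h' q))\<bar>" by (simp add: F_def indicator_def)
    also have "\<dots> \<le> norm (g' r) * norm (K (max 0 (r - q)) (h' q))"
      using norm_blinfun[of "g' r"] by simp
    also have "\<dots> \<le> c' * (m * d')"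
    proof (intro mult_mono g')
      have "norm (K (max 0 (r - q)) (h' q)) \<le> norm (K (max 0 (r - q))) * norm (h' q)" by (rule norm_blinfun)
      also have "\<dots> \<le> m * d'" using that m by (intro mult_mono K(2) h') auto
      finally show "norm (K (max 0 (r - q)) (h' q)) \<le> m * d'" .
    qed (auto simp: c'_d'_def)
    finally show ?thesis .
  qed
  interpret fin: finite_measure "?M \<Otimes>\<^sub>M ?M" by (rule finite_measure_pair_measure) unfold_locales
  have F_int: "integrable (?M \<Otimes>\<^sub>M ?M) (case_prod F)"
  proof (rule fin.integrable_const_bound)
    show "case_prod F \<in> borel_measurable (?M \<Otimes>\<^sub>M ?M)" using F_meas by (simp add: case_prod_unfold)
    show "AE p in ?M \<Otimes>\<^sub>M ?M. norm (case_prod F p) \<le> c' * (m * d')"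
      by (rule AE_I2) (auto simp: space_pair_measure intro!: F_bound)
  qed
  have inner_r: "(\<integral>q. F r q \<partial>?M) = (\<integral>q. g r (K (r - q) (h q)) \<partial>lebesgue_on {a..r})"
    if r: "r \<in> {a..b}" and gr: "g r = g' r" for r
  proof -
    have sub: "{a..r} \<subseteq> {a..b}" using r by auto
    interpret R: complete_measure "lebesgue_on {a..r}" by (rule complete_measure_lebesgue_on) simp
    have "(\<integral>q. F r q \<partial>?M) = (\<integral>q. indicator {a..r} q *\<^sub>R g' r (K (max 0 (r - q)) (h' q)) \<partial>?M)"
      by (intro Bochner_Integration.integral_cong) (auto simp: F_def indicator_def)
    also have "\<dots> = (\<integral>q. g' r (K (max 0 (r - q)) (h' q)) \<partial>lebesgue_on {a..r})"
      unfolding lebesgue_on_restrict[OF sub]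
      by (rule integral_restrict_space[symmetric]) (use interval_in_sets_lebesgue_on[OF sub] in \<open>simp only: space_lebesgue_on Int_absorb2[OF sub]\<close>)
    also have "\<dots> = (\<integral>q. g r (K (r - q) (h q)) \<partial>lebesgue_on {a..r})"
    proof (rule R.integral_cong_AE_complete)
      have "strongly_measurable ?M h'" using h(1) h'(1) by (rule strongly_measurable_cong_AE)
      then have h'_meas: "strongly_measurable (lebesgue_on {a..r}) h'" by (rule strongly_measurable_interval_subset[OF _ sub])
      have "strongly_measurable (lebesgue_on {a..r}) (\<lambda>q. K (max 0 (r - q)) x)" for x
        by (intro strongly_measurable_continuous_on continuous_on_compose2[OF K(1)]) (auto intro!: continuous_intros)
      from strongly_measurable_operator_family[OF this h'_meas]
      show "(\<lambda>q. g' r (K (max 0 (r - q)) (h' q))) \<in> borel_measurable (lebesgue_on {a..r})"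
        by (rule R.borel_measurable_strongly_measurable[OF
              strongly_measurable_blinfun_apply[OF strongly_measurable_const]])
      have "AE q in lebesgue_on {a..r}. h q = h' q" by (rule AE_interval_subset[OF h'(1) sub])
      then show "AE q in lebesgue_on {a..r}. g' r (K (max 0 (r - q)) (h' q)) = g r (K (r - q) (h q))"
        using AE_space by eventually_elim (simp add: gr)
    qed
    finally show ?thesis .
  qed
  have inner_q: "(\<integral>r. F r q \<partial>?M) = (\<integral>r. g r (K (r - q) (h q)) \<partial>lebesgue_on {q..b})"
    if q: "q \<in> {a..b}" and hq: "h q = h' q" for q
  proof -
    have sub: "{q..b} \<subseteq> {a..b}" using q by auto
    interpret R: complete_measure "lebesgue_on {q..b}" by (rule complete_measure_lebesgue_on) simp
    have "(\<integral>r. F r q \<partial>?M) = (\<integral>r. indicator {q..b} r *\<^sub>R g' r (K (max 0 (r - q)) (h' q)) \<partial>?M)"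
      by (intro Bochner_Integration.integral_cong) (auto simp: F_def indicator_def)
    also have "\<dots> = (\<integral>r. g' r (K (max 0 (r - q)) (h' q)) \<partial>lebesgue_on {q..b})"
      unfolding lebesgue_on_restrict[OF sub]
      by (rule integral_restrict_space[symmetric]) (use interval_in_sets_lebesgue_on[OF sub] in \<open>simp only: space_lebesgue_on Int_absorb2[OF sub]\<close>)
    also have "\<dots> = (\<integral>r. g r (K (r - q) (h q)) \<partial>lebesgue_on {q..b})"
    proof (rule R.integral_cong_AE_complete)
      have "strongly_measurable ?M g'" using g(1) g'(1) by (rule strongly_measurable_cong_AE)
      then have g'_meas: "strongly_measurable (lebesgue_on {q..b}) g'" by (rule strongly_measurable_interval_subset[OF _ sub])
      have K'_meas: "strongly_measurable (lebesgue_on {q..b}) (\<lambda>r. K (max 0 (r - q)) x)" for x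
        by (intro strongly_measurable_continuous_on continuous_on_compose2[OF K(1)]) (auto intro!: continuous_intros)
      show "(\<lambda>r. g' r (K (max 0 (r - q)) (h' q))) \<in> borel_measurable (lebesgue_on {q..b})"
        by (rule R.borel_measurable_strongly_measurable[OF
              strongly_measurable_blinfun_apply[OF g'_meas K'_meas]])
      have "AE r in lebesgue_on {q..b}. g r = g' r" by (rule AE_interval_subset[OF g'(1) sub])
      then show "AE r in lebesgue_on {q..b}. g' r (K (max 0 (r - q)) (h' q)) = g r (K (r - q) (h q))"
        using AE_space by eventually_elim (simp add: hq)
    qed
    finally show ?thesis .
  qed
  \<comment> \<open>The inner integrals agree where \<open>g\<close> and its replacement coincide,
    that is, for almost every \<open>r\<close>.\<close>
  have "(\<integral>r. (\<integral>q. g r (K (r - q) (h q)) \<partial>lebesgue_on {a..r}) \<partial>?M) = (\<integral>r. (\<integral>q. F r q \<partial>?M) \<partial>?M)"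
  proof (rule integral_cong_AE_complete[symmetric])
    show "(\<lambda>r. \<integral>q. F r q \<partial>?M) \<in> borel_measurable ?M"
      using borel_measurable_integrable[OF P.integrable_fst[OF F_int]] .
    show "AE r in ?M. (\<integral>q. F r q \<partial>?M) = (\<integral>q. g r (K (r - q) (h q)) \<partial>lebesgue_on {a..r})"
      using g'(1) AE_space by eventually_elim (simp add: inner_r)
  qed
  also have "\<dots> = (\<integral>q. (\<integral>r. F r q \<partial>?M) \<partial>?M)"
    by (rule P.Fubini_integral[OF F_int, symmetric])
  also have "\<dots> = (\<integral>q. (\<integral>r. g r (K (r - q) (h q)) \<partial>lebesgue_on {q..b}) \<partial>?M)"
  proof (rule integral_cong_AE_complete)
    show "(\<lambda>q. \<integral>r. F r q \<partial>?M) \<in> borel_measurable ?M"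
      using borel_measurable_integrable[OF P.integrable_snd[OF F_int]] .
    show "AE q in ?M. (\<integral>r. F r q \<partial>?M) = (\<integral>r. g r (K (r - q) (h q)) \<partial>lebesgue_on {q..b})"
      using h'(1) AE_space by eventually_elim (simp add: inner_q)
  qed
  finally show ?thesis .
qed

section \<open>The unit ball of Lp\<close>

text \<open>For finite \<open>p\<close> the integral of the power is bounded without taking its
  root, so convexity of the ball reduces to pointwise convexity of the power.\<close>

definition lp_ball :: "ennreal \<Rightarrow> 'a measure \<Rightarrow> ('a \<Rightarrow> 'b::real_normed_vector) set" where
  "lp_ball p M = {u. strongly_measurable M u \<and>
     (if p = \<infinity> then AE x in M. norm (u x) \<le> 1
      else (\<integral>\<^sup>+x. ennreal (norm (u x) powr enn2real p) \<partial>M) \<le> 1)}"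

lemma enn2real_gt_one:
  assumes "1 < p" "p \<noteq> \<infinity>"
  shows "1 < enn2real p"
  using assms by (cases p) auto

lemma conjugate_exponent_eq:
  assumes "1 < p" "p \<noteq> \<infinity>"
  shows "conjugate_exponent p = ennreal (enn2real p / (enn2real p - 1))"
proof -
  define P where "P = enn2real p"
  have P: "1 < P" "p = ennreal P" using assms enn2real_gt_one[OF assms] by (auto simp: P_def less_top)
  have "p - 1 = ennreal (P - 1)" using P by (metis ennreal_1 ennreal_minus zero_le_one)
  then show ?thesis
    using assms P by (simp add: conjugate_exponent_def divide_ennreal P_def[symmetric])
qed

lemma powr_convex_combination:
  fixes x y :: real
  assumes "1 \<le> P" "0 \<le> x" "0 \<le> y" "0 \<le> \<alpha>" "0 \<le> \<beta>" "\<alpha> + \<beta> = 1"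
  shows "(\<alpha> * x + \<beta> * y) powr P \<le> \<alpha> * x powr P + \<beta> * y powr P"
proof -
  have *: "(\<gamma> * z) powr P \<le> \<gamma> * z powr P" if "0 \<le> \<gamma>" "\<gamma> \<le> 1" "0 \<le> z" for \<gamma> z :: real
  proof (cases "\<gamma> = 0")
    case False
    have "\<gamma> powr P \<le> \<gamma> powr 1" using that assms(1) by (intro powr_mono') auto
    then show ?thesis using that by (simp add: powr_mult mult_right_mono)
  qed simp
  consider "x = 0" | "y = 0" | "0 < x" "0 < y" using assms by linarith
  then show ?thesis
  proof cases
    case 3
    then show ?thesis
      using powr_convex[OF assms(1)] assms by (auto simp: convex_on_def)
  qed (use * assms in auto)
qed

context finite_complete_measure
begin

lemma powr_norm_measurable:
  assumes "strongly_measurable M u"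
  shows "(\<lambda>x. ennreal (norm (u x) powr P)) \<in> borel_measurable M"
  using norm_strongly_measurable[OF assms] by measurable

lemma lp_ball_zero: "(\<lambda>_. 0) \<in> lp_ball p M"
  by (simp add: lp_ball_def)

lemma lp_ball_minus:
  assumes "u \<in> lp_ball p M"
  shows "(\<lambda>x. - u x) \<in> lp_ball p M"
proof -
  have "strongly_measurable M (\<lambda>x. (-1) *\<^sub>R u x)"
    using assms by (intro strongly_measurable_scaleR) (auto simp: lp_ball_def)
  with assms show ?thesis by (simp add: lp_ball_def)
qed

lemma lp_ball_convex:
  assumes p: "1 < p" and u: "u \<in> lp_ball p M" and v: "v \<in> lp_ball p M"
    and ab: "0 \<le> \<alpha>" "0 \<le> \<beta>" "\<alpha> + \<beta> = 1"
  shows "(\<lambda>x. \<alpha> *\<^sub>R u x + \<beta> *\<^sub>R v x) \<in> lp_ball p M"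
proof -
  have meas: "strongly_measurable M u" "strongly_measurable M v" using u v by (auto simp: lp_ball_def)
  then have sm: "strongly_measurable M (\<lambda>x. \<alpha> *\<^sub>R u x + \<beta> *\<^sub>R v x)"
    by (intro strongly_measurable_add strongly_measurable_scaleR) auto
  have norm: "norm (\<alpha> *\<^sub>R u x + \<beta> *\<^sub>R v x) \<le> \<alpha> * norm (u x) + \<beta> * norm (v x)" for x
    using norm_triangle_ineq[of "\<alpha> *\<^sub>R u x" "\<beta> *\<^sub>R v x"] ab by simp
  show ?thesis
  proof (cases "p = \<infinity>")
    case True
    have "AE x in M. norm (u x) \<le> 1" "AE x in M. norm (v x) \<le> 1" using u v True by (auto simp: lp_ball_def)
    then have "AE x in M. norm (\<alpha> *\<^sub>R u x + \<beta> *\<^sub>R v x) \<le> 1"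
    proof eventually_elim
      case (elim x)
      have "norm (\<alpha> *\<^sub>R u x + \<beta> *\<^sub>R v x) \<le> \<alpha> * 1 + \<beta> * 1"
        using norm[of x] mult_left_mono[OF elim(1) ab(1)] mult_left_mono[OF elim(2) ab(2)] by linarith
      with ab show ?case by simp
    qed
    with True sm show ?thesis by (simp add: lp_ball_def)
  next
    case False
    define P where "P = enn2real p"
    have P: "1 < P" using enn2real_gt_one[OF p False] by (simp add: P_def)
    have int: "(\<integral>\<^sup>+x. ennreal (norm (u x) powr P) \<partial>M) \<le> 1" "(\<integral>\<^sup>+x. ennreal (norm (v x) powr P) \<partial>M) \<le> 1"
      using u v False by (auto simp: lp_ball_def P_def)
    have "(\<integral>\<^sup>+x. ennreal (norm (\<alpha> *\<^sub>R u x + \<beta> *\<^sub>R v x) powr P) \<partial>M) \<le>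
        (\<integral>\<^sup>+x. ennreal \<alpha> * ennreal (norm (u x) powr P) + ennreal \<beta> * ennreal (norm (v x) powr P) \<partial>M)"
    proof (rule nn_integral_mono)
      fix x
      have "norm (\<alpha> *\<^sub>R u x + \<beta> *\<^sub>R v x) powr P \<le> (\<alpha> * norm (u x) + \<beta> * norm (v x)) powr P"
        using norm[of x] P by (intro powr_mono2) auto
      also have "\<dots> \<le> \<alpha> * norm (u x) powr P + \<beta> * norm (v x) powr P"
        using P ab by (intro powr_convex_combination) auto
      finally show "ennreal (norm (\<alpha> *\<^sub>R u x + \<beta> *\<^sub>R v x) powr P) \<le>
          ennreal \<alpha> * ennreal (norm (u x) powr P) + ennreal \<beta> * ennreal (norm (v x) powr P)"
        using ab by (simp add: ennreal_leI flip: ennreal_mult ennreal_plus)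
    qed
    also have "\<dots> = ennreal \<alpha> * (\<integral>\<^sup>+x. ennreal (norm (u x) powr P) \<partial>M) + ennreal \<beta> * (\<integral>\<^sup>+x. ennreal (norm (v x) powr P) \<partial>M)"
      using powr_norm_measurable[OF meas(1), of P] powr_norm_measurable[OF meas(2), of P]
      by (simp add: nn_integral_add nn_integral_cmult)
    also have "\<dots> \<le> ennreal \<alpha> * 1 + ennreal \<beta> * 1" using int by (intro add_mono mult_left_mono) auto
    also have "\<dots> = 1" using ab by (simp flip: ennreal_plus)
    finally show ?thesis using False sm by (simp add: lp_ball_def P_def)
  qed
qed

text \<open>Lets controls be handled through the ball alone: linear operations on them become convex
  combinations and scalings.\<close>

lemma Lp_space_iff_lp_ball:
  assumes p: "1 < p"
  shows "u \<in> Lp_space p M \<longleftrightarrow> (\<exists>a v. 0 < a \<and> v \<in> lp_ball p M \<and> u = (\<lambda>x. a *\<^sub>R v x))"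
proof
  assume u: "u \<in> Lp_space p M"
  then have sm: "strongly_measurable M u" by (simp add: Lp_space_def)
  have scaled: "strongly_measurable M (\<lambda>x. (1 / a) *\<^sub>R u x)" for a
    using sm by (intro strongly_measurable_scaleR) auto
  have "\<exists>a>0. (\<lambda>x. (1 / a) *\<^sub>R u x) \<in> lp_ball p M"
  proof (cases "p = \<infinity>")
    case True
    then obtain c where c: "AE x in M. norm (u x) \<le> c" using u by (auto simp: Lp_space_def)
    have "AE x in M. norm ((1 / max 1 c) *\<^sub>R u x) \<le> 1"
      using c
    proof eventually_elim
      case (elim x)
      then have "norm (u x) \<le> max 1 c" by simp
      then show ?case by (simp add: divide_le_eq)
    qed
    with True scaled show ?thesis by (intro exI[of _ "max 1 c"]) (simp add: lp_ball_def)
  next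
    case False
    define P where "P = enn2real p"
    have P: "1 < P" using enn2real_gt_one[OF p False] by (simp add: P_def)
    let ?I = "\<integral>\<^sup>+x. ennreal (norm (u x) powr P) \<partial>M"
    have fin: "?I < \<infinity>" using u False by (simp add: Lp_space_def P_def)
    \<comment> \<open>The integral itself, without its root, is a sufficient normalisation:
      \<open>(1 / a) powr P \<le> 1 / a\<close> whenever \<open>1 \<le> a\<close> and
      \<open>1 < P\<close>.\<close>
    define a where "a = max 1 (enn2real ?I)"
    have "ennreal (enn2real ?I) = ?I" using fin by (simp add: less_top)
    moreover have "ennreal (enn2real ?I) \<le> ennreal a" unfolding a_def by (intro ennreal_leI) simp
    ultimately have a: "1 \<le> a" "?I \<le> ennreal a" by (auto simp: a_def)
    have "(\<integral>\<^sup>+x. ennreal (norm ((1 / a) *\<^sub>R u x) powr P) \<partial>M) =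
        (\<integral>\<^sup>+x. ennreal ((1 / a) powr P) * ennreal (norm (u x) powr P) \<partial>M)"
      using a by (intro nn_integral_cong) (simp add: powr_divide ennreal_mult[symmetric])
    also have "\<dots> = ennreal ((1 / a) powr P) * ?I" by (intro nn_integral_cmult powr_norm_measurable sm)
    also have "\<dots> \<le> ennreal (1 / a) * ennreal a"
    proof (intro mult_mono a(2) ennreal_leI)
      have "(1 / a) powr P \<le> (1 / a) powr 1" using a P by (intro powr_mono') auto
      then show "(1 / a) powr P \<le> 1 / a" using a by simp
    qed auto
    also have "\<dots> = 1" using a by (simp flip: ennreal_mult)
    finally show ?thesis using False scaled a by (intro exI[of _ a]) (simp add: lp_ball_def P_def)
  qed
  then obtain a where "0 < a" "(\<lambda>x. (1 / a) *\<^sub>R u x) \<in> lp_ball p M" by blast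
  then show "\<exists>a v. 0 < a \<and> v \<in> lp_ball p M \<and> u = (\<lambda>x. a *\<^sub>R v x)"
    by (intro exI[of _ a] exI[of _ "\<lambda>x. (1 / a) *\<^sub>R u x"]) simp
next
  assume "\<exists>a v. 0 < a \<and> v \<in> lp_ball p M \<and> u = (\<lambda>x. a *\<^sub>R v x)"
  then obtain a v where a: "0 < a" and v: "v \<in> lp_ball p M" and u: "u = (\<lambda>x. a *\<^sub>R v x)" by blast
  have vm: "strongly_measurable M v" using v by (simp add: lp_ball_def)
  then have sm: "strongly_measurable M u" unfolding u by (intro strongly_measurable_scaleR) auto
  show "u \<in> Lp_space p M"
  proof (cases "p = \<infinity>")
    case True
    then have "AE x in M. norm (v x) \<le> 1" using v by (simp add: lp_ball_def)
    then have "AE x in M. norm (u x) \<le> a" by eventually_elim (use a in \<open>simp add: u mult_left_le\<close>)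
    with True sm show ?thesis by (auto simp: Lp_space_def)
  next
    case False
    have "(\<integral>\<^sup>+x. ennreal (norm (u x) powr enn2real p) \<partial>M) =
        (\<integral>\<^sup>+x. ennreal (a powr enn2real p) * ennreal (norm (v x) powr enn2real p) \<partial>M)"
      using a by (intro nn_integral_cong) (simp add: u powr_mult ennreal_mult[symmetric])
    also have "\<dots> = ennreal (a powr enn2real p) * (\<integral>\<^sup>+x. ennreal (norm (v x) powr enn2real p) \<partial>M)"
      by (intro nn_integral_cmult powr_norm_measurable vm)
    also have "\<dots> \<le> ennreal (a powr enn2real p) * 1"
      using v False by (intro mult_left_mono) (auto simp: lp_ball_def)
    also have "\<dots> < \<infinity>" by simp
    finally show ?thesis using False sm by (simp add: Lp_space_def)
  qed
qed

text \<open>For finite exponent \<open>P\<close> the pointwise bound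
  \<open>norm (u x) \<le> 1 + norm (u x) powr P\<close> is integrated over a finite measure.\<close>

lemma lp_ball_nn_integral_norm:
  assumes p: "1 < p" and u: "u \<in> lp_ball p M"
  shows "(\<integral>\<^sup>+x. norm (u x) \<partial>M) \<le> ennreal (measure M (space M) + 1)"
proof (cases "p = \<infinity>")
  case True
  then have "AE x in M. norm (u x) \<le> 1" using u by (simp add: lp_ball_def)
  then have "(\<integral>\<^sup>+x. norm (u x) \<partial>M) \<le> ennreal (1 * measure M (space M))"
    by (rule nn_integral_norm_bounded) simp
  also have "\<dots> \<le> ennreal (measure M (space M) + 1)" by (intro ennreal_leI) simp
  finally show ?thesis .
next
  case False
  define P where "P = enn2real p"
  have P: "1 < P" using enn2real_gt_one[OF p False] by (simp add: P_def)
  have "(\<integral>\<^sup>+x. norm (u x) \<partial>M) \<le> (\<integral>\<^sup>+x. 1 + ennreal (norm (u x) powr P) \<partial>M)"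
  proof (rule nn_integral_mono)
    fix x
    have "norm (u x) \<le> 1 + norm (u x) powr P"
    proof (cases "norm (u x) \<le> 1")
      case False
      then have "norm (u x) powr 1 \<le> norm (u x) powr P" using P by (intro powr_mono) auto
      then show ?thesis by simp
    qed (simp add: add_increasing2)
    then show "ennreal (norm (u x)) \<le> 1 + ennreal (norm (u x) powr P)"
      by (metis ennreal_1 ennreal_leI ennreal_plus powr_ge_zero zero_le_one)
  qed
  also have "\<dots> = emeasure M (space M) + (\<integral>\<^sup>+x. ennreal (norm (u x) powr P) \<partial>M)"
    using u powr_norm_measurable[of u P] by (simp add: nn_integral_add lp_ball_def)
  also have "\<dots> \<le> emeasure M (space M) + 1"
    using u False by (intro add_left_mono) (auto simp: lp_ball_def P_def)
  also have "\<dots> = ennreal (measure M (space M) + 1)" by (simp add: emeasure_eq_measure)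
  finally show ?thesis .
qed

lemma powr_norm_integrable:
  assumes w: "strongly_measurable M w" "AE x in M. norm (w x) \<le> c" and q: "0 \<le> q"
  shows "integrable M (\<lambda>x. norm (w x) powr q)"
proof (rule integrable_const_bound)
  show "AE x in M. norm (norm (w x) powr q) \<le> c powr q"
    using w(2) by eventually_elim (use q in \<open>simp add: powr_mono2\<close>)
  show "(\<lambda>x. norm (w x) powr q) \<in> borel_measurable M"
    using norm_strongly_measurable[OF w(1)] by measurable
qed

lemma Lp_norm_eq_integral:
  assumes w: "strongly_measurable M w" and q: "q \<noteq> \<infinity>"
  shows "Lp_norm q M w = (\<integral>x. norm (w x) powr enn2real q \<partial>M) powr (1 / enn2real q)"
proof -
  have "(\<lambda>x. norm (w x) powr enn2real q) \<in> borel_measurable M"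
    using norm_strongly_measurable[OF w] by measurable
  then have "(\<integral>x. norm (w x) powr enn2real q \<partial>M) = enn2real (\<integral>\<^sup>+x. ennreal (norm (w x) powr enn2real q) \<partial>M)"
    by (intro integral_eq_nn_integral) auto
  with q show ?thesis by (simp add: Lp_norm_def)
qed

lemma Lp_norm_one_eq_integral:
  assumes w: "strongly_measurable M w"
  shows "Lp_norm 1 M w = (\<integral>x. norm (w x) \<partial>M)"
  using Lp_norm_eq_integral[OF w, of 1] by (simp add: integral_nonneg_AE)

section \<open>Hoelder's inequality and its converse\<close>

lemma holder:
  fixes w :: "'a \<Rightarrow> 'b::real_normed_vector \<Rightarrow>\<^sub>L real"
  assumes p: "1 < p" and u: "u \<in> lp_ball p M"
    and w: "strongly_measurable M w" "AE x in M. norm (w x) \<le> c"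
  shows "\<bar>\<integral>x. w x (u x) \<partial>M\<bar> \<le> Lp_norm (conjugate_exponent p) M w"
proof -
  have um: "strongly_measurable M u" using u by (simp add: lp_ball_def)
  have wu: "(\<lambda>x. w x (u x)) \<in> borel_measurable M"
    using w(1) um by (intro borel_measurable_strongly_measurable strongly_measurable_blinfun_apply)
  have pointwise: "\<bar>w x (u x)\<bar> \<le> norm (w x) * norm (u x)" for x using norm_blinfun[of "w x" "u x"] by simp
  show ?thesis
  proof (cases "p = \<infinity>")
    case True
    then have u1: "AE x in M. norm (u x) \<le> 1" using u by (simp add: lp_ball_def)
    have "integrable M (\<lambda>x. norm (w x) powr 1)" by (rule powr_norm_integrable[OF w]) simp
    then have int: "integrable M (\<lambda>x. norm (w x))" by simp
    have le: "AE x in M. norm (w x (u x)) \<le> norm (w x)"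
      using u1
    proof eventually_elim
      case (elim x)
      then show ?case using pointwise[of x] mult_left_mono[OF elim norm_ge_zero[of "w x"]] by simp
    qed
    have int_wu: "integrable M (\<lambda>x. w x (u x))"
      by (rule Bochner_Integration.integrable_bound[OF int wu]) (use le in simp)
    have "\<bar>\<integral>x. w x (u x) \<partial>M\<bar> \<le> (\<integral>x. \<bar>w x (u x)\<bar> \<partial>M)" by (rule integral_abs_bound)
    also have "\<dots> \<le> (\<integral>x. norm (w x) \<partial>M)"
      using int_wu int le by (intro integral_mono_AE) auto
    finally have "\<bar>\<integral>x. w x (u x) \<partial>M\<bar> \<le> (\<integral>x. norm (w x) \<partial>M)" .
    then show ?thesis using True Lp_norm_one_eq_integral[OF w(1)] by (simp add: conjugate_exponent_def)
  next
    case False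
    define P where "P = enn2real p"
    define q where "q = P / (P - 1)"
    have P: "1 < P" using enn2real_gt_one[OF p False] by (simp add: P_def)
    then have q: "1 < q" "1 / P + 1 / q = 1" by (auto simp: q_def field_simps)
    define W where "W = (\<integral>x. norm (w x) powr q \<partial>M)"
    define N where "N = W powr (1 / q)"
    have conj: "conjugate_exponent p = ennreal q"
      unfolding q_def P_def by (rule conjugate_exponent_eq[OF p False])
    have norm_eq: "Lp_norm (conjugate_exponent p) M w = N"
      unfolding N_def W_def conj using q by (subst Lp_norm_eq_integral[OF w(1)]) auto
    have int_w: "integrable M (\<lambda>x. norm (w x) powr q)" using q by (intro powr_norm_integrable[OF w]) simp
    have um_powr: "(\<lambda>x. norm (u x) powr P) \<in> borel_measurable M"
      using norm_strongly_measurable[OF um] by measurable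
    have u1: "(\<integral>\<^sup>+x. ennreal (norm (u x) powr P) \<partial>M) \<le> 1" using u False by (simp add: lp_ball_def P_def)
    then have int_u: "integrable M (\<lambda>x. norm (u x) powr P)"
      using um_powr by (intro integrableI_nonneg) (auto intro: le_less_trans)
    have U: "(\<integral>x. norm (u x) powr P \<partial>M) \<le> 1"
      using u1 nn_integral_eq_integral[OF int_u] by simp
    have "0 \<le> W" unfolding W_def by (intro integral_nonneg_AE) simp
    show ?thesis
    proof (cases "W = 0")
      case True
      then have "AE x in M. norm (w x) powr q = 0"
        unfolding W_def using integral_nonneg_eq_0_iff_AE[OF int_w] by simp
      then have "AE x in M. w x (u x) = 0" by eventually_elim simp
      then have "(\<integral>x. w x (u x) \<partial>M) = 0" by (rule integral_eq_zero_AE)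
      then show ?thesis using norm_eq True by (simp add: N_def)
    next
      case False
      with \<open>0 \<le> W\<close> have W: "0 < W" by simp
      then have N: "0 < N" "N powr q = W" using q by (auto simp: N_def powr_powr)
      \<comment> \<open>Young's inequality with \<open>w\<close> scaled to norm one. Multiplied back
        by \<open>N\<close> and integrated, its right side is at most
        \<open>N * (1 / q + 1 / P) = N\<close>.\<close>
      let ?f = "\<lambda>x. N * (norm (w x) powr q / W / q + norm (u x) powr P / P)"
      have le: "norm (w x (u x)) \<le> ?f x" for x
      proof -
        have "(norm (w x) / N) * norm (u x) \<le> (norm (w x) / N) powr q / q + norm (u x) powr P / P"
          using Youngs_inequality[of q P "norm (w x) / N" "norm (u x)"] P q N by (simp add: add.commute)
        then have "norm (w x) / N * norm (u x) \<le> norm (w x) powr q / W / q + norm (u x) powr P / P"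
          using N by (simp add: powr_divide)
        then have "N * (norm (w x) / N * norm (u x)) \<le> ?f x" using N by (intro mult_left_mono) auto
        then show ?thesis using pointwise[of x] N by simp
      qed
      have int_f: "integrable M ?f"
        by (intro integrable_mult_right Bochner_Integration.integrable_add Bochner_Integration.integrable_divide int_w int_u)
      have int_wu: "integrable M (\<lambda>x. w x (u x))"
      proof (rule Bochner_Integration.integrable_bound[OF int_f wu])
        show "AE x in M. norm (w x (u x)) \<le> norm (?f x)"
          by (rule AE_I2) (rule order_trans[OF le], simp)
      qed
      have "\<bar>\<integral>x. w x (u x) \<partial>M\<bar> \<le> (\<integral>x. \<bar>w x (u x)\<bar> \<partial>M)" by (rule integral_abs_bound)
      also have "\<dots> \<le> (\<integral>x. ?f x \<partial>M)"
        using int_wu int_f le by (intro integral_mono) auto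
      finally have "\<bar>\<integral>x. w x (u x) \<partial>M\<bar> \<le> (\<integral>x. ?f x \<partial>M)" .
      also have "\<dots> = N * (W / W / q + (\<integral>x. norm (u x) powr P \<partial>M) / P)"
        using int_w int_u by (simp add: W_def)
      also have "\<dots> \<le> N * (1 / q + 1 / P)"
        using N W U P q by (intro mult_left_mono add_mono divide_right_mono) auto
      also have "\<dots> = N" using q by (simp add: add.commute)
      finally show ?thesis using norm_eq by simp
    qed
  qed
qed

text \<open>The constant 3/4, above the 1/2 wanted in the end, leaves room for the approximation
  error in \<open>measurable_near_norming\<close>.\<close>

lemma near_norming_vector:
  fixes \<phi> :: "'b::real_normed_vector \<Rightarrow>\<^sub>L real"
  shows "\<exists>x. norm x \<le> 1 \<and> 3 / 4 * norm \<phi> \<le> \<phi> x"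
proof (rule ccontr)
  assume "\<not> ?thesis"
  then have less: "\<phi> x < 3 / 4 * norm \<phi>" if "norm x \<le> 1" for x using that by (meson not_le)
  have pos: "0 < norm \<phi>" using less[of 0] by simp
  have "norm \<phi> \<le> 3 / 4 * norm \<phi>"
  proof (rule norm_blinfun_bound)
    fix x
    show "norm (\<phi> x) \<le> 3 / 4 * norm \<phi> * norm x"
    proof (cases "x = 0")
      case False
      have 1: "\<phi> ((1 / norm x) *\<^sub>R x) < 3 / 4 * norm \<phi>" "\<phi> (- ((1 / norm x) *\<^sub>R x)) < 3 / 4 * norm \<phi>"
        using less[of "(1 / norm x) *\<^sub>R x"] less[of "- ((1 / norm x) *\<^sub>R x)"] False by simp_all
      then have "\<bar>\<phi> x / norm x\<bar> \<le> 3 / 4 * norm \<phi>"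
        by (simp add: blinfun.scaleR_right blinfun.minus_right abs_le_iff)
      then show ?thesis using False by (simp add: field_simps)
    qed simp
  qed simp
  with pos show False by simp
qed

text \<open>The values of \<open>w\<close> are approximated by a sequence of functionals, and the first of the near
  norming vectors of that sequence that works is taken.\<close>

lemma measurable_near_norming:
  fixes w :: "'a \<Rightarrow> 'b::real_normed_vector \<Rightarrow>\<^sub>L real"
  assumes w: "strongly_measurable M w"
  obtains v where "strongly_measurable M v" "\<And>x. norm (v x) \<le> 1" "AE x in M. norm (w x) / 2 \<le> w x (v x)"
proof -
  obtain s g where s: "\<And>i. simple_function M (s i)" "\<And>x. x \<in> space M \<Longrightarrow> (\<lambda>i::nat. s i x) \<longlonglongrightarrow> g x"
    and g: "AE x in M. w x = g x"
    using strongly_measurable_everywhere[OF w] by metis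
  have sg: "strongly_measurable M g" using w g by (rule strongly_measurable_cong_AE)
  define E where "E = insert 0 (\<Union>i. s i ` space M)"
  have "countable (s i ` space M)" for i
    using simple_functionD(1)[OF s(1)] by (rule countable_finite)
  then have E: "countable E" "E \<noteq> {}" by (auto simp: E_def)
  define e where "e = from_nat_into E"
  have range_e: "range e = E" using E by (simp add: e_def)
  obtain z where z: "\<And>k. norm (z k) \<le> 1" "\<And>k. 3 / 4 * norm (e k) \<le> e k (z k)"
    using near_norming_vector[of "e _"] by metis
  define Q where "Q k x \<longleftrightarrow> norm (g x) / 2 \<le> g x (z k)" for k x
  have ex: "\<exists>k. Q k x" if x: "x \<in> space M" for x
  proof (cases "g x = 0")
    case False
    \<comment> \<open>The relative error 1/8 is small enough: \<open>3/4 * 7/8 - 1/8 = 17/32\<close>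
      still exceeds 1/2.\<close>
    with tendstoD[OF s(2)[OF x], of "norm (g x) / 8"]
    obtain i where i: "dist (s i x) (g x) < norm (g x) / 8"
      by (auto simp: eventually_sequentially)
    have "s i x \<in> E" using x by (auto simp: E_def)
    then obtain k where k: "e k = s i x" using range_e by (metis imageE)
    have "norm (e k) \<ge> norm (g x) - norm (g x) / 8"
      using i k norm_triangle_ineq2[of "g x" "e k"] by (simp add: dist_norm norm_minus_commute)
    moreover have "\<bar>(e k - g x) (z k)\<bar> \<le> norm (g x) / 8"
    proof -
      have "\<bar>(e k - g x) (z k)\<bar> \<le> norm (e k - g x) * norm (z k)"
        using norm_blinfun[of "e k - g x" "z k"] by simp
      also have "\<dots> \<le> norm (g x) / 8 * 1" using i k z(1)[of k] by (intro mult_mono) (auto simp: dist_norm)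
      finally show ?thesis by simp
    qed
    then have "e k (z k) - norm (g x) / 8 \<le> g x (z k)" unfolding blinfun.diff_left by linarith
    ultimately have "norm (g x) / 2 \<le> g x (z k)" using z(2)[of k] norm_ge_zero[of "g x"] by linarith
    then show ?thesis by (auto simp: Q_def)
  qed (simp add: Q_def)
  have gz: "(\<lambda>x. g x (z k)) \<in> borel_measurable M" for k
    by (intro borel_measurable_strongly_measurable strongly_measurable_blinfun_apply sg) simp
  have Q_meas: "Measurable.pred M (Q k)" for k
    unfolding Q_def pred_def
    by (intro borel_measurable_le gz borel_measurable_divide norm_strongly_measurable sg) simp
  define v where "v x = z (LEAST k. Q k x)" for x
  have v_borel: "v \<in> borel_measurable M"
  proof -
    have "(\<lambda>x. LEAST k. Q k x) \<in> measurable M (count_space UNIV)"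
      using Q_meas by (rule measurable_Least)
    from measurable_compose[OF this, of z borel] show ?thesis by (simp add: v_def[abs_def])
  qed
  show thesis
  proof (rule that[of v])
    show "strongly_measurable M v"
      by (rule borel_measurable_imp_strongly_measurable[OF v_borel, of "range z"])
        (use closure_subset[of "range z"] in \<open>auto simp: v_def\<close>)
    show "norm (v x) \<le> 1" for x by (simp add: v_def z)
    have least: "norm (g x) / 2 \<le> g x (v x)" if "x \<in> space M" for x
      using LeastI_ex[OF ex[OF that]] by (simp add: Q_def v_def)
    show "AE x in M. norm (w x) / 2 \<le> w x (v x)"
      using g AE_space
    proof eventually_elim
      case (elim x)
      then show ?case using least[of x] by simp
    qed
  qed
qed

text \<open>The extremal control of Hoelder's inequality is directed along a measurable field of
  near norming vectors; only this field causes the loss of a factor 2.\<close>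

lemma converse_holder:
  fixes w :: "'a \<Rightarrow> 'b::real_normed_vector \<Rightarrow>\<^sub>L real"
  assumes p: "1 < p" and w: "strongly_measurable M w" "AE x in M. norm (w x) \<le> c"
  obtains u where "u \<in> lp_ball p M" "Lp_norm (conjugate_exponent p) M w / 2 \<le> (\<integral>x. w x (u x) \<partial>M)"
proof -
  obtain v where v: "strongly_measurable M v" "\<And>x. norm (v x) \<le> 1" "AE x in M. norm (w x) / 2 \<le> w x (v x)"
    using measurable_near_norming[OF w(1)] by metis
  have nw: "(\<lambda>x. norm (w x)) \<in> borel_measurable M" by (rule norm_strongly_measurable[OF w(1)])
  have wv_le: "\<bar>w x (v x)\<bar> \<le> norm (w x)" for x
    using norm_blinfun[of "w x" "v x"] mult_left_mono[OF v(2) norm_ge_zero[of "w x"]] by (simp add: order_trans)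
  have wv: "(\<lambda>x. w x (v x)) \<in> borel_measurable M"
    using w(1) v(1) by (intro borel_measurable_strongly_measurable strongly_measurable_blinfun_apply)
  show thesis
  proof (cases "p = \<infinity>")
    case True
    have "integrable M (\<lambda>x. norm (w x) powr 1)" by (rule powr_norm_integrable[OF w]) simp
    then have int: "integrable M (\<lambda>x. norm (w x))" by simp
    have int_wv: "integrable M (\<lambda>x. w x (v x))"
      using Bochner_Integration.integrable_bound[OF int wv] wv_le by simp
    have "(\<integral>x. norm (w x) / 2 \<partial>M) \<le> (\<integral>x. w x (v x) \<partial>M)"
      using int int_wv v(3) by (intro integral_mono_AE) auto
    then have "Lp_norm (conjugate_exponent p) M w / 2 \<le> (\<integral>x. w x (v x) \<partial>M)"
      using True Lp_norm_one_eq_integral[OF w(1)] by (simp add: conjugate_exponent_def)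
    moreover have "v \<in> lp_ball p M" using v True by (simp add: lp_ball_def)
    ultimately show thesis by (intro that)
  next
    case False
    define P where "P = enn2real p"
    define q where "q = P / (P - 1)"
    have P: "1 < P" using enn2real_gt_one[OF p False] by (simp add: P_def)
    then have q: "1 < q" "(q - 1) * P = q" by (auto simp: q_def field_simps)
    define W where "W = (\<integral>x. norm (w x) powr q \<partial>M)"
    define N where "N = W powr (1 / q)"
    have conj: "conjugate_exponent p = ennreal q"
      unfolding q_def P_def by (rule conjugate_exponent_eq[OF p False])
    have norm_eq: "Lp_norm (conjugate_exponent p) M w = N"
      unfolding N_def W_def conj using q by (subst Lp_norm_eq_integral[OF w(1)]) auto
    have int_w: "integrable M (\<lambda>x. norm (w x) powr q)" using q by (intro powr_norm_integrable[OF w]) simp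
    have "0 \<le> W" unfolding W_def by (intro integral_nonneg_AE) simp
    show thesis
    proof (cases "W = 0")
      case True
      then show thesis using norm_eq by (intro that[of "\<lambda>_. 0"]) (auto simp: lp_ball_zero N_def)
    next
      case False
      with \<open>0 \<le> W\<close> have W: "0 < W" by simp
      then have N: "0 < N" "N powr q = W" using q by (auto simp: N_def powr_powr)
      \<comment> \<open>Since \<open>(q - 1) * P = q\<close>, the power \<open>a x powr P\<close>
        equals \<open>norm (w x) powr q / W\<close> and has integral 1, while
        \<open>a x * norm (w x)\<close> has integral \<open>N\<close>.\<close>
      define a where "a x = (norm (w x) / N) powr (q - 1)" for x
      have am: "a \<in> borel_measurable M" unfolding a_def[abs_def] using nw by measurable
      have asm: "strongly_measurable M a"
        unfolding a_def[abs_def]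
      proof -
        obtain Q :: "real set" where Q: "countable Q" "UNIV \<subseteq> closure Q" using separable[of UNIV] by metis
        show "strongly_measurable M (\<lambda>x. (norm (w x) / N) powr (q - 1))"
          using am[unfolded a_def[abs_def]] Q(1)
          by (rule borel_measurable_imp_strongly_measurable) (use Q in auto)
      qed
      define u where "u x = a x *\<^sub>R v x" for x
      have "u \<in> lp_ball p M"
      proof -
        have "(\<integral>\<^sup>+x. ennreal (norm (u x) powr P) \<partial>M) \<le> (\<integral>\<^sup>+x. ennreal (norm (w x) powr q / W) \<partial>M)"
        proof (intro nn_integral_mono ennreal_leI)
          fix x
          have "norm (u x) \<le> a x"
            using mult_left_mono[OF v(2)[of x], of "a x"] by (simp add: u_def a_def)
          then have "norm (u x) powr P \<le> a x powr P" using P by (intro powr_mono2) auto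
          also have "\<dots> = norm (w x) powr q / W"
            using q N by (simp add: a_def powr_powr powr_divide)
          finally show "norm (u x) powr P \<le> norm (w x) powr q / W" .
        qed
        also have "\<dots> = ennreal (\<integral>x. norm (w x) powr q / W \<partial>M)"
          using int_w W by (intro nn_integral_eq_integral) auto
        also have "\<dots> = 1" using W int_w by (simp add: W_def[symmetric])
        finally show ?thesis
          using \<open>p \<noteq> \<infinity>\<close> strongly_measurable_scaleR[OF asm v(1)]
          by (simp add: lp_ball_def P_def u_def[abs_def])
      qed
      moreover have "N / 2 \<le> (\<integral>x. w x (u x) \<partial>M)"
      proof -
        have a_eq: "a x * norm (w x) = N / W * norm (w x) powr q" for x
        proof (cases "w x = 0")
          case False
          have "a x * norm (w x) = N * ((norm (w x) / N) powr (q - 1) * (norm (w x) / N) powr 1)"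
            using N by (simp add: a_def)
          also have "\<dots> = N * (norm (w x) / N) powr q" by (subst powr_add[symmetric]) simp
          also have "\<dots> = N / W * norm (w x) powr q" using N by (simp add: powr_divide)
          finally show ?thesis .
        qed (use q in \<open>simp add: a_def\<close>)
        have int_a: "integrable M (\<lambda>x. a x * norm (w x))"
          unfolding a_eq by (intro integrable_mult_right int_w)
        have wu: "(\<lambda>x. w x (u x)) \<in> borel_measurable M"
          unfolding u_def blinfun.scaleR_right real_scaleR_def by (intro borel_measurable_times am wv)
        have a0: "0 \<le> a x" for x by (simp add: a_def)
        have int_wu: "integrable M (\<lambda>x. w x (u x))"
          by (rule Bochner_Integration.integrable_bound[OF int_a wu])
            (use wv_le a0 in \<open>simp add: u_def blinfun.scaleR_right abs_mult mult_left_mono\<close>)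
        have "N / 2 = (\<integral>x. a x * norm (w x) / 2 \<partial>M)"
          unfolding a_eq using int_w W by (simp add: W_def[symmetric])
        also have "\<dots> \<le> (\<integral>x. w x (u x) \<partial>M)"
        proof (rule integral_mono_AE)
          show "AE x in M. a x * norm (w x) / 2 \<le> w x (u x)"
            using v(3)
          proof eventually_elim
            case (elim x)
            from mult_left_mono[OF elim a0[of x]] show ?case by (simp add: u_def blinfun.scaleR_right)
          qed
        qed (use int_a int_wu in auto)
        finally show ?thesis .
      qed
      ultimately show thesis using norm_eq by (intro that[of u]) auto
    qed
  qed
qed

text \<open>Takes the place of completeness of Lp. For finite exponent \<open>P\<close> the function
  \<open>g\<close> is the root of order \<open>P\<close> of the sum of
  \<open>(1/2) ^ k * norm (u k x) powr P\<close>, whose integral is finite. The last clause turns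
  domination by a multiple of \<open>g\<close> into membership of the limit.\<close>

lemma lp_ball_sequence_dominated:
  fixes u :: "nat \<Rightarrow> 'a \<Rightarrow> 'b::real_normed_vector"
  assumes p: "1 < p" and u: "\<And>k. u k \<in> lp_ball p M"
  obtains g where "g \<in> borel_measurable M" "\<And>x. 0 \<le> g x" "(\<integral>\<^sup>+x. ennreal (g x) \<partial>M) < \<infinity>" "AE x in M. \<forall>k. norm (u k x) \<le> 2 ^ k * g x"
    "\<forall>(v :: 'a \<Rightarrow> 'b) c. strongly_measurable M v \<and> 0 \<le> c \<and> (AE x in M. norm (v x) \<le> c * g x) \<longrightarrow> v \<in> Lp_space p M"
proof (cases "p = \<infinity>")
  case True
  show thesis
  proof (rule that[of "\<lambda>_. 1"])
    have "AE x in M. norm (u k x) \<le> 1" for k using u[of k] True by (simp add: lp_ball_def)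
    then have "AE x in M. \<forall>k. norm (u k x) \<le> 1" by (simp add: AE_all_countable)
    then show "AE x in M. \<forall>k. norm (u k x) \<le> 2 ^ k * 1"
    proof eventually_elim
      case (elim x)
      have "(1::real) \<le> 2 ^ k" for k by simp
      with elim show ?case by (auto intro: order_trans)
    qed
  qed (use True in \<open>auto simp: Lp_space_def emeasure_eq_measure\<close>)
next
  case False
  define P where "P = enn2real p"
  have P: "1 < P" using enn2real_gt_one[OF p False] by (simp add: P_def)
  have um: "strongly_measurable M (u k)" for k using u[of k] by (simp add: lp_ball_def)
  have int: "(\<integral>\<^sup>+x. ennreal (norm (u k x) powr P) \<partial>M) \<le> 1" for k
    using u[of k] False by (simp add: lp_ball_def P_def)
  define G where "G x = (\<Sum>k. ennreal ((1/2) ^ k) * ennreal (norm (u k x) powr P))" for x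
  have meas: "(\<lambda>x. ennreal ((1/2) ^ k) * ennreal (norm (u k x) powr P)) \<in> borel_measurable M" for k
    using powr_norm_measurable[OF um] by measurable
  have G_meas: "G \<in> borel_measurable M"
    unfolding G_def[abs_def] using meas by measurable
  have "(\<integral>\<^sup>+x. G x \<partial>M) = (\<Sum>k. \<integral>\<^sup>+x. ennreal ((1/2) ^ k) * ennreal (norm (u k x) powr P) \<partial>M)"
    unfolding G_def by (intro nn_integral_suminf meas)
  also have "\<dots> = (\<Sum>k. ennreal ((1/2) ^ k) * (\<integral>\<^sup>+x. ennreal (norm (u k x) powr P) \<partial>M))"
    by (intro suminf_cong nn_integral_cmult powr_norm_measurable um)
  also have "\<dots> \<le> (\<Sum>k. ennreal ((1/2) ^ k) * 1)"
    using int by (intro suminf_le mult_left_mono) auto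
  also have "\<dots> = ennreal (\<Sum>k. (1/2) ^ k)"
    by (simp add: suminf_ennreal2 summable_geometric)
  also have "\<dots> < \<infinity>" by simp
  finally have G_int: "(\<integral>\<^sup>+x. G x \<partial>M) < \<infinity>" .
  then have G_fin: "AE x in M. G x \<noteq> \<infinity>" using G_meas by (intro nn_integral_PInf_AE) auto
  define g where "g x = enn2real (G x) powr (1 / P)" for x
  show thesis
  proof (rule that[of g])
    show "g \<in> borel_measurable M" unfolding g_def[abs_def] using G_meas by measurable
    show "0 \<le> g x" for x by (simp add: g_def)
    have gP: "g x powr P = enn2real (G x)" for x
      using P by (simp add: g_def powr_powr)
    have "(\<integral>\<^sup>+x. ennreal (g x) \<partial>M) \<le> (\<integral>\<^sup>+x. 1 + G x \<partial>M)"
    proof (rule nn_integral_mono_AE, use G_fin in eventually_elim)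
      case (elim x)
      have "g x \<le> 1 + enn2real (G x)"
      proof (cases "enn2real (G x) \<le> 1")
        case True
        then have "g x \<le> 1" unfolding g_def using P by (intro powr_le1) auto
        then show ?thesis by (simp add: add_increasing2)
      next
        case False
        then have "g x \<le> enn2real (G x) powr 1" unfolding g_def using P by (intro powr_mono) auto
        then show ?thesis by simp
      qed
      then have "ennreal (g x) \<le> ennreal (1 + enn2real (G x))" by (rule ennreal_leI)
      also have "\<dots> = 1 + G x" using elim by (simp add: less_top)
      finally show ?case .
    qed
    also have "\<dots> = emeasure M (space M) + (\<integral>\<^sup>+x. G x \<partial>M)" using G_meas by (simp add: nn_integral_add)
    also have "\<dots> < \<infinity>" using G_int by (simp add: emeasure_eq_measure)
    finally show "(\<integral>\<^sup>+x. ennreal (g x) \<partial>M) < \<infinity>" .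
    show "AE x in M. \<forall>k. norm (u k x) \<le> 2 ^ k * g x"
      using G_fin
    proof eventually_elim
      case (elim x)
      show ?case
      proof
        fix k
        have "ennreal ((1/2) ^ k) * ennreal (norm (u k x) powr P) \<le> G x"
          unfolding G_def using sum_le_suminf[of "\<lambda>k. ennreal ((1/2) ^ k) * ennreal (norm (u k x) powr P)" "{k}"]
          by (simp add: summableI)
        then have "ennreal ((1/2) ^ k * norm (u k x) powr P) \<le> ennreal (enn2real (G x))"
          using elim by (simp add: ennreal_mult less_top)
        then have "(1/2) ^ k * norm (u k x) powr P \<le> enn2real (G x)" by (simp add: ennreal_le_iff)
        then have "norm (u k x) powr P \<le> 2 ^ k * enn2real (G x)"
          by (simp add: power_one_over field_simps)
        then have "(norm (u k x) powr P) powr (1 / P) \<le> (2 ^ k * enn2real (G x)) powr (1 / P)"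
          using P by (intro powr_mono2) auto
        then have "norm (u k x) \<le> (2 ^ k) powr (1 / P) * g x"
          using P by (simp add: powr_powr powr_mult g_def)
        \<comment> \<open>Enlarging the exponent makes the growth rate the same for every
          \<open>p\<close>.\<close>
        also have "\<dots> \<le> (2 ^ k) powr 1 * g x"
          using P by (intro mult_right_mono powr_mono) (auto simp: g_def)
        finally show "norm (u k x) \<le> 2 ^ k * g x" by simp
      qed
    qed
    show "\<forall>(v :: 'a \<Rightarrow> 'b) c. strongly_measurable M v \<and> 0 \<le> c \<and> (AE x in M. norm (v x) \<le> c * g x) \<longrightarrow> v \<in> Lp_space p M"
    proof (intro allI impI, elim conjE)
      fix v :: "'a \<Rightarrow> 'b" and c :: real
      assume v: "strongly_measurable M v" "0 \<le> c" "AE x in M. norm (v x) \<le> c * g x"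
      have "(\<integral>\<^sup>+x. ennreal (norm (v x) powr P) \<partial>M) \<le> (\<integral>\<^sup>+x. ennreal (c powr P) * G x \<partial>M)"
      proof (rule nn_integral_mono_AE, use G_fin v(3) in eventually_elim)
        case (elim x)
        have "norm (v x) powr P \<le> (c * g x) powr P" using elim P by (intro powr_mono2) auto
        also have "\<dots> = c powr P * enn2real (G x)" using v(2) gP by (simp add: powr_mult g_def)
        finally have "ennreal (norm (v x) powr P) \<le> ennreal (c powr P * enn2real (G x))" by (rule ennreal_leI)
        also have "\<dots> = ennreal (c powr P) * G x" using elim by (simp add: ennreal_mult less_top)
        finally show ?case .
      qed
      also have "\<dots> = ennreal (c powr P) * (\<integral>\<^sup>+x. G x \<partial>M)" by (intro nn_integral_cmult G_meas)
      also have "\<dots> < \<infinity>" using G_int by (simp add: ennreal_mult_less_top)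
      finally show "v \<in> Lp_space p M" using v False by (simp add: Lp_space_def P_def)
    qed
  qed
qed

text \<open>The rate \<open>4\<^sup>-\<^sup>k\<close> compensates the factor \<open>2\<^sup>k\<close> in the domination.\<close>

lemma lp_ball_series:
  fixes u :: "nat \<Rightarrow> 'a \<Rightarrow> 'b::banach"
  assumes p: "1 < p" and u: "\<And>k. u k \<in> lp_ball p M"
    and b: "\<And>k. 0 \<le> b k" "\<And>k. b k \<le> \<beta> * (1/4) ^ k"
  obtains v where "v \<in> Lp_space p M" "(\<lambda>n. \<integral>\<^sup>+x. norm (v x - (\<Sum>k<n. b k *\<^sub>R u k x)) \<partial>M) \<longlonglongrightarrow> 0"
proof -
  have "\<exists>g. g \<in> borel_measurable M \<and> (\<forall>x. 0 \<le> g x) \<and> (\<integral>\<^sup>+x. ennreal (g x) \<partial>M) < \<infinity> \<and>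
      (AE x in M. \<forall>k. norm (u k x) \<le> 2 ^ k * g x) \<and>
      (\<forall>(v :: 'a \<Rightarrow> 'b) c. strongly_measurable M v \<and> 0 \<le> c \<and> (AE x in M. norm (v x) \<le> c * g x) \<longrightarrow> v \<in> Lp_space p M)"
    by (rule lp_ball_sequence_dominated[OF p u])
      (rule exI, intro conjI, assumption, rule allI, assumption, assumption, assumption, assumption)
  then obtain g where gm: "g \<in> borel_measurable M" and g: "\<And>x. 0 \<le> g x" "(\<integral>\<^sup>+x. ennreal (g x) \<partial>M) < \<infinity>"
      "AE x in M. \<forall>k. norm (u k x) \<le> 2 ^ k * g x"
    and mem: "\<forall>(v :: 'a \<Rightarrow> 'b) c. strongly_measurable M v \<and> 0 \<le> c \<and> (AE x in M. norm (v x) \<le> c * g x) \<longrightarrow> v \<in> Lp_space p M"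
    by (elim exE conjE) (rule that, assumption, erule spec, assumption+)
  have \<beta>: "0 \<le> \<beta>" using b(1)[of 0] b(2)[of 0] by simp
  define v where "v x = (\<Sum>k. b k *\<^sub>R u k x)" for x
  have term_le: "norm (b k *\<^sub>R u k x) \<le> \<beta> * g x * (1/2) ^ k" if "\<forall>k. norm (u k x) \<le> 2 ^ k * g x" for k x
  proof -
    have "norm (b k *\<^sub>R u k x) \<le> (\<beta> * (1/4) ^ k) * (2 ^ k * g x)"
      using b that \<beta> by (auto intro!: mult_mono)
    also have "\<dots> = \<beta> * g x * ((1/4) ^ k * 2 ^ k)" by simp
    also have "(1/4) ^ k * 2 ^ k = (1/2 :: real) ^ k" by (simp flip: power_mult_distrib)
    finally show ?thesis .
  qed
  have geo: "summable (\<lambda>k. (1/2 :: real) ^ k)" by (simp add: summable_geometric)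
  \<comment> \<open>After the growth \<open>2 ^ k\<close> is offset, a geometric series of ratio 1/2
    remains, whose sum is the factor 2. The case \<open>n = 0\<close> also bounds the limit
    itself.\<close>
  have tail: "norm (v x - (\<Sum>k<n. b k *\<^sub>R u k x)) \<le> 2 * \<beta> * (1/2) ^ n * g x"
    and summ: "summable (\<lambda>k. b k *\<^sub>R u k x)" if *: "\<forall>k. norm (u k x) \<le> 2 ^ k * g x" for x n
  proof -
    show s: "summable (\<lambda>k. b k *\<^sub>R u k x)"
      by (rule summable_comparison_test'[OF summable_mult[OF geo, of "\<beta> * g x"] term_le[OF *]])
    have "v x - (\<Sum>k<n. b k *\<^sub>R u k x) = (\<Sum>k. b (k + n) *\<^sub>R u (k + n) x)"
      unfolding v_def using suminf_minus_initial_segment[OF s, of n] by simp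
    also have "norm \<dots> \<le> (\<Sum>k. \<beta> * g x * (1/2) ^ n * (1/2) ^ k)"
    proof (rule norm_suminf_le)
      show "norm (b (k + n) *\<^sub>R u (k + n) x) \<le> \<beta> * g x * (1/2) ^ n * (1/2) ^ k" for k
        using term_le[OF *, of "k + n"] by (simp add: power_add mult_ac)
    qed (rule summable_mult[OF geo])
    also have "\<dots> = \<beta> * g x * (1/2) ^ n * (\<Sum>k. (1/2) ^ k)" by (rule suminf_mult[OF geo])
    also have "(\<Sum>k. (1/2 :: real) ^ k) = 2" by (simp add: suminf_geometric)
    finally show "norm (v x - (\<Sum>k<n. b k *\<^sub>R u k x)) \<le> 2 * \<beta> * (1/2) ^ n * g x" by (simp add: mult_ac)
  qed
  have partial: "strongly_measurable M (\<lambda>x. \<Sum>k<n. b k *\<^sub>R u k x)" for n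
    using u by (intro strongly_measurable_sum strongly_measurable_scaleR) (auto simp: lp_ball_def)
  have "AE x in M. (\<lambda>n. \<Sum>k<n. b k *\<^sub>R u k x) \<longlonglongrightarrow> v x"
    using g(3) by eventually_elim (use summable_LIMSEQ[OF summ] in \<open>simp add: v_def\<close>)
  with partial have vm: "strongly_measurable M v" by (rule strongly_measurable_LIMSEQ)
  have "AE x in M. norm (v x) \<le> 2 * \<beta> * g x"
    using g(3) by eventually_elim (use tail[of _ 0] in simp)
  then have "v \<in> Lp_space p M" using mem vm \<beta> by (metis mult_nonneg_nonneg zero_le_numeral)
  moreover have "(\<lambda>n. \<integral>\<^sup>+x. norm (v x - (\<Sum>k<n. b k *\<^sub>R u k x)) \<partial>M) \<longlonglongrightarrow> 0"
  proof (rule tendsto_sandwich[OF _ _ tendsto_const])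
    let ?J = "\<integral>\<^sup>+x. ennreal (g x) \<partial>M"
    have J: "?J = ennreal (enn2real ?J)" using g(2) by (simp add: less_top)
    have "(\<lambda>n. 2 * \<beta> * (1/2) ^ n * enn2real ?J) \<longlonglongrightarrow> 2 * \<beta> * 0 * enn2real ?J"
      by (intro tendsto_intros LIMSEQ_power_zero) simp
    then have "(\<lambda>n. ennreal (2 * \<beta> * (1/2) ^ n * enn2real ?J)) \<longlonglongrightarrow> ennreal 0"
      by (intro tendsto_ennrealI) simp
    then show "(\<lambda>n. ennreal (2 * \<beta> * (1/2) ^ n * enn2real ?J)) \<longlonglongrightarrow> 0" by simp
    have "(\<integral>\<^sup>+x. norm (v x - (\<Sum>k<n. b k *\<^sub>R u k x)) \<partial>M) \<le> ennreal (2 * \<beta> * (1/2) ^ n * enn2real ?J)" for n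
    proof -
      have "(\<integral>\<^sup>+x. norm (v x - (\<Sum>k<n. b k *\<^sub>R u k x)) \<partial>M) \<le> (\<integral>\<^sup>+x. ennreal (2 * \<beta> * (1/2) ^ n) * ennreal (g x) \<partial>M)"
      proof (rule nn_integral_mono_AE, use g(3) in eventually_elim)
        case (elim x)
        then show ?case using tail[OF elim, of n] \<beta> g(1)[of x] by (simp add: ennreal_leI flip: ennreal_mult)
      qed
      also have "\<dots> \<le> ennreal (2 * \<beta> * (1/2) ^ n) * ?J"
        using gm by (subst nn_integral_cmult) auto
      finally show ?thesis using \<beta> by (simp add: ennreal_mult J[symmetric])
    qed
    then show "\<forall>\<^sub>F n in sequentially. (\<integral>\<^sup>+x. norm (v x - (\<Sum>k<n. b k *\<^sub>R u k x)) \<partial>M)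
        \<le> ennreal (2 * \<beta> * (1/2) ^ n * enn2real ?J)" by simp
  qed simp
  ultimately show thesis by (rule that)
qed

end

section \<open>Operators with range of finite codimension\<close>

text \<open>Abstracts the integrand \<open>S T s o\<^sub>L B s\<close>, which may fail to be
  strongly measurable in the operator norm. Hence two separate measurability assumptions: applied to
  controls it is governed by strong continuity of \<open>S\<close>, composed with functionals by the
  backward solutions.\<close>

locale control_operator = finite_complete_measure M for M :: "'a measure" +
  fixes p :: ennreal and K :: "'a \<Rightarrow> 'u::banach \<Rightarrow>\<^sub>L 'y::banach" and c :: real
  assumes p: "1 < p" and c: "0 \<le> c"
    and K_bound: "AE s in M. norm (K s) \<le> c"
    and K_meas: "\<And>u. strongly_measurable M u \<Longrightarrow> strongly_measurable M (\<lambda>s. K s (u s))"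
    and dual_meas: "\<And>\<psi> :: 'y \<Rightarrow>\<^sub>L real. strongly_measurable M (\<lambda>s. \<psi> o\<^sub>L K s)"
begin

text \<open>Integrability is all that \<open>L\<close> requires; in this larger class linearity and
  passage to the limit do not involve \<open>p\<close>.\<close>

definition L1 :: "('a \<Rightarrow> 'u) \<Rightarrow> bool" where
  "L1 u \<longleftrightarrow> strongly_measurable M u \<and> (\<integral>\<^sup>+s. norm (u s) \<partial>M) < \<infinity>"

definition L :: "('a \<Rightarrow> 'u) \<Rightarrow> 'y" where
  "L u = banach_integral M (\<lambda>s. K s (u s))"

lemma norm_K_nn_integral:
  assumes "L1 u"
  shows "(\<integral>\<^sup>+s. norm (K s (u s)) \<partial>M) \<le> ennreal c * (\<integral>\<^sup>+s. norm (u s) \<partial>M)"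
proof -
  have u: "strongly_measurable M u" using assms by (simp add: L1_def)
  have "(\<integral>\<^sup>+s. norm (K s (u s)) \<partial>M) \<le> (\<integral>\<^sup>+s. ennreal c * ennreal (norm (u s)) \<partial>M)"
  proof (rule nn_integral_mono_AE, use K_bound in eventually_elim)
    case (elim s)
    have "norm (K s (u s)) \<le> c * norm (u s)"
      using norm_blinfun[of "K s" "u s"] mult_right_mono[OF elim norm_ge_zero[of "u s"]] by simp
    then show ?case using c by (simp add: ennreal_leI flip: ennreal_mult)
  qed
  also have "\<dots> = ennreal c * (\<integral>\<^sup>+s. norm (u s) \<partial>M)"
    by (rule nn_integral_cmult[OF measurable_compose[OF norm_strongly_measurable[OF u] measurable_ennreal]])
  finally show ?thesis .
qed

lemma has_L:
  assumes "L1 u"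
  shows "has_banach_integral M (\<lambda>s. K s (u s)) (L u)"
  unfolding L_def
proof (rule has_banach_integral_banach_integral)
  show "strongly_measurable M (\<lambda>s. K s (u s))" using assms by (intro K_meas) (simp add: L1_def)
  have "ennreal c * (\<integral>\<^sup>+s. norm (u s) \<partial>M) < \<infinity>" using assms by (simp add: L1_def ennreal_mult_less_top)
  with norm_K_nn_integral[OF assms] show "(\<integral>\<^sup>+s. norm (K s (u s)) \<partial>M) < \<infinity>" by (rule le_less_trans)
qed

lemma norm_L_le: "L1 u \<Longrightarrow> ennreal (norm (L u)) \<le> ennreal c * (\<integral>\<^sup>+s. norm (u s) \<partial>M)"
  using has_banach_integral_norm_le[OF has_L] norm_K_nn_integral by (rule order_trans)

lemma L_functional:
  fixes \<psi> :: "'y \<Rightarrow>\<^sub>L real"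
  assumes "L1 u"
  shows "has_bochner_integral M (\<lambda>s. (\<psi> o\<^sub>L K s) (u s)) (\<psi> (L u))"
  using has_banach_integral_functional[OF has_L[OF assms], of \<psi>] by simp

lemma L1_lincomb:
  assumes "L1 u" "L1 v"
  shows "L1 (\<lambda>s. a *\<^sub>R u s + b *\<^sub>R v s)"
  unfolding L1_def
proof
  have m: "strongly_measurable M u" "strongly_measurable M v" using assms by (auto simp: L1_def)
  then show "strongly_measurable M (\<lambda>s. a *\<^sub>R u s + b *\<^sub>R v s)"
    by (intro strongly_measurable_add strongly_measurable_scaleR) auto
  note nm = m[THEN norm_strongly_measurable]
  have "(\<integral>\<^sup>+s. norm (a *\<^sub>R u s + b *\<^sub>R v s) \<partial>M) \<le> (\<integral>\<^sup>+s. ennreal \<bar>a\<bar> * norm (u s) + ennreal \<bar>b\<bar> * norm (v s) \<partial>M)"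
  proof (rule nn_integral_mono)
    fix s
    have "norm (a *\<^sub>R u s + b *\<^sub>R v s) \<le> \<bar>a\<bar> * norm (u s) + \<bar>b\<bar> * norm (v s)"
      using norm_triangle_ineq[of "a *\<^sub>R u s" "b *\<^sub>R v s"] by simp
    then show "ennreal (norm (a *\<^sub>R u s + b *\<^sub>R v s)) \<le> ennreal \<bar>a\<bar> * norm (u s) + ennreal \<bar>b\<bar> * norm (v s)"
      by (simp add: ennreal_leI flip: ennreal_mult ennreal_plus)
  qed
  also have "\<dots> = ennreal \<bar>a\<bar> * (\<integral>\<^sup>+s. norm (u s) \<partial>M) + ennreal \<bar>b\<bar> * (\<integral>\<^sup>+s. norm (v s) \<partial>M)"
    using nm by (simp add: nn_integral_add nn_integral_cmult)
  also have "\<dots> < \<infinity>" using assms by (simp add: L1_def ennreal_mult_less_top)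
  finally show "(\<integral>\<^sup>+s. norm (a *\<^sub>R u s + b *\<^sub>R v s) \<partial>M) < \<infinity>" .
qed

lemma L_lincomb:
  assumes "L1 u" "L1 v"
  shows "L (\<lambda>s. a *\<^sub>R u s + b *\<^sub>R v s) = a *\<^sub>R L u + b *\<^sub>R L v"
proof (rule functional_eqI)
  fix \<psi> :: "'y \<Rightarrow>\<^sub>L real"
  have "has_bochner_integral M (\<lambda>s. a * (\<psi> o\<^sub>L K s) (u s) + b * (\<psi> o\<^sub>L K s) (v s)) (a * \<psi> (L u) + b * \<psi> (L v))"
    using assms by (intro has_bochner_integral_add has_bochner_integral_mult_right L_functional)
  moreover have "has_bochner_integral M (\<lambda>s. (\<psi> o\<^sub>L K s) (a *\<^sub>R u s + b *\<^sub>R v s)) (\<psi> (L (\<lambda>s. a *\<^sub>R u s + b *\<^sub>R v s)))"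
    by (rule L_functional[OF L1_lincomb[OF assms]])
  then have "has_bochner_integral M (\<lambda>s. a * (\<psi> o\<^sub>L K s) (u s) + b * (\<psi> o\<^sub>L K s) (v s)) (\<psi> (L (\<lambda>s. a *\<^sub>R u s + b *\<^sub>R v s)))"
    by (simp add: blinfun.add_right blinfun.scaleR_right)
  ultimately show "\<psi> (L (\<lambda>s. a *\<^sub>R u s + b *\<^sub>R v s)) = \<psi> (a *\<^sub>R L u + b *\<^sub>R L v)"
    by (simp add: has_bochner_integral_eq blinfun.add_right blinfun.scaleR_right)
qed

lemma L1_zero: "L1 (\<lambda>_. 0)" and L_zero: "L (\<lambda>_. 0) = 0"
proof -
  show *: "L1 (\<lambda>_. 0)" by (simp add: L1_def)
  show "L (\<lambda>_. 0) = 0" using L_lincomb[OF * *, of 0 0] by simp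
qed

lemma L_scaleR: "L1 u \<Longrightarrow> L (\<lambda>s. a *\<^sub>R u s) = a *\<^sub>R L u"
  using L_lincomb[OF _ L1_zero, of u a 0] by (simp add: L_zero)

lemma L1_scaleR: "L1 u \<Longrightarrow> L1 (\<lambda>s. a *\<^sub>R u s)"
  using L1_lincomb[OF _ L1_zero, of u a 0] by simp

lemma L_sum:
  fixes n :: nat
  assumes "\<And>k. L1 (u k)"
  shows "L1 (\<lambda>s. \<Sum>k<n. a k *\<^sub>R u k s) \<and> L (\<lambda>s. \<Sum>k<n. a k *\<^sub>R u k s) = (\<Sum>k<n. a k *\<^sub>R L (u k))"
proof (induction n)
  case 0
  then show ?case by (simp add: L1_zero L_zero)
next
  case (Suc n)
  then show ?case
    using L1_lincomb[of "\<lambda>s. \<Sum>k<n. a k *\<^sub>R u k s" "u n" 1 "a n"]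
      L_lincomb[of "\<lambda>s. \<Sum>k<n. a k *\<^sub>R u k s" "u n" 1 "a n"] assms[of n] by simp
qed

lemma lp_ball_L1: "u \<in> lp_ball p M \<Longrightarrow> L1 u"
  using le_less_trans[OF lp_ball_nn_integral_norm[OF p, of u]] by (simp add: L1_def lp_ball_def)

lemma Lp_space_L1: "u \<in> Lp_space p M \<Longrightarrow> L1 u"
  by (auto simp: Lp_space_iff_lp_ball[OF p] intro: L1_scaleR lp_ball_L1)

lemma lp_ball_scaleR:
  assumes "u \<in> lp_ball p M" "0 \<le> a" "a \<le> 1"
  shows "(\<lambda>s. a *\<^sub>R u s) \<in> lp_ball p M"
  using lp_ball_convex[OF p assms(1) lp_ball_zero, of a "1 - a"] assms by simp

lemma range_subspace: "subspace (L ` Lp_space p M)"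
proof -
  have mem: "a *\<^sub>R L u \<in> L ` Lp_space p M" if "u \<in> lp_ball p M" "0 < a" for u a
  proof (rule image_eqI)
    show "a *\<^sub>R L u = L (\<lambda>s. a *\<^sub>R u s)" using that by (simp add: L_scaleR lp_ball_L1)
    show "(\<lambda>s. a *\<^sub>R u s) \<in> Lp_space p M" using that by (auto simp: Lp_space_iff_lp_ball[OF p])
  qed
  have rep: "\<exists>a u. 0 < a \<and> u \<in> lp_ball p M \<and> x = a *\<^sub>R L u" if x: "x \<in> L ` Lp_space p M" for x
  proof -
    obtain u where u: "u \<in> Lp_space p M" "x = L u" using x by blast
    then obtain a v where "0 < a" "v \<in> lp_ball p M" "u = (\<lambda>s. a *\<^sub>R v s)" by (auto simp: Lp_space_iff_lp_ball[OF p])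
    with u show ?thesis by (intro exI[of _ a] exI[of _ v]) (simp add: L_scaleR lp_ball_L1)
  qed
  have zero: "0 \<in> L ` Lp_space p M" using mem[OF lp_ball_zero, of 1] by (simp add: L_zero)
  show ?thesis
  proof (rule subspaceI)
    fix x y and r :: real assume "x \<in> L ` Lp_space p M"
    then obtain a u where u: "0 < a" "u \<in> lp_ball p M" "x = a *\<^sub>R L u" using rep by blast
    consider "r = 0" | "0 < r" | "r < 0" by linarith
    then show "r *\<^sub>R x \<in> L ` Lp_space p M"
    proof cases
      case 2
      then show ?thesis using mem[OF u(2), of "r * a"] u by simp
    next
      case 3
      have "L (\<lambda>s. - u s) = - L u" using L_scaleR[OF lp_ball_L1[OF u(2)], of "-1"] by simp
      then show ?thesis using mem[OF lp_ball_minus[OF u(2)], of "- r * a"] u 3 by (simp add: mult_neg_pos)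
    qed (simp add: zero)
    assume "y \<in> L ` Lp_space p M"
    then obtain b v where v: "0 < b" "v \<in> lp_ball p M" "y = b *\<^sub>R L v" using rep by blast
    \<comment> \<open>The sum is \<open>a + b\<close> times the image of a convex combination, so
      closure under addition comes from convexity of the ball.\<close>
    let ?w = "\<lambda>s. (a / (a + b)) *\<^sub>R u s + (b / (a + b)) *\<^sub>R v s"
    have "?w \<in> lp_ball p M" using u v by (intro lp_ball_convex[OF p]) (auto simp flip: add_divide_distrib)
    from mem[OF this, of "a + b"] u v show "x + y \<in> L ` Lp_space p M"
      by (simp add: L_lincomb lp_ball_L1 scaleR_add_right)
  qed (rule zero)
qed

lemma dual_bound:
  fixes \<psi> :: "'y \<Rightarrow>\<^sub>L real"
  shows "AE s in M. norm (\<psi> o\<^sub>L K s) \<le> norm \<psi> * c"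
  using K_bound
proof eventually_elim
  case (elim s)
  then show ?case using norm_blinfun_compose[of \<psi> "K s"] mult_left_mono[OF elim norm_ge_zero[of \<psi>]] by simp
qed

lemma functional_L_le:
  fixes \<psi> :: "'y \<Rightarrow>\<^sub>L real"
  assumes "u \<in> lp_ball p M"
  shows "\<bar>\<psi> (L u)\<bar> \<le> Lp_norm (conjugate_exponent p) M (\<lambda>s. \<psi> o\<^sub>L K s)"
proof -
  have "(\<integral>s. (\<psi> o\<^sub>L K s) (u s) \<partial>M) = \<psi> (L u)"
    using L_functional[OF lp_ball_L1[OF assms]] by (rule has_bochner_integral_integral_eq)
  with holder[OF p assms dual_meas[of \<psi>] dual_bound[of \<psi>]] show ?thesis by simp
qed

text \<open>The image of the unit ball under \<open>(u, a) \<mapsto> L u + \<Sum>\<^sub>w a\<^sub>w w\<close>, a map onto \<open>Y\<close> when the range of \<open>L\<close>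
  and \<open>W\<close> together span \<open>Y\<close>.\<close>

definition augmented :: "'y set \<Rightarrow> 'y set" where
  "augmented W = {L u + (\<Sum>w\<in>W. a w *\<^sub>R w) | u a. u \<in> lp_ball p M \<and> (\<forall>w\<in>W. \<bar>a w\<bar> \<le> 1)}"

lemma augmentedI: "u \<in> lp_ball p M \<Longrightarrow> (\<And>w. w \<in> W \<Longrightarrow> \<bar>a w\<bar> \<le> 1) \<Longrightarrow> L u + (\<Sum>w\<in>W. a w *\<^sub>R w) \<in> augmented W"
  by (auto simp: augmented_def)

lemma augmented_convex: "convex (augmented W)"
proof (rule convexI)
  fix x y and \<alpha> \<beta> :: real
  assume "x \<in> augmented W" "y \<in> augmented W" and ab: "0 \<le> \<alpha>" "0 \<le> \<beta>" "\<alpha> + \<beta> = 1"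
  then obtain u a v b where u: "u \<in> lp_ball p M" "\<forall>w\<in>W. \<bar>a w\<bar> \<le> 1" "x = L u + (\<Sum>w\<in>W. a w *\<^sub>R w)"
    and v: "v \<in> lp_ball p M" "\<forall>w\<in>W. \<bar>b w\<bar> \<le> 1" "y = L v + (\<Sum>w\<in>W. b w *\<^sub>R w)"
    unfolding augmented_def by blast
  have "L (\<lambda>s. \<alpha> *\<^sub>R u s + \<beta> *\<^sub>R v s) + (\<Sum>w\<in>W. (\<alpha> * a w + \<beta> * b w) *\<^sub>R w) \<in> augmented W"
  proof (rule augmentedI)
    show "(\<lambda>s. \<alpha> *\<^sub>R u s + \<beta> *\<^sub>R v s) \<in> lp_ball p M" by (rule lp_ball_convex[OF p u(1) v(1) ab])
    fix w assume w: "w \<in> W"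
    have "\<bar>\<alpha> * a w + \<beta> * b w\<bar> \<le> \<alpha> * \<bar>a w\<bar> + \<beta> * \<bar>b w\<bar>"
      using abs_triangle_ineq[of "\<alpha> * a w" "\<beta> * b w"] ab by (simp add: abs_mult)
    also have "\<dots> \<le> \<alpha> * 1 + \<beta> * 1" using u(2) v(2) w ab by (intro add_mono mult_left_mono) auto
    finally show "\<bar>\<alpha> * a w + \<beta> * b w\<bar> \<le> 1" using ab by simp
  qed
  moreover have "L (\<lambda>s. \<alpha> *\<^sub>R u s + \<beta> *\<^sub>R v s) + (\<Sum>w\<in>W. (\<alpha> * a w + \<beta> * b w) *\<^sub>R w) = \<alpha> *\<^sub>R x + \<beta> *\<^sub>R y"
    unfolding u(3) v(3) L_lincomb[OF lp_ball_L1[OF u(1)] lp_ball_L1[OF v(1)]]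
    by (simp add: scaleR_add_left scaleR_add_right sum.distrib scaleR_sum_right algebra_simps)
  ultimately show "\<alpha> *\<^sub>R x + \<beta> *\<^sub>R y \<in> augmented W" by simp
qed

lemma augmented_minus:
  assumes "x \<in> augmented W"
  shows "- x \<in> augmented W"
proof -
  obtain u a where u: "u \<in> lp_ball p M" "\<forall>w\<in>W. \<bar>a w\<bar> \<le> 1" "x = L u + (\<Sum>w\<in>W. a w *\<^sub>R w)"
    using assms unfolding augmented_def by blast
  have "L (\<lambda>s. - u s) + (\<Sum>w\<in>W. (- a w) *\<^sub>R w) \<in> augmented W"
    by (rule augmentedI[OF lp_ball_minus[OF u(1)]]) (use u(2) in auto)
  moreover have "L (\<lambda>s. - u s) = - L u" using L_scaleR[OF lp_ball_L1[OF u(1)], of "-1"] by simp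
  ultimately show ?thesis by (simp add: u(3) sum_negf)
qed

lemma augmented_L: "u \<in> lp_ball p M \<Longrightarrow> L u \<in> augmented W"
  using augmentedI[of u W "\<lambda>_. 0"] by simp

lemma augmented_mem:
  assumes "finite W" "w \<in> W"
  shows "w \<in> augmented W"
proof -
  have "(\<Sum>v\<in>W. (if v = w then 1 else 0 :: real) *\<^sub>R v) = (\<Sum>v\<in>W. if v = w then w else 0)"
    by (rule sum.cong) auto
  also have "\<dots> = w" using assms by simp
  finally show ?thesis
    using augmentedI[OF lp_ball_zero, of W "\<lambda>v. if v = w then 1 else 0"] by (simp add: L_zero)
qed

text \<open>Functionals that vanish on \<open>Z\<close> see only the \<open>L\<close> part of
  \<open>augmented Z\<close>, where Hoelder's inequality bounds them by the observation.\<close>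

theorem finite_codim_range_imp_estimate:
  assumes "finite_codim (L ` Lp_space p M)"
  obtains Yt :: "('y \<Rightarrow>\<^sub>L real) set" and C :: real where "finite_codim Yt" "0 < C"
    "\<And>\<psi>. \<psi> \<in> Yt \<Longrightarrow> norm \<psi> \<le> C * Lp_norm (conjugate_exponent p) M (\<lambda>s. \<psi> o\<^sub>L K s)"
proof -
  obtain Z where Z: "finite Z" "span (L ` Lp_space p M \<union> Z) = UNIV"
    using assms unfolding finite_codim_def by blast
  \<comment> \<open>Closed, as Baire's theorem requires; bounds on functionals pass to the
    closure.\<close>
  define E where "E n = closure ((\<lambda>x. real n *\<^sub>R x) ` augmented Z)" for n
  have "y \<in> (\<Union>n. E n)" for y
  proof -
    have "y \<in> span (L ` Lp_space p M \<union> Z)" using Z by simp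
    then obtain r z where "r \<in> span (L ` Lp_space p M)" "z \<in> span Z" and y: "y = r + z"
      unfolding span_Un by blast
    then have "r \<in> L ` Lp_space p M" using span_eq_iff[THEN iffD2, OF range_subspace] by simp
    then obtain u where u: "u \<in> Lp_space p M" "r = L u" by blast
    then obtain b v where v: "0 < b" "v \<in> lp_ball p M" "u = (\<lambda>s. b *\<^sub>R v s)"
      by (auto simp: Lp_space_iff_lp_ball[OF p])
    obtain a where a: "z = (\<Sum>w\<in>Z. a w *\<^sub>R w)"
      using \<open>z \<in> span Z\<close> unfolding span_finite[OF Z(1)] by blast
    \<comment> \<open>Large enough to normalise the control and all coefficients at once.\<close>
    obtain n where n: "b + (\<Sum>w\<in>Z. \<bar>a w\<bar>) \<le> real n" using real_arch_simple by blast
    have sum0: "0 \<le> (\<Sum>w\<in>Z. \<bar>a w\<bar>)" by (intro sum_nonneg) simp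
    have n0: "0 < real n" using n v(1) sum0 by linarith
    have "L (\<lambda>s. (b / real n) *\<^sub>R v s) + (\<Sum>w\<in>Z. (a w / real n) *\<^sub>R w) \<in> augmented Z"
    proof (rule augmentedI)
      show "(\<lambda>s. (b / real n) *\<^sub>R v s) \<in> lp_ball p M"
      proof (rule lp_ball_scaleR[OF v(2)])
        have "b \<le> real n" using n sum0 by linarith
        then show "0 \<le> b / real n" "b / real n \<le> 1" using n0 v(1) by auto
      qed
      fix w assume "w \<in> Z"
      then have "\<bar>a w\<bar> \<le> (\<Sum>w\<in>Z. \<bar>a w\<bar>)" using Z(1) by (intro member_le_sum) auto
      then show "\<bar>a w / real n\<bar> \<le> 1" using n n0 v(1) by simp
    qed
    moreover have "y = real n *\<^sub>R (L (\<lambda>s. (b / real n) *\<^sub>R v s) + (\<Sum>w\<in>Z. (a w / real n) *\<^sub>R w))"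
      using n0 v u lp_ball_L1[OF v(2)] by (simp add: y a L_scaleR scaleR_add_right scaleR_sum_right)
    ultimately have "y \<in> (\<lambda>x. real n *\<^sub>R x) ` augmented Z" by (rule rev_image_eqI)
    then have "y \<in> E n" unfolding E_def by (rule subsetD[OF closure_subset])
    then show ?thesis by (rule UN_I[OF UNIV_I])
  qed
  then have "(\<Union>n. E n) = UNIV" by blast
  moreover have "convex (E n)" for n
    unfolding E_def by (intro convex_closure convex_scaling augmented_convex)
  moreover have "- x \<in> E n" if "x \<in> E n" for x n
  proof -
    obtain f where f: "\<And>k. f k \<in> (\<lambda>x. real n *\<^sub>R x) ` augmented Z" "f \<longlonglongrightarrow> x"
      using \<open>x \<in> E n\<close> unfolding E_def closure_sequential by blast
    have neg: "- f k \<in> (\<lambda>x. real n *\<^sub>R x) ` augmented Z" for k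
    proof -
      obtain z where "z \<in> augmented Z" "f k = real n *\<^sub>R z" using f(1)[of k] by blast
      then show ?thesis by (intro rev_image_eqI[OF augmented_minus[of z]]) auto
    qed
    show ?thesis
      unfolding E_def closure_sequential
    proof (intro exI conjI allI)
      show "(\<lambda>k. - f k) \<longlonglongrightarrow> - x" by (rule tendsto_minus[OF f(2)])
    qed (rule neg)
  qed
  moreover have "closed (E n)" for n by (simp add: E_def)
  ultimately obtain n e where e: "0 < e" "ball 0 e \<subseteq> E n"
    using baire_ball_zero[of E] by metis
  show thesis
  \<comment> \<open>The 2 stems from scaling vectors to half the radius \<open>e\<close>; the
    summand 1 keeps the constant positive for \<open>n = 0\<close>.\<close>
  proof (rule that[of "{\<psi>. \<forall>z\<in>Z. blinfun_apply \<psi> z = 0}" "2 * real n / e + 1"])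
    show "finite_codim {\<psi> :: 'y \<Rightarrow>\<^sub>L real. \<forall>z\<in>Z. blinfun_apply \<psi> z = 0}"
      using Z(1) by (rule finite_codim_annihilator)
    show "0 < 2 * real n / e + 1" using e by (simp add: add_nonneg_pos)
    fix \<psi> :: "'y \<Rightarrow>\<^sub>L real" assume "\<psi> \<in> {\<psi>. \<forall>z\<in>Z. blinfun_apply \<psi> z = 0}"
    then have \<psi>: "\<psi> z = 0" if "z \<in> Z" for z using that by simp
    define N where "N = Lp_norm (conjugate_exponent p) M (\<lambda>s. \<psi> o\<^sub>L K s)"
    have N: "0 \<le> N" using functional_L_le[OF lp_ball_zero, of \<psi>] by (simp add: N_def L_zero)
    have "\<bar>\<psi> x\<bar> \<le> N" if x: "x \<in> augmented Z" for x
    proof -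
      obtain u a where u: "u \<in> lp_ball p M" "x = L u + (\<Sum>w\<in>Z. a w *\<^sub>R w)"
        using x unfolding augmented_def by blast
      have "\<psi> x = \<psi> (L u)"
        by (simp add: u(2) blinfun.add_right blinfun.sum_right blinfun.scaleR_right \<psi>)
      then show ?thesis using functional_L_le[OF u(1), of \<psi>] by (simp add: N_def)
    qed
    then have "(\<lambda>x. real n *\<^sub>R x) ` augmented Z \<subseteq> {x. \<bar>\<psi> x\<bar> \<le> real n * N}"
      by (auto simp: blinfun.scaleR_right abs_mult mult_left_mono)
    moreover have "closed {x. \<bar>\<psi> x\<bar> \<le> real n * N}"
      by (intro closed_Collect_le continuous_intros)
    ultimately have En: "E n \<subseteq> {x. \<bar>\<psi> x\<bar> \<le> real n * N}" unfolding E_def by (rule closure_minimal)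
    have "norm \<psi> \<le> 2 * real n * N / e"
    proof (rule norm_blinfun_bound)
      fix x
      show "norm (\<psi> x) \<le> 2 * real n * N / e * norm x"
      proof (cases "x = 0")
        case False
        define t where "t = e / (2 * norm x)"
        have t: "0 < t" using False e by (simp add: t_def)
        have "t *\<^sub>R x \<in> ball 0 e" using False e by (simp add: t_def)
        then have "\<bar>\<psi> (t *\<^sub>R x)\<bar> \<le> real n * N" using e En by blast
        then have "t * \<bar>\<psi> x\<bar> \<le> real n * N" using t by (simp add: blinfun.scaleR_right abs_mult)
        then show ?thesis using False e by (simp add: t_def field_simps)
      qed simp
    qed (use N e in simp)
    also have "\<dots> \<le> (2 * real n / e + 1) * N" using N by (simp add: distrib_right)
    finally show "norm \<psi> \<le> (2 * real n / e + 1) * Lp_norm (conjugate_exponent p) M (\<lambda>s. \<psi> o\<^sub>L K s)"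
      by (simp add: N_def)
  qed
qed

text \<open>The dual norm of \<psi> composed with \<open>L\<close>. It stands in for the equivalent
  \<open>Lp_norm\<close> of the observation because subadditivity and Lipschitz continuity follow
  directly for a supremum of this kind.\<close>

definition dual_seminorm :: "('y \<Rightarrow>\<^sub>L real) \<Rightarrow> real" where
  "dual_seminorm \<psi> = (SUP u\<in>lp_ball p M. \<bar>\<psi> (L u)\<bar>)"

lemma norm_L_lp_ball:
  assumes "u \<in> lp_ball p M"
  shows "norm (L u) \<le> c * (measure M (space M) + 1)"
proof -
  have "ennreal (norm (L u)) \<le> ennreal c * ennreal (measure M (space M) + 1)"
    using norm_L_le[OF lp_ball_L1[OF assms]] mult_left_mono[OF lp_ball_nn_integral_norm[OF p assms], of "ennreal c"]
    by (rule order_trans) simp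
  also have "\<dots> = ennreal (c * (measure M (space M) + 1))" using c by (simp add: ennreal_mult)
  finally show ?thesis using c by (subst (asm) ennreal_le_iff) auto
qed

lemma dual_seminorm_bdd:
  fixes \<psi> :: "'y \<Rightarrow>\<^sub>L real"
  shows "bdd_above ((\<lambda>u. \<bar>\<psi> (L u)\<bar>) ` lp_ball p M)"
proof (rule bdd_aboveI2)
  fix u :: "'a \<Rightarrow> 'u" assume "u \<in> lp_ball p M"
  from mult_left_mono[OF norm_L_lp_ball[OF this] norm_ge_zero[of \<psi>]] norm_blinfun[of \<psi> "L u"]
  show "\<bar>\<psi> (L u)\<bar> \<le> norm \<psi> * (c * (measure M (space M) + 1))" by simp
qed

lemma dual_seminorm_upper:
  fixes \<psi> :: "'y \<Rightarrow>\<^sub>L real"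
  shows "u \<in> lp_ball p M \<Longrightarrow> \<bar>\<psi> (L u)\<bar> \<le> dual_seminorm \<psi>"
  unfolding dual_seminorm_def by (rule cSUP_upper[OF _ dual_seminorm_bdd])

lemma dual_seminorm_least:
  fixes \<psi> :: "'y \<Rightarrow>\<^sub>L real"
  shows "(\<And>u. u \<in> lp_ball p M \<Longrightarrow> \<bar>\<psi> (L u)\<bar> \<le> r) \<Longrightarrow> dual_seminorm \<psi> \<le> r"
  unfolding dual_seminorm_def using lp_ball_zero by (intro cSUP_least) auto

lemma dual_seminorm_add:
  fixes \<psi> \<eta> :: "'y \<Rightarrow>\<^sub>L real"
  shows "dual_seminorm (\<psi> + \<eta>) \<le> dual_seminorm \<psi> + dual_seminorm \<eta>"
proof (rule dual_seminorm_least)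
  fix u :: "'a \<Rightarrow> 'u" assume u: "u \<in> lp_ball p M"
  have "\<bar>(\<psi> + \<eta>) (L u)\<bar> \<le> \<bar>\<psi> (L u)\<bar> + \<bar>\<eta> (L u)\<bar>" by (simp add: blinfun.add_left)
  with dual_seminorm_upper[OF u, of \<psi>] dual_seminorm_upper[OF u, of \<eta>]
  show "\<bar>(\<psi> + \<eta>) (L u)\<bar> \<le> dual_seminorm \<psi> + dual_seminorm \<eta>" by linarith
qed

lemma dual_seminorm_scale:
  fixes \<psi> :: "'y \<Rightarrow>\<^sub>L real"
  shows "dual_seminorm (r *\<^sub>R \<psi>) = \<bar>r\<bar> * dual_seminorm \<psi>"
proof (rule abs_homogeneousI)
  fix r and \<psi> :: "'y \<Rightarrow>\<^sub>L real"
  show "dual_seminorm (r *\<^sub>R \<psi>) \<le> \<bar>r\<bar> * dual_seminorm \<psi>"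
  proof (rule dual_seminorm_least)
    fix u :: "'a \<Rightarrow> 'u" assume "u \<in> lp_ball p M"
    from mult_left_mono[OF dual_seminorm_upper[OF this, of \<psi>] abs_ge_zero[of r]]
    show "\<bar>(r *\<^sub>R \<psi>) (L u)\<bar> \<le> \<bar>r\<bar> * dual_seminorm \<psi>" by (simp add: blinfun.scaleR_left abs_mult)
  qed
qed

lemma dual_seminorm_le_norm:
  fixes \<psi> :: "'y \<Rightarrow>\<^sub>L real"
  shows "dual_seminorm \<psi> \<le> c * (measure M (space M) + 1) * norm \<psi>"
proof (rule dual_seminorm_least)
  fix u :: "'a \<Rightarrow> 'u" assume "u \<in> lp_ball p M"
  from mult_left_mono[OF norm_L_lp_ball[OF this] norm_ge_zero[of \<psi>]] norm_blinfun[of \<psi> "L u"]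
  show "\<bar>\<psi> (L u)\<bar> \<le> c * (measure M (space M) + 1) * norm \<psi>" by (simp add: mult.commute)
qed

lemma dual_seminorm_continuous: "continuous_on UNIV dual_seminorm"
proof (rule continuous_on_subset[OF lipschitz_on_continuous_on])
  let ?C = "c * (measure M (space M) + 1)"
  have le: "dual_seminorm \<psi> - dual_seminorm \<eta> \<le> ?C * norm (\<psi> - \<eta>)" for \<psi> \<eta> :: "'y \<Rightarrow>\<^sub>L real"
    using dual_seminorm_add[of "\<psi> - \<eta>" \<eta>] dual_seminorm_le_norm[of "\<psi> - \<eta>"] by simp
  show "?C-lipschitz_on UNIV dual_seminorm"
  proof (rule lipschitz_onI)
    show "dist (dual_seminorm \<psi>) (dual_seminorm \<eta>) \<le> ?C * dist \<psi> \<eta>" for \<psi> \<eta>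
      using le[of \<psi> \<eta>] le[of \<eta> \<psi>] by (simp add: dist_norm norm_minus_commute abs_le_iff)
  qed (use c in simp)
qed simp

lemma Lp_norm_le_dual_seminorm:
  fixes \<psi> :: "'y \<Rightarrow>\<^sub>L real"
  shows "Lp_norm (conjugate_exponent p) M (\<lambda>s. \<psi> o\<^sub>L K s) \<le> 2 * dual_seminorm \<psi>"
proof -
  obtain u where u: "u \<in> lp_ball p M"
    "Lp_norm (conjugate_exponent p) M (\<lambda>s. \<psi> o\<^sub>L K s) / 2 \<le> (\<integral>s. (\<psi> o\<^sub>L K s) (u s) \<partial>M)"
    using converse_holder[OF p dual_meas dual_bound] by metis
  have "(\<integral>s. (\<psi> o\<^sub>L K s) (u s) \<partial>M) = \<psi> (L u)"
    using L_functional[OF lp_ball_L1[OF u(1)]] by (rule has_bochner_integral_integral_eq)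
  with u(2) dual_seminorm_upper[OF u(1), of \<psi>] show ?thesis by linarith
qed

text \<open>Convergence of the control series in the L1 sense suffices, since \<open>L\<close> is
  bounded on integrable controls.\<close>

lemma L_series:
  assumes u: "\<And>k. u k \<in> lp_ball p M" and b: "\<And>k. 0 \<le> b k" "\<And>k. b k \<le> \<beta> * (1/4) ^ k"
  obtains v where "v \<in> Lp_space p M" "(\<lambda>k. b k *\<^sub>R L (u k)) sums L v"
proof -
  have "\<exists>v. v \<in> Lp_space p M \<and> (\<lambda>n. \<integral>\<^sup>+s. norm (v s - (\<Sum>k<n. b k *\<^sub>R u k s)) \<partial>M) \<longlonglongrightarrow> 0"
    by (rule lp_ball_series[OF p u b]) (rule exI, rule conjI)
  then obtain v where v: "v \<in> Lp_space p M" "(\<lambda>n. \<integral>\<^sup>+s. norm (v s - (\<Sum>k<n. b k *\<^sub>R u k s)) \<partial>M) \<longlonglongrightarrow> 0"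
    by (elim exE conjE)
  note v1 = Lp_space_L1[OF v(1)] and u1 = lp_ball_L1[OF u]
  let ?s = "\<lambda>n s. \<Sum>k<n. b k *\<^sub>R u k s"
  note s = L_sum[where u=u and a=b, OF u1]
  have le: "ennreal (norm (L v - (\<Sum>k<n. b k *\<^sub>R L (u k)))) \<le> ennreal c * (\<integral>\<^sup>+s. norm (v s - ?s n s) \<partial>M)" for n
    using norm_L_le[OF L1_lincomb[OF v1 conjunct1[OF s], of 1 "-1" n]]
      L_lincomb[OF v1 conjunct1[OF s], of 1 "-1" n] conjunct2[OF s[of n]] by simp
  have "(\<lambda>n. ennreal c * (\<integral>\<^sup>+s. norm (v s - ?s n s) \<partial>M)) \<longlonglongrightarrow> ennreal c * 0"
    by (intro ennreal_tendsto_cmult v(2)) simp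
  then have lim: "(\<lambda>n. ennreal c * (\<integral>\<^sup>+s. norm (v s - ?s n s) \<partial>M)) \<longlonglongrightarrow> 0" by simp
  have "(\<lambda>n. ennreal (norm (L v - (\<Sum>k<n. b k *\<^sub>R L (u k))))) \<longlonglongrightarrow> 0"
    by (rule tendsto_sandwich[OF _ always_eventually[OF allI[OF le]] tendsto_const lim]) simp
  then have "(\<lambda>n. ennreal (norm (L v - (\<Sum>k<n. b k *\<^sub>R L (u k))))) \<longlonglongrightarrow> ennreal 0" by simp
  then have "(\<lambda>n. norm (L v - (\<Sum>k<n. b k *\<^sub>R L (u k)))) \<longlonglongrightarrow> 0"
    by (subst (asm) tendsto_ennreal_iff) auto
  then have "(\<lambda>n. L v - (\<Sum>k<n. b k *\<^sub>R L (u k))) \<longlonglongrightarrow> 0" by (rule tendsto_norm_zero_cancel)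
  from tendsto_diff[OF tendsto_const[of "L v"] this] have "(\<lambda>k. b k *\<^sub>R L (u k)) sums L v"
    by (simp add: sums_def)
  with v(1) show thesis by (rule that)
qed

theorem estimate_imp_finite_codim_range:
  fixes Yt :: "('y \<Rightarrow>\<^sub>L real) set"
  assumes refl: "reflexive_space TYPE('y)" and Yt: "finite_codim Yt" and C: "0 < C"
    and est: "\<And>\<psi>. \<psi> \<in> Yt \<Longrightarrow> norm \<psi> \<le> C * Lp_norm (conjugate_exponent p) M (\<lambda>s. \<psi> o\<^sub>L K s)"
  shows "finite_codim (L ` Lp_space p M)"
proof -
  obtain Z where Z: "finite Z" "span (Yt \<union> Z) = UNIV" and sub: "subspace Yt"
    using Yt unfolding finite_codim_def by blast
  have est2: "norm \<psi> \<le> (2 * C) * dual_seminorm \<psi>" if "\<psi> \<in> Yt" for \<psi>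
    using est[OF that] mult_left_mono[OF Lp_norm_le_dual_seminorm[of \<psi>] less_imp_le[OF C]] by simp
  obtain W C' where W: "finite W" and C': "0 \<le> C'"
    and all: "\<And>\<psi> :: 'y \<Rightarrow>\<^sub>L real. norm \<psi> \<le> C' * (dual_seminorm \<psi> + (\<Sum>w\<in>W. \<bar>blinfun_apply \<psi> w\<bar>))"
    using finite_codim_dual_estimate[OF refl dual_seminorm_add dual_seminorm_scale dual_seminorm_continuous Z(1) est2 sub] Z(2)
    by auto
  \<comment> \<open>A functional bounded by 1 on \<open>augmented W\<close> has seminorm at most 1
    and each \<bar>\<psi> w\<bar> at most 1, so the sum over \<open>W\<close> contributes at most
    its cardinality.\<close>
  define C'' where "C'' = C' * (1 + real (card W))"
  have C'': "0 \<le> C''" using C' by (simp add: C''_def)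
  have dual: "norm \<psi> \<le> C''" if \<psi>: "\<And>x. x \<in> augmented W \<Longrightarrow> blinfun_apply \<psi> x \<le> 1" for \<psi> :: "'y \<Rightarrow>\<^sub>L real"
  proof -
    have abs1: "\<bar>\<psi> x\<bar> \<le> 1" if "x \<in> augmented W" for x
      using \<psi>[OF that] \<psi>[OF augmented_minus[OF that]] by (simp add: blinfun.minus_right abs_le_iff)
    have "dual_seminorm \<psi> \<le> 1" by (rule dual_seminorm_least) (rule abs1[OF augmented_L])
    moreover have "(\<Sum>w\<in>W. \<bar>\<psi> w\<bar>) \<le> (\<Sum>w\<in>W. 1)" by (rule sum_mono) (rule abs1[OF augmented_mem[OF W]])
    ultimately have "dual_seminorm \<psi> + (\<Sum>w\<in>W. \<bar>\<psi> w\<bar>) \<le> 1 + real (card W)" by simp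
    from mult_left_mono[OF this C'] all[of \<psi>] show ?thesis by (simp add: C''_def)
  qed
  have ne: "augmented W \<noteq> {}" using augmented_L[OF lp_ball_zero] by blast
  have "y \<in> span (L ` Lp_space p M \<union> W)" for y
  proof -
    obtain a x where a: "\<And>k::nat. 0 \<le> a k" "\<And>k. a k \<le> (C'' + 1) * norm y * (1/4) ^ k"
      and x: "\<And>k. x k \<in> augmented W" and y: "(\<lambda>k. a k *\<^sub>R x k) sums y"
      using series_by_convex[OF augmented_convex augmented_minus ne C'' dual, where y=y] by metis
    have "\<forall>k. \<exists>u \<alpha>. u \<in> lp_ball p M \<and> (\<forall>w\<in>W. \<bar>\<alpha> w\<bar> \<le> 1) \<and> x k = L u + (\<Sum>w\<in>W. \<alpha> w *\<^sub>R w)"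
      using x unfolding augmented_def by blast
    then obtain u \<alpha> where u: "\<And>k. u k \<in> lp_ball p M" and \<alpha>: "\<And>k w. w \<in> W \<Longrightarrow> \<bar>\<alpha> k w\<bar> \<le> 1"
      and x_eq: "\<And>k. x k = L (u k) + (\<Sum>w\<in>W. \<alpha> k w *\<^sub>R w)" by metis
    have "\<exists>v. v \<in> Lp_space p M \<and> (\<lambda>k. a k *\<^sub>R L (u k)) sums L v"
      by (rule L_series[OF u a]) (rule exI, rule conjI)
    then obtain v where v: "v \<in> Lp_space p M" "(\<lambda>k. a k *\<^sub>R L (u k)) sums L v"
      by (elim exE conjE)
    \<comment> \<open>The coefficients of each \<open>w\<close> are summed separately; they inherit
      the geometric rate, so this part of the solution stays in the span of
      \<open>W\<close>.\<close>
    have summ: "summable (\<lambda>k. a k * \<alpha> k w)" if w: "w \<in> W" for w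
    proof (rule summable_comparison_test')
      show "summable (\<lambda>k. (C'' + 1) * norm y * (1/4) ^ k)" by (intro summable_mult summable_geometric) simp
      show "norm (a k * \<alpha> k w) \<le> (C'' + 1) * norm y * (1/4) ^ k" for k
        using mult_left_mono[OF \<alpha>[OF w, of k] a(1)[of k]] a(1)[of k] a(2)[of k] by (simp add: abs_mult)
    qed
    have "(\<lambda>k. \<Sum>w\<in>W. (a k * \<alpha> k w) *\<^sub>R w) sums (\<Sum>w\<in>W. (\<Sum>k. a k * \<alpha> k w) *\<^sub>R w)"
      using summ by (intro sums_sum sums_scaleR_left summable_sums)
    from sums_add[OF v(2) this] have "(\<lambda>k. a k *\<^sub>R x k) sums (L v + (\<Sum>w\<in>W. (\<Sum>k. a k * \<alpha> k w) *\<^sub>R w))"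
      by (simp add: x_eq scaleR_add_right scaleR_sum_right)
    with y have "y = L v + (\<Sum>w\<in>W. (\<Sum>k. a k * \<alpha> k w) *\<^sub>R w)" by (rule sums_unique2)
    also have "\<dots> \<in> span (L ` Lp_space p M \<union> W)"
      using v(1) by (intro span_add span_sum span_scale) (auto intro: span_base)
    finally show ?thesis .
  qed
  then have "span (L ` Lp_space p M \<union> W) = UNIV" by blast
  with range_subspace W show ?thesis by (rule finite_codimI)
qed

end

section \<open>Backward Volterra equations\<close>

lemma continuous_on_interval_bounded:
  fixes \<phi> :: "real \<Rightarrow> 'a::real_normed_vector"
  assumes "continuous_on {a..b} \<phi>"
  obtains B where "0 \<le> B" "\<And>t. t \<in> {a..b} \<Longrightarrow> norm (\<phi> t) \<le> B"
proof -
  have "bounded (\<phi> ` {a..b})" by (intro compact_imp_bounded compact_continuous_image assms) simp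
  then obtain B where "\<forall>x\<in>\<phi> ` {a..b}. norm x \<le> B" unfolding bounded_iff by blast
  then have "norm (\<phi> t) \<le> max 0 B" if "t \<in> {a..b}" for t using that by (simp add: max.coboundedI2)
  then show thesis by (intro that[of "max 0 B"]) auto
qed

context strongly_continuous_semigroup
begin

text \<open>The domain of integration is fixed and \<tau> occurs only in the integrand, so dominated
  convergence yields continuity in \<tau>. \<open>max 0\<close> keeps the time of \<open>G\<close>
  nonnegative where the indicator vanishes.\<close>

definition convolution :: "real \<Rightarrow> (real \<Rightarrow> 'a) \<Rightarrow> real \<Rightarrow> 'a" where
  "convolution T f \<tau> = banach_integral (lebesgue_on {0..T}) (\<lambda>s. indicat_real {\<tau>..} s *\<^sub>R G (max 0 (s - \<tau>)) (f s))"

lemma G_max_continuous: "continuous_on S (\<lambda>s. G (max 0 (s - \<tau>)) x)"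
  by (rule continuous_on_compose) (auto intro!: continuous_intros)

lemma convolution_integrand:
  assumes f: "strongly_measurable (lebesgue_on {0..T}) f"
  shows "strongly_measurable (lebesgue_on {0..T}) (\<lambda>s. indicat_real {\<tau>..} s *\<^sub>R G (max 0 (s - \<tau>)) (f s))"
proof (rule strongly_measurable_scaleR)
  show "strongly_measurable (lebesgue_on {0..T}) (indicat_real {\<tau>..})"
  proof (rule strongly_measurable_simple)
    have "simple_function (lebesgue_on {0..T}) (indicat_real ({\<tau>..} \<inter> {0..T}))"
      by (intro simple_function_indicator) (simp add: sets_restrict_space_iff)
    then show "simple_function (lebesgue_on {0..T}) (indicat_real {\<tau>..})"
      by (subst simple_function_cong[where g="indicat_real ({\<tau>..} \<inter> {0..T})"]) (auto simp: indicator_def)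
  qed
  show "strongly_measurable (lebesgue_on {0..T}) (\<lambda>s. G (max 0 (s - \<tau>)) (f s))"
    by (rule strongly_measurable_operator_family[OF _ f])
      (rule strongly_measurable_continuous_on[OF G_max_continuous])
qed

lemma convolution_integrand_bound:
  assumes f: "AE s in lebesgue_on {0..T}. norm (f s) \<le> b" and m: "\<forall>t\<in>{0..T}. norm (G t) \<le> m" and \<tau>: "0 \<le> \<tau>"
  shows "AE s in lebesgue_on {0..T}. norm (indicat_real {\<tau>..} s *\<^sub>R G (max 0 (s - \<tau>)) (f s)) \<le> m * b"
  using f AE_space
proof eventually_elim
  case (elim s)
  have m0: "0 \<le> m" using bspec[OF m, of 0] norm_ge_zero[of "G 0"] elim by (auto simp del: norm_ge_zero)
  have "norm (indicat_real {\<tau>..} s *\<^sub>R G (max 0 (s - \<tau>)) (f s)) \<le> norm (G (max 0 (s - \<tau>)) (f s))"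
    by (simp add: indicator_def)
  also have "\<dots> \<le> norm (G (max 0 (s - \<tau>))) * norm (f s)" by (rule norm_blinfun)
  also have "\<dots> \<le> m * b" using elim m0 \<tau> by (intro mult_mono bspec[OF m]) auto
  finally show ?case .
qed

lemma has_banach_integral_convolution:
  assumes f: "strongly_measurable (lebesgue_on {0..T}) f" "AE s in lebesgue_on {0..T}. norm (f s) \<le> b" and \<tau>: "0 \<le> \<tau>"
  shows "has_banach_integral (lebesgue_on {0..T}) (\<lambda>s. indicat_real {\<tau>..} s *\<^sub>R G (max 0 (s - \<tau>)) (f s)) (convolution T f \<tau>)"
proof -
  interpret I: finite_complete_measure "lebesgue_on {0..T}" by (rule finite_complete_measure_interval)
  obtain m where "1 \<le> m" "\<forall>t\<in>{0..T}. norm (G t) \<le> m" using bounded_on by metis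
  from I.has_banach_integral_bounded[OF convolution_integrand[OF f(1)] convolution_integrand_bound[OF f(2) this(2) \<tau>]]
  show ?thesis by (simp add: convolution_def)
qed

text \<open>Returns from the fixed domain to the interval of integration that occurs in mild
  solutions; functionals identify the two values.\<close>

lemma has_banach_integral_convolution_interval:
  assumes f: "strongly_measurable (lebesgue_on {0..T}) f" "AE s in lebesgue_on {0..T}. norm (f s) \<le> b" and \<tau>: "0 \<le> \<tau>" "\<tau> \<le> T"
  shows "has_banach_integral (lebesgue_on {\<tau>..T}) (\<lambda>s. G (s - \<tau>) (f s)) (convolution T f \<tau>)"
proof -
  interpret I: finite_complete_measure "lebesgue_on {0..T}" by (rule finite_complete_measure_interval)
  interpret J: finite_complete_measure "lebesgue_on {\<tau>..T}" by (rule finite_complete_measure_interval)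
  have sub: "{\<tau>..T} \<subseteq> {0..T}" using \<tau> by auto
  obtain m where m: "1 \<le> m" "\<forall>t\<in>{0..T}. norm (G t) \<le> m" using bounded_on by metis
  let ?k = "\<lambda>s. indicat_real {\<tau>..} s *\<^sub>R G (max 0 (s - \<tau>)) (f s)"
  have k_eq: "AE s in lebesgue_on {\<tau>..T}. ?k s = G (s - \<tau>) (f s)"
    by (rule AE_I2) simp
  have sm: "strongly_measurable (lebesgue_on {\<tau>..T}) (\<lambda>s. G (s - \<tau>) (f s))"
    by (rule strongly_measurable_cong_AE[OF strongly_measurable_interval_subset[OF convolution_integrand[OF f(1)] sub] k_eq])
  have bound: "AE s in lebesgue_on {\<tau>..T}. norm (G (s - \<tau>) (f s)) \<le> m * b"
    using AE_interval_subset[OF convolution_integrand_bound[OF f(2) m(2) \<tau>(1)] sub] k_eq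
    by eventually_elim simp
  have J: "has_banach_integral (lebesgue_on {\<tau>..T}) (\<lambda>s. G (s - \<tau>) (f s)) (banach_integral (lebesgue_on {\<tau>..T}) (\<lambda>s. G (s - \<tau>) (f s)))"
    (is "has_banach_integral _ _ ?x") by (rule J.has_banach_integral_bounded[OF sm bound])
  have "?x = convolution T f \<tau>"
  proof (rule functional_eqI)
    fix \<psi> :: "'a \<Rightarrow>\<^sub>L real"
    have "\<psi> ?x = (\<integral>s. \<psi> (G (s - \<tau>) (f s)) \<partial>lebesgue_on {\<tau>..T})"
      using has_bochner_integral_integral_eq[OF J.has_banach_integral_functional[OF J, of \<psi>]] by simp
    also have "\<dots> = (\<integral>s. indicator {\<tau>..T} s *\<^sub>R \<psi> (G (s - \<tau>) (f s)) \<partial>lebesgue_on {0..T})"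
      unfolding lebesgue_on_restrict[OF sub]
      by (rule integral_restrict_space) (use interval_in_sets_lebesgue_on[OF sub] in \<open>simp only: space_lebesgue_on Int_absorb2[OF sub]\<close>)
    also have "\<dots> = (\<integral>s. \<psi> (?k s) \<partial>lebesgue_on {0..T})"
      by (intro Bochner_Integration.integral_cong) (auto simp: indicator_def blinfun.scaleR_right)
    also have "\<dots> = \<psi> (convolution T f \<tau>)"
      using has_bochner_integral_integral_eq[OF I.has_banach_integral_functional[OF has_banach_integral_convolution[OF f \<tau>(1)], of \<psi>]] by simp
    finally show "\<psi> ?x = \<psi> (convolution T f \<tau>)" .
  qed
  with J show ?thesis by simp
qed

lemma convolution_diff:
  assumes f: "strongly_measurable (lebesgue_on {0..T}) f" "AE s in lebesgue_on {0..T}. norm (f s) \<le> b"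
    and g: "strongly_measurable (lebesgue_on {0..T}) g" "AE s in lebesgue_on {0..T}. norm (g s) \<le> d" and \<tau>: "0 \<le> \<tau>"
  shows "convolution T f \<tau> - convolution T g \<tau> = convolution T (\<lambda>s. f s - g s) \<tau>"
proof (rule functional_eqI)
  interpret I: finite_complete_measure "lebesgue_on {0..T}" by (rule finite_complete_measure_interval)
  fix \<psi> :: "'a \<Rightarrow>\<^sub>L real"
  let ?k = "\<lambda>f s. indicat_real {\<tau>..} s *\<^sub>R G (max 0 (s - \<tau>)) (f s)"
  have fg: "strongly_measurable (lebesgue_on {0..T}) (\<lambda>s. f s - g s)"
    by (rule strongly_measurable_diff[OF f(1) g(1)])
  have fg': "AE s in lebesgue_on {0..T}. norm (f s - g s) \<le> b + d"
    using f(2) g(2)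
  proof eventually_elim
    case (elim s)
    then show ?case using norm_triangle_ineq4[of "f s" "g s"] by linarith
  qed
  have "has_bochner_integral (lebesgue_on {0..T}) (\<lambda>s. \<psi> (?k f s) - \<psi> (?k g s)) (\<psi> (convolution T f \<tau>) - \<psi> (convolution T g \<tau>))"
    by (intro has_bochner_integral_diff I.has_banach_integral_functional has_banach_integral_convolution[OF f \<tau>] has_banach_integral_convolution[OF g \<tau>])
  moreover have "has_bochner_integral (lebesgue_on {0..T}) (\<lambda>s. \<psi> (?k (\<lambda>s. f s - g s) s)) (\<psi> (convolution T (\<lambda>s. f s - g s) \<tau>))"
    by (rule I.has_banach_integral_functional[OF has_banach_integral_convolution[OF fg fg' \<tau>]])
  moreover have "\<psi> (?k (\<lambda>s. f s - g s) s) = \<psi> (?k f s) - \<psi> (?k g s)" for s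
    by (simp add: blinfun.diff_right blinfun.scaleR_right right_diff_distrib)
  ultimately show "\<psi> (convolution T f \<tau> - convolution T g \<tau>) = \<psi> (convolution T (\<lambda>s. f s - g s) \<tau>)"
    by (simp only: has_bochner_integral_eq blinfun.diff_right)
qed

lemma convolution_continuous:
  assumes f: "strongly_measurable (lebesgue_on {0..T}) f" "AE s in lebesgue_on {0..T}. norm (f s) \<le> b"
  shows "continuous_on {0..T} (convolution T f)"
proof (rule continuous_on_sequentiallyI)
  fix u :: "nat \<Rightarrow> real" and a assume u: "\<forall>n. u n \<in> {0..T}" and a: "a \<in> {0..T}" and lim: "u \<longlonglongrightarrow> a"
  let ?M = "lebesgue_on {0..T}"
  interpret I: finite_complete_measure ?M by (rule finite_complete_measure_interval)
  obtain m where m: "1 \<le> m" "\<forall>t\<in>{0..T}. norm (G t) \<le> m" using bounded_on by metis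
  let ?k = "\<lambda>\<tau> s. indicat_real {\<tau>..} s *\<^sub>R G (max 0 (s - \<tau>)) (f s)"
  have k_meas: "strongly_measurable ?M (?k \<tau>)" for \<tau> by (rule convolution_integrand[OF f(1)])
  have k_bound: "AE s in ?M. norm (?k \<tau> s) \<le> m * b" if "0 \<le> \<tau>" for \<tau>
    by (rule convolution_integrand_bound[OF f(2) m(2) that])
  have d_bound: "AE s in ?M. norm (?k (u n) s - ?k a s) \<le> 2 * (m * b)" for n
  proof -
    have "0 \<le> u n" "0 \<le> a" using u a by auto
    from k_bound[OF this(1)] k_bound[OF this(2)] show ?thesis
    proof eventually_elim
      case (elim s)
      then show ?case using norm_triangle_ineq4[of "?k (u n) s" "?k a s"] by linarith
    qed
  qed
  have d_meas: "strongly_measurable ?M (\<lambda>s. ?k (u n) s - ?k a s)" for n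
    by (intro strongly_measurable_diff k_meas)
  have conv_dist: "ennreal (norm (convolution T f (u n) - convolution T f a)) \<le> (\<integral>\<^sup>+s. norm (?k (u n) s - ?k a s) \<partial>?M)" for n
  proof -
    have "has_banach_integral ?M (\<lambda>s. ?k (u n) s - ?k a s) (convolution T f (u n) - convolution T f a)"
    proof (rule I.has_banach_integralI[OF d_meas])
      have "AE s in ?M. norm (?k (u n) s - ?k a s) \<le> max 0 (2 * (m * b))"
        using d_bound[of n] by eventually_elim simp
      from I.nn_integral_norm_bounded[OF this] show "(\<integral>\<^sup>+s. norm (?k (u n) s - ?k a s) \<partial>?M) < \<infinity>"
        by (rule le_less_trans) simp_all
      fix \<psi> :: "'a \<Rightarrow>\<^sub>L real"
      have "has_bochner_integral ?M (\<lambda>s. \<psi> (?k (u n) s) - \<psi> (?k a s)) (\<psi> (convolution T f (u n)) - \<psi> (convolution T f a))"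
        using u a by (intro has_bochner_integral_diff I.has_banach_integral_functional has_banach_integral_convolution[OF f]) auto
      then show "(\<integral>s. \<psi> (?k (u n) s - ?k a s) \<partial>?M) = \<psi> (convolution T f (u n) - convolution T f a)"
        by (simp add: blinfun.diff_right has_bochner_integral_integral_eq)
    qed
    then show ?thesis by (rule I.has_banach_integral_norm_le)
  qed
  have "(\<lambda>n. \<integral>\<^sup>+s. norm (?k (u n) s - ?k a s) \<partial>?M) \<longlonglongrightarrow> (\<integral>\<^sup>+s. 0 \<partial>?M)"
  proof (rule nn_integral_dominated_convergence)
    show "(\<lambda>s. ennreal (norm (?k (u n) s - ?k a s))) \<in> borel_measurable ?M" for n
      by (rule measurable_compose[OF I.norm_strongly_measurable[OF d_meas] measurable_ennreal])
    show "AE s in ?M. ennreal (norm (?k (u n) s - ?k a s)) \<le> ennreal (2 * (m * b))" for n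
      using d_bound[of n] by eventually_elim (rule ennreal_leI)
    show "(\<integral>\<^sup>+s. ennreal (2 * (m * b)) \<partial>?M) < \<infinity>"
      by (simp add: I.emeasure_eq_measure ennreal_mult_less_top del: space_lebesgue_on)
    \<comment> \<open>Pointwise convergence can fail only at \<open>s = a\<close>, where the
      indicator jumps.\<close>
    have "{a} \<in> null_sets ?M" using a by (simp add: null_sets_restrict_space)
    from AE_not_in[OF this] show "AE s in ?M. (\<lambda>n. ennreal (norm (?k (u n) s - ?k a s))) \<longlonglongrightarrow> 0"
    proof eventually_elim
      case (elim s)
      have "(\<lambda>n. ?k (u n) s) \<longlonglongrightarrow> ?k a s"
      proof (cases "s < a")
        case True
        then have "\<forall>\<^sub>F n in sequentially. s < u n" by (rule order_tendstoD(1)[OF lim])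
        then have "\<forall>\<^sub>F n in sequentially. ?k (u n) s = ?k a s"
          by eventually_elim (use True in simp)
        then show ?thesis by (rule tendsto_eventually)
      next
        case False
        with elim have as: "a < s" by simp
        then have "\<forall>\<^sub>F n in sequentially. u n < s" by (rule order_tendstoD(2)[OF lim])
        then have ev: "\<forall>\<^sub>F n in sequentially. G (max 0 (s - u n)) (f s) = ?k (u n) s"
          by eventually_elim simp
        have "(\<lambda>n. max 0 (s - u n)) \<longlonglongrightarrow> max 0 (s - a)" by (intro tendsto_intros lim)
        from continuous_on_tendsto_compose[OF continuous this, of "f s"]
        have "(\<lambda>n. G (max 0 (s - u n)) (f s)) \<longlonglongrightarrow> ?k a s" using as by simp
        then show ?thesis using ev by (rule Lim_transform_eventually)
      qed
      from tendsto_norm[OF tendsto_diff[OF this tendsto_const[of "?k a s"]]]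
      have "(\<lambda>n. norm (?k (u n) s - ?k a s)) \<longlonglongrightarrow> 0" by simp
      from tendsto_ennrealI[OF this] show ?case by simp
    qed
  qed simp_all
  then have lim0: "(\<lambda>n. \<integral>\<^sup>+s. norm (?k (u n) s - ?k a s) \<partial>?M) \<longlonglongrightarrow> 0" by simp
  have "(\<lambda>n. ennreal (norm (convolution T f (u n) - convolution T f a))) \<longlonglongrightarrow> 0"
    by (rule tendsto_sandwich[OF _ always_eventually[OF allI[OF conv_dist]] tendsto_const lim0]) simp
  then have "(\<lambda>n. ennreal (norm (convolution T f (u n) - convolution T f a))) \<longlonglongrightarrow> ennreal 0" by simp
  then have "(\<lambda>n. norm (convolution T f (u n) - convolution T f a)) \<longlonglongrightarrow> 0"
    by (subst (asm) tendsto_ennreal_iff) auto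
  then show "(\<lambda>n. convolution T f (u n)) \<longlonglongrightarrow> convolution T f a"
    by (rule Lim_null[THEN iffD2, OF tendsto_norm_zero_cancel])
qed

text \<open>The gain \<open>1 / \<mu>\<close> is what makes the weighted integral operator a
  contraction.\<close>

lemma nn_integral_exp:
  fixes \<mu> :: real
  assumes "0 < \<mu>" "\<tau> \<le> T"
  shows "(\<integral>\<^sup>+s. ennreal (exp (\<mu> * (T - s))) \<partial>lebesgue_on {\<tau>..T}) \<le> ennreal (exp (\<mu> * (T - \<tau>)) / \<mu>)"
proof -
  have "(\<integral>\<^sup>+s. ennreal (exp (\<mu> * (T - s))) \<partial>lebesgue_on {\<tau>..T}) = (\<integral>\<^sup>+s. ennreal (exp (\<mu> * (T - s))) * indicator {\<tau>..T} s \<partial>lborel)"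
    by (subst nn_integral_restrict_space) (auto simp: nn_integral_completion)
  also have "\<dots> = ennreal (- exp (\<mu> * (T - T)) / \<mu> - - exp (\<mu> * (T - \<tau>)) / \<mu>)"
    using assms by (intro nn_integral_FTC_Icc) (auto intro!: derivative_eq_intros)
  also have "\<dots> \<le> ennreal (exp (\<mu> * (T - \<tau>)) / \<mu>)" using assms by (intro ennreal_leI) simp
  finally show ?thesis .
qed

text \<open>The backward Volterra equation is solved by a fixed point in the weight \<open>exp (\<mu> (T - t))\<close>,
  for which the integral operator is a contraction once \<open>\<mu>\<close> is large.\<close>

lemma volterra_solution:
  fixes Q :: "real \<Rightarrow> 'a \<Rightarrow>\<^sub>L 'a"
  assumes T: "0 \<le> T" and Q: "strongly_measurable (lebesgue_on {0..T}) Q" "AE s in lebesgue_on {0..T}. norm (Q s) \<le> c"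
  obtains \<phi> where "continuous_on {0..T} \<phi>"
    "\<And>t. t \<in> {0..T} \<Longrightarrow> has_banach_integral (lebesgue_on {t..T}) (\<lambda>s. G (s - t) (Q s (\<phi> s))) (\<phi> t - G (T - t) x0)"
proof -
  let ?M = "lebesgue_on {0..T}"
  obtain m where m: "1 \<le> m" "\<forall>t\<in>{0..T}. norm (G t) \<le> m" using bounded_on by metis
  define c' where "c' = max 0 c"
  have c': "0 \<le> c'" "AE s in ?M. norm (Q s) \<le> c'" using Q(2) by (auto simp: c'_def elim: eventually_mono)
  \<comment> \<open>Chosen so that \<open>m * c' / \<mu> \<le> 1/2\<close>; the summand 1 keeps it
    positive even for \<open>c' = 0\<close>.\<close>
  define \<mu> where "\<mu> = 2 * (m * c' + 1)"
  have mc: "0 \<le> m * c'" using m(1) c'(1) by simp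
  then have \<mu>: "0 < \<mu>" by (simp add: \<mu>_def)
  define E where "E s = exp (\<mu> * (T - s))" for s
  have E: "0 < E s" for s by (simp add: E_def)
  have E_cont: "continuous_on S E" for S unfolding E_def by (intro continuous_intros)
  \<comment> \<open>The fixed point variable is the solution divided by the weight \<open>E\<close>,
    which turns the weighted norm into the plain supremum norm.\<close>
  define h where "h \<phi> s = Q s (E s *\<^sub>R apply_bcontfun \<phi> s)" for \<phi> :: "real \<Rightarrow>\<^sub>C 'a" and s
  have h_meas: "strongly_measurable ?M (h \<phi>)" for \<phi>
    unfolding h_def[abs_def]
    by (intro strongly_measurable_blinfun_apply Q(1) strongly_measurable_continuous_on continuous_intros E_cont) simp
  have h_bound: "AE s in ?M. norm (h \<phi> s) \<le> c' * (E 0 * norm \<phi>)" for \<phi>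
    using c'(2) AE_space
  proof eventually_elim
    case (elim s)
    have "norm (h \<phi> s) \<le> norm (Q s) * norm (E s *\<^sub>R apply_bcontfun \<phi> s)" unfolding h_def by (rule norm_blinfun)
    also have "\<dots> \<le> c' * (E 0 * norm \<phi>)"
    proof (intro mult_mono)
      have "E s \<le> E 0" using elim \<mu> by (simp add: E_def)
      then have "E s * norm (apply_bcontfun \<phi> s) \<le> E 0 * norm \<phi>"
        using E[of 0] by (intro mult_mono norm_bounded) auto
      then show "norm (E s *\<^sub>R apply_bcontfun \<phi> s) \<le> E 0 * norm \<phi>" using E[of s] by simp
    qed (use elim c' in auto)
    finally show ?case .
  qed
  define \<Gamma> where "\<Gamma> \<phi> \<tau> = (1 / E \<tau>) *\<^sub>R (G (T - \<tau>) x0 + convolution T (h \<phi>) \<tau>)" for \<phi> \<tau>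
  have \<Gamma>_cont: "continuous_on {0..T} (\<Gamma> \<phi>)" for \<phi>
    unfolding \<Gamma>_def[abs_def]
    by (intro continuous_intros convolution_continuous[OF h_meas h_bound] continuous_on_compose E_cont)
      (use E in \<open>auto simp: less_imp_neq[symmetric] intro!: continuous_intros\<close>)
  \<comment> \<open>Clamping to the interval extends functions to the whole line, where the bounded
    continuous ones form a complete space for Banach's fixed point theorem.\<close>
  define \<kappa> where "\<kappa> t = max 0 (min T t)" for t
  have \<kappa>: "\<kappa> t \<in> {0..T}" for t using T by (auto simp: \<kappa>_def)
  have \<kappa>_id: "\<kappa> t = t" if "t \<in> {0..T}" for t using that by (auto simp: \<kappa>_def)
  define \<Phi> where "\<Phi> \<phi> = Bcontfun (\<lambda>t. \<Gamma> \<phi> (\<kappa> t))" for \<phi>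
  have \<Phi>_apply: "apply_bcontfun (\<Phi> \<phi>) t = \<Gamma> \<phi> (\<kappa> t)" for \<phi> t
  proof -
    obtain B where B: "\<And>t. t \<in> {0..T} \<Longrightarrow> norm (\<Gamma> \<phi> t) \<le> B"
      using continuous_on_interval_bounded[OF \<Gamma>_cont] by metis
    have "continuous_on UNIV (\<lambda>t. \<Gamma> \<phi> (\<kappa> t))"
      by (rule continuous_on_compose2[OF \<Gamma>_cont]) (use \<kappa> in \<open>auto simp: \<kappa>_def intro!: continuous_intros\<close>)
    then have "(\<lambda>t. \<Gamma> \<phi> (\<kappa> t)) \<in> bcontfun" by (rule bcontfun_normI) (rule B[OF \<kappa>])
    then show ?thesis by (simp add: \<Phi>_def Bcontfun_inverse)
  qed
  have contraction: "dist (\<Phi> \<phi>) (\<Phi> \<eta>) \<le> (1/2) * dist \<phi> \<eta>" for \<phi> \<eta>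
  proof (rule dist_bound)
    fix t
    let ?\<tau> = "\<kappa> t" and ?d = "dist \<phi> \<eta>"
    have \<tau>: "0 \<le> ?\<tau>" "?\<tau> \<le> T" using \<kappa>[of t] by auto
    have sub: "{?\<tau>..T} \<subseteq> {0..T}" using \<tau> by auto
    interpret J: finite_complete_measure "lebesgue_on {?\<tau>..T}" by (rule finite_complete_measure_interval)
    have hd_meas: "strongly_measurable ?M (\<lambda>s. h \<phi> s - h \<eta> s)" by (intro strongly_measurable_diff h_meas)
    have hd_bound: "AE s in ?M. norm (h \<phi> s - h \<eta> s) \<le> c' * (E s * ?d)"
      using c'(2)
    proof eventually_elim
      case (elim s)
      have "h \<phi> s - h \<eta> s = Q s (E s *\<^sub>R (apply_bcontfun \<phi> s - apply_bcontfun \<eta> s))"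
        by (simp add: h_def blinfun.diff_right scaleR_diff_right)
      then have "norm (h \<phi> s - h \<eta> s) \<le> norm (Q s) * (E s * dist (apply_bcontfun \<phi> s) (apply_bcontfun \<eta> s))"
        using norm_blinfun[of "Q s" "E s *\<^sub>R (apply_bcontfun \<phi> s - apply_bcontfun \<eta> s)"] E[of s]
        by (simp add: dist_norm)
      also have "\<dots> \<le> c' * (E s * ?d)"
        using elim c'(1) E[of s] by (intro mult_mono dist_bounded) auto
      finally show ?case .
    qed
    have hd_bound': "AE s in ?M. norm (h \<phi> s - h \<eta> s) \<le> c' * (E 0 * ?d)"
      using hd_bound AE_space
    proof eventually_elim
      case (elim s)
      have "E s \<le> E 0" using elim \<mu> by (simp add: E_def)
      then have "c' * (E s * ?d) \<le> c' * (E 0 * ?d)" using c' by (intro mult_left_mono mult_right_mono) auto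
      with elim show ?case by simp
    qed
    let ?x = "convolution T (\<lambda>s. h \<phi> s - h \<eta> s) ?\<tau>"
    have "ennreal (norm ?x) \<le> (\<integral>\<^sup>+s. norm (G (s - ?\<tau>) (h \<phi> s - h \<eta> s)) \<partial>lebesgue_on {?\<tau>..T})"
      by (rule J.has_banach_integral_norm_le[OF has_banach_integral_convolution_interval[OF hd_meas hd_bound' \<tau>]])
    also have "\<dots> \<le> (\<integral>\<^sup>+s. ennreal (m * c' * ?d) * ennreal (exp (\<mu> * (T - s))) \<partial>lebesgue_on {?\<tau>..T})"
    proof (rule nn_integral_mono_AE)
      show "AE s in lebesgue_on {?\<tau>..T}. ennreal (norm (G (s - ?\<tau>) (h \<phi> s - h \<eta> s))) \<le> ennreal (m * c' * ?d) * ennreal (exp (\<mu> * (T - s)))"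
        using AE_interval_subset[OF hd_bound sub] AE_space
      proof eventually_elim
        case (elim s)
        have "norm (G (s - ?\<tau>) (h \<phi> s - h \<eta> s)) \<le> norm (G (s - ?\<tau>)) * norm (h \<phi> s - h \<eta> s)" by (rule norm_blinfun)
        also have "\<dots> \<le> m * (c' * (E s * ?d))"
          using elim m(1) \<tau> by (intro mult_mono bspec[OF m(2)]) auto
        also have "\<dots> = (m * c' * ?d) * exp (\<mu> * (T - s))" by (simp add: E_def)
        finally show ?case using mc by (simp add: ennreal_leI flip: ennreal_mult)
      qed
    qed
    also have "\<dots> = ennreal (m * c' * ?d) * (\<integral>\<^sup>+s. ennreal (exp (\<mu> * (T - s))) \<partial>lebesgue_on {?\<tau>..T})"
    proof (rule nn_integral_cmult)
      have "continuous_on {?\<tau>..T} (\<lambda>s. exp (\<mu> * (T - s)))" by (intro continuous_intros)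
      then have "(\<lambda>s. exp (\<mu> * (T - s))) \<in> borel_measurable (lebesgue_on {?\<tau>..T})"
        by (intro continuous_imp_measurable_on_sets_lebesgue) auto
      then show "(\<lambda>s. ennreal (exp (\<mu> * (T - s)))) \<in> borel_measurable (lebesgue_on {?\<tau>..T})" by measurable
    qed
    also have "\<dots> \<le> ennreal (m * c' * ?d) * ennreal (E ?\<tau> / \<mu>)"
      unfolding E_def using nn_integral_exp[OF \<mu> \<tau>(2)] by (intro mult_left_mono) auto
    also have "\<dots> = ennreal (m * c' * ?d * (E ?\<tau> / \<mu>))"
      using mc by (subst ennreal_mult) (auto simp: E_def \<mu> less_imp_le)
    finally have x: "norm ?x \<le> m * c' * ?d * (E ?\<tau> / \<mu>)"
      using mc E[of ?\<tau>] \<mu> by (subst (asm) ennreal_le_iff) auto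
    have "dist (apply_bcontfun (\<Phi> \<phi>) t) (apply_bcontfun (\<Phi> \<eta>) t) = norm ((1 / E ?\<tau>) *\<^sub>R ?x)"
      unfolding \<Phi>_apply \<Gamma>_def dist_norm convolution_diff[OF h_meas h_bound h_meas h_bound \<tau>(1), symmetric]
      by (simp add: algebra_simps)
    also have "\<dots> = norm ?x / E ?\<tau>" using E[of ?\<tau>] by simp
    also have "\<dots> \<le> m * c' * ?d * (E ?\<tau> / \<mu>) / E ?\<tau>" using x E[of ?\<tau>] by (intro divide_right_mono) auto
    also have "\<dots> = (m * c' / \<mu>) * ?d" using E[of ?\<tau>] by simp
    also have "\<dots> \<le> (1/2) * ?d"
      using mc by (intro mult_right_mono) (auto simp: \<mu>_def divide_simps)
    finally show "dist (apply_bcontfun (\<Phi> \<phi>) t) (apply_bcontfun (\<Phi> \<eta>) t) \<le> (1/2) * ?d" .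
  qed
  obtain \<phi> where fp: "\<Phi> \<phi> = \<phi>"
    using banach_fix_type[of "1/2" \<Phi>] contraction by auto
  define y where "y t = E t *\<^sub>R apply_bcontfun \<phi> t" for t
  have h_eq: "h \<phi> s = Q s (y s)" for s by (simp add: h_def y_def)
  show thesis
  proof (rule that[of y])
    show "continuous_on {0..T} y" unfolding y_def[abs_def] by (intro continuous_intros E_cont) simp
    fix t assume t: "t \<in> {0..T}"
    have "apply_bcontfun \<phi> t = \<Gamma> \<phi> t" using \<Phi>_apply[of \<phi> t] fp \<kappa>_id[OF t] by simp
    then have "y t = G (T - t) x0 + convolution T (h \<phi>) t" using E[of t] by (simp add: y_def \<Gamma>_def)
    then have "convolution T (h \<phi>) t = y t - G (T - t) x0" by simp
    moreover have "has_banach_integral (lebesgue_on {t..T}) (\<lambda>s. G (s - t) (h \<phi> s)) (convolution T (h \<phi>) t)"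
      using t by (intro has_banach_integral_convolution_interval[OF h_meas h_bound]) auto
    ultimately show "has_banach_integral (lebesgue_on {t..T}) (\<lambda>s. G (s - t) (Q s (y s))) (y t - G (T - t) x0)"
      by (simp add: h_eq)
  qed
qed

end

section \<open>Evolution operators\<close>

lemma norm_adjoint_blinfun: "norm (adjoint_blinfun G) \<le> norm G"
  by (rule norm_blinfun_bound) (auto simp: norm_blinfun_compose mult.commute[of "norm G"])

lemma bounded_linear_adjoint_blinfun: "bounded_linear adjoint_blinfun"
proof (rule bounded_linear_intro[where K=1])
  show "adjoint_blinfun (G + H) = adjoint_blinfun G + adjoint_blinfun H" for G H :: "'a \<Rightarrow>\<^sub>L 'b"
    by (rule blinfun_eqI, rule blinfun_eqI) (simp add: blinfun.add_left blinfun.add_right)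
  show "adjoint_blinfun (r *\<^sub>R G) = r *\<^sub>R adjoint_blinfun G" for r and G :: "'a \<Rightarrow>\<^sub>L 'b"
    by (rule blinfun_eqI, rule blinfun_eqI) (simp add: blinfun.scaleR_left blinfun.scaleR_right)
qed (simp add: norm_adjoint_blinfun)

lemma strongly_measurable_adjoint_blinfun:
  "strongly_measurable M F \<Longrightarrow> strongly_measurable M (\<lambda>t. adjoint_blinfun (F t))"
  by (rule strongly_measurable_compose[where h=adjoint_blinfun])
    (auto intro: bounded_linear.continuous_on[OF bounded_linear_adjoint_blinfun] continuous_intros)

lemma strongly_measurable_blinfun_compose:
  "strongly_measurable M F \<Longrightarrow> strongly_measurable M G \<Longrightarrow> strongly_measurable M (\<lambda>t. F t o\<^sub>L G t)"
  by (rule strongly_measurable_compose2[where h="(o\<^sub>L)"])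
    (auto simp: case_prod_unfold intro!: bounded_bilinear.continuous_on[OF bounded_bilinear_blinfun_compose] continuous_intros)

lemma blinfun_compose_assoc: "(F o\<^sub>L G) o\<^sub>L H = F o\<^sub>L (G o\<^sub>L H)"
  by (rule blinfun_eqI) simp

lemma Lp_norm_cong:
  assumes "\<And>x. x \<in> space M \<Longrightarrow> f x = g x"
  shows "Lp_norm q M f = Lp_norm q M g"
proof -
  have "(AE x in M. norm (f x) \<le> c) \<longleftrightarrow> (AE x in M. norm (g x) \<le> c)" for c
    by (rule AE_cong) (simp add: assms)
  moreover have "(\<integral>\<^sup>+x. ennreal (norm (f x) powr enn2real q) \<partial>M) = (\<integral>\<^sup>+x. ennreal (norm (g x) powr enn2real q) \<partial>M)"
    by (rule nn_integral_cong) (simp add: assms)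
  ultimately show ?thesis by (simp add: Lp_norm_def)
qed

locale evolution_system = semigroup_generator D A G
  for D :: "'a::banach set" and A G +
  fixes F :: "real \<Rightarrow> 'a \<Rightarrow>\<^sub>L 'a" and S :: "real \<Rightarrow> real \<Rightarrow> 'a \<Rightarrow>\<^sub>L 'a" and T c :: real
  assumes T: "0 \<le> T"
    and F_meas: "strongly_measurable (lebesgue_on {0..T}) F"
    and F_bound: "AE t in lebesgue_on {0..T}. norm (F t) \<le> c"
    and S_continuous: "\<And>y. continuous_on {(t, s). 0 \<le> s \<and> s \<le> t \<and> t \<le> T} (\<lambda>(t, s). S t s y)"
    and S_duhamel: "\<And>s t y. 0 \<le> s \<Longrightarrow> s \<le> t \<Longrightarrow> t \<le> T \<Longrightarrow>
      has_banach_integral (lebesgue_on {s..t}) (\<lambda>r. G (t - r) (F r (S r s y))) (S t s y - G (t - s) y)"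
begin

text \<open>Orbits are bounded on the compact triangle of times, so uniform boundedness applies with
  pairs of times as the index.\<close>

lemma S_bounded:
  obtains m where "0 < m" "\<And>s t. 0 \<le> s \<Longrightarrow> s \<le> t \<Longrightarrow> t \<le> T \<Longrightarrow> norm (S t s) \<le> m"
proof -
  let ?I = "{(t, s). 0 \<le> s \<and> s \<le> t \<and> t \<le> T}"
  have "compact ?I"
  proof -
    have "?I = ({0..T} \<times> {0..T}) \<inter> {p. snd p \<le> fst p}" by auto
    moreover have "closed {p :: real \<times> real. snd p \<le> fst p}" by (intro closed_Collect_le continuous_intros)
    ultimately show ?thesis by (simp add: compact_Int_closed compact_Times)
  qed
  then have bdd: "bounded ((\<lambda>(t, s). S t s y) ` ?I)" for y
    by (intro compact_imp_bounded compact_continuous_image S_continuous)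
  obtain m where m: "0 < m" "\<And>i. i \<in> ?I \<Longrightarrow> norm (case i of (t, s) \<Rightarrow> S t s) \<le> m"
  proof (rule uniform_boundedness[of ?I "\<lambda>(t, s). S t s"])
    fix y
    obtain b where "\<forall>x\<in>(\<lambda>(t, s). S t s y) ` ?I. norm x \<le> b" using bdd[of y] unfolding bounded_iff by blast
    then show "\<exists>b. \<forall>i\<in>?I. norm ((case i of (t, s) \<Rightarrow> S t s) y) \<le> b" by (intro exI[of _ b]) auto
  qed blast
  have "norm (S t s) \<le> m" if "0 \<le> s" "s \<le> t" "t \<le> T" for s t using m(2)[of "(t, s)"] that by simp
  with m(1) show thesis by (rule that)
qed

lemma S_continuous_fst:
  assumes "0 \<le> s"
  shows "continuous_on {s..T} (\<lambda>r. S r s y)"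
proof -
  have "continuous_on {s..T} (\<lambda>r. (r, s))" by (intro continuous_intros)
  moreover have "(\<lambda>r. (r, s)) ` {s..T} \<subseteq> {(t, s). 0 \<le> s \<and> s \<le> t \<and> t \<le> T}" using assms by auto
  ultimately have "continuous_on {s..T} (\<lambda>r. case (r, s) of (t, s) \<Rightarrow> S t s y)"
    by (rule continuous_on_compose2[OF S_continuous])
  then show ?thesis by simp
qed

lemma S_continuous_snd:
  assumes "t \<le> T"
  shows "continuous_on {0..t} (\<lambda>s. S t s y)"
proof -
  have "continuous_on {0..t} (\<lambda>s. (t, s))" by (intro continuous_intros)
  moreover have "(\<lambda>s. (t, s)) ` {0..t} \<subseteq> {(t, s). 0 \<le> s \<and> s \<le> t \<and> t \<le> T}" using assms by auto
  ultimately have "continuous_on {0..t} (\<lambda>s. case (t, s) of (t, s) \<Rightarrow> S t s y)"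
    by (rule continuous_on_compose2[OF S_continuous])
  then show ?thesis by simp
qed

lemma S_duhamel_functional:
  fixes \<psi> :: "'a \<Rightarrow>\<^sub>L real"
  assumes "0 \<le> s" "s \<le> t" "t \<le> T"
  shows "(\<integral>r. blinfun_apply \<psi> (G (t - r) (F r (S r s y))) \<partial>lebesgue_on {s..t}) = blinfun_apply \<psi> (S t s y) - blinfun_apply \<psi> (G (t - s) y)"
proof -
  interpret I: finite_complete_measure "lebesgue_on {s..t}" by (rule finite_complete_measure_interval)
  show ?thesis
    using has_bochner_integral_integral_eq[OF I.has_banach_integral_functional[OF S_duhamel[OF assms], of \<psi>]]
    by (simp add: blinfun.diff_right)
qed

text \<open>The Duhamel formulas for \<open>S\<close> and for \<open>\<phi>\<close> are combined by a single exchange of integrals, which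
  makes Gronwall's inequality unnecessary for the uniqueness of \<open>\<phi>\<close>.\<close>

theorem mild_backward_solution_eq:
  assumes sol: "mild_backward_solution (adjoint_domain D A) (adjoint_op D A) (\<lambda>t. adjoint_blinfun (F t)) T \<phi>T \<phi>"
    and s: "s \<in> {0..T}"
  shows "\<phi> s = \<phi>T o\<^sub>L S T s"
proof (rule blinfun_eqI)
  fix y
  obtain G' where \<phi>_cont: "continuous_on {0..T} \<phi>"
    and G': "generates_C0_semigroup (adjoint_domain D A) (adjoint_op D A) G'"
    and int: "\<And>t. t \<in> {0..T} \<Longrightarrow> has_banach_integral (lebesgue_on {t..T})
      (\<lambda>r. G' (r - t) (adjoint_blinfun (F r) (\<phi> r))) (\<phi> t - G' (T - t) \<phi>T)"
    using sol unfolding mild_backward_solution_def by blast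
  define g where "g r = \<phi> r o\<^sub>L F r" for r
  define h where "h q = F q (S q s y)" for q
  \<comment> \<open>Evaluation at \<open>x\<close>, a functional on the dual space, makes the
    backward equation scalar and moves the adjoint semigroup onto \<open>x\<close>. It is used at
    \<open>q\<close> inside the double integral and at \<open>s\<close> in the end.\<close>
  have dual: "(\<integral>r. blinfun_apply (g r) (G (r - t) x) \<partial>lebesgue_on {t..T}) = blinfun_apply (\<phi> t) x - blinfun_apply \<phi>T (G (T - t) x)"
    if t: "t \<in> {0..T}" for t x
  proof -
    interpret I: finite_complete_measure "lebesgue_on {t..T}" by (rule finite_complete_measure_interval)
    have "(\<integral>r. blinfun_apply (bidual_embedding x) (G' (r - t) (adjoint_blinfun (F r) (\<phi> r))) \<partial>lebesgue_on {t..T}) =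
        blinfun_apply (bidual_embedding x) (\<phi> t - G' (T - t) \<phi>T)"
      by (rule has_bochner_integral_integral_eq[OF I.has_banach_integral_functional[OF int[OF t]]])
    moreover have "blinfun_apply (bidual_embedding x) (G' (r - t) (adjoint_blinfun (F r) (\<phi> r))) = g r (G (r - t) x)"
      if "r \<in> space (lebesgue_on {t..T})" for r
      using that adjoint_semigroup_unique[OF G', of "r - t"] by (simp add: g_def)
    then have "(\<integral>r. blinfun_apply (bidual_embedding x) (G' (r - t) (adjoint_blinfun (F r) (\<phi> r))) \<partial>lebesgue_on {t..T}) =
        (\<integral>r. blinfun_apply (g r) (G (r - t) x) \<partial>lebesgue_on {t..T})"
      by (intro Bochner_Integration.integral_cong refl)
    moreover have "blinfun_apply (bidual_embedding x) (\<phi> t - G' (T - t) \<phi>T) = \<phi> t x - \<phi>T (G (T - t) x)"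
      using t adjoint_semigroup_unique[OF G', of "T - t"] by (simp add: blinfun.diff_left)
    ultimately show ?thesis by simp
  qed
  let ?M = "lebesgue_on {s..T}"
  interpret M: finite_complete_measure ?M by (rule finite_complete_measure_interval)
  have sub: "{s..T} \<subseteq> {0..T}" using s by auto
  obtain \<beta> where \<beta>: "0 \<le> \<beta>" "\<And>t. t \<in> {0..T} \<Longrightarrow> norm (\<phi> t) \<le> \<beta>"
    using continuous_on_interval_bounded[OF \<phi>_cont] by metis
  obtain \<gamma> where \<gamma>: "0 \<le> \<gamma>" "\<And>t. t \<in> {s..T} \<Longrightarrow> norm (S t s y) \<le> \<gamma>"
    using continuous_on_interval_bounded[OF S_continuous_fst[of s y]] s by auto
  obtain m where m: "1 \<le> m" "\<And>t. t \<in> {0..T} \<Longrightarrow> norm (G t) \<le> m" using bounded_on by metis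
  have F': "strongly_measurable ?M F" "AE t in ?M. norm (F t) \<le> max 0 c"
    using strongly_measurable_interval_subset[OF F_meas sub] AE_interval_subset[OF F_bound sub]
    by (auto elim: eventually_mono)
  have \<phi>': "strongly_measurable ?M \<phi>"
    by (rule strongly_measurable_continuous_on[OF continuous_on_subset[OF \<phi>_cont sub]])
  have S': "strongly_measurable ?M (\<lambda>q. S q s y)"
    using s by (intro strongly_measurable_continuous_on S_continuous_fst) auto
  have g_meas: "strongly_measurable ?M g"
    unfolding g_def[abs_def] by (rule strongly_measurable_blinfun_compose[OF \<phi>' F'(1)])
  have g_bound: "AE r in ?M. norm (g r) \<le> \<beta> * max 0 c"
    using F'(2) AE_space
  proof eventually_elim
    case (elim r)
    have "norm (g r) \<le> norm (\<phi> r) * norm (F r)" unfolding g_def by (rule norm_blinfun_compose)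
    also have "\<dots> \<le> \<beta> * max 0 c" using elim \<beta> s by (intro mult_mono) auto
    finally show ?case .
  qed
  have h_meas: "strongly_measurable ?M h"
    unfolding h_def[abs_def] by (rule strongly_measurable_blinfun_apply[OF F'(1) S'])
  have h_bound: "AE q in ?M. norm (h q) \<le> max 0 c * \<gamma>"
    using F'(2) AE_space
  proof eventually_elim
    case (elim q)
    have "norm (h q) \<le> norm (F q) * norm (S q s y)" unfolding h_def by (rule norm_blinfun)
    also have "\<dots> \<le> max 0 c * \<gamma>" using elim \<gamma> by (intro mult_mono) auto
    finally show ?case .
  qed
  \<comment> \<open>The double integral pairs backward data \<open>g\<close> with forward data
    \<open>h\<close>. With \<open>q\<close> inside, the Duhamel formula for \<open>S\<close>
    evaluates it; with \<open>r\<close> inside, the backward equation does.\<close>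
  have fubini: "(\<integral>r. (\<integral>q. g r (G (r - q) (h q)) \<partial>lebesgue_on {s..r}) \<partial>?M) =
      (\<integral>q. (\<integral>r. g r (G (r - q) (h q)) \<partial>lebesgue_on {q..T}) \<partial>?M)"
    using s by (intro fubini_triangle[OF g_meas g_bound h_meas h_bound continuous m(2)]) auto
  have apply_integrable: "integrable ?M (\<lambda>r. blinfun_apply (\<alpha> r) (v r))"
    if \<alpha>: "strongly_measurable ?M \<alpha>" "AE r in ?M. norm (\<alpha> r) \<le> b"
      and v: "strongly_measurable ?M v" "AE r in ?M. norm (v r) \<le> d" for \<alpha> :: "real \<Rightarrow> 'a \<Rightarrow>\<^sub>L real" and v b d
  proof (rule M.integrable_strongly_measurable_bounded)
    show "strongly_measurable ?M (\<lambda>r. blinfun_apply (\<alpha> r) (v r))"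
      by (rule strongly_measurable_blinfun_apply[OF \<alpha>(1) v(1)])
    show "AE r in ?M. \<bar>blinfun_apply (\<alpha> r) (v r)\<bar> \<le> b * d"
      using \<alpha>(2) v(2)
    proof eventually_elim
      case (elim r)
      have "\<bar>blinfun_apply (\<alpha> r) (v r)\<bar> \<le> norm (\<alpha> r) * norm (v r)" using norm_blinfun[of "\<alpha> r" "v r"] by simp
      also have "\<dots> \<le> b * d" by (rule mult_mono[OF elim order_trans[OF norm_ge_zero elim(1)] norm_ge_zero])
      finally show ?case .
    qed
  qed
  have G_bound: "norm (G t x) \<le> m * norm x" if "t \<in> {0..T}" for t x
    using norm_blinfun[of "G t" x] mult_right_mono[OF m(2)[OF that] norm_ge_zero[of x]] by simp
  have int_gS: "integrable ?M (\<lambda>r. g r (S r s y))"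
    by (rule apply_integrable[OF g_meas g_bound S', of \<gamma>]) (rule AE_I2, simp add: \<gamma>)
  have int_gG: "integrable ?M (\<lambda>r. g r (G (r - s) y))"
  proof (rule apply_integrable[OF g_meas g_bound, of _ "m * norm y"])
    show "strongly_measurable ?M (\<lambda>r. G (r - s) y)"
      by (intro strongly_measurable_continuous_on continuous_on_compose continuous_intros) auto
  qed (rule AE_I2, use s in \<open>auto intro!: G_bound\<close>)
  have int_\<phi>h: "integrable ?M (\<lambda>q. \<phi> q (h q))"
    by (rule apply_integrable[OF \<phi>' _ h_meas h_bound, of \<beta>]) (rule AE_I2, use s in \<open>auto intro!: \<beta>(2)\<close>)
  have int_Gh: "integrable ?M (\<lambda>q. \<phi>T (G (T - q) (h q)))"
  proof (rule apply_integrable[of "\<lambda>_. \<phi>T" "norm \<phi>T" _ "m * (max 0 c * \<gamma>)"])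
    have "strongly_measurable ?M (\<lambda>q. G (T - q) x)" for x
      by (intro strongly_measurable_continuous_on continuous_on_compose continuous_intros) auto
    from strongly_measurable_operator_family[OF this h_meas]
    show "strongly_measurable ?M (\<lambda>q. G (T - q) (h q))" .
    show "AE q in ?M. norm (G (T - q) (h q)) \<le> m * (max 0 c * \<gamma>)"
      using h_bound AE_space
    proof eventually_elim
      case (elim q)
      have "norm (G (T - q) (h q)) \<le> m * norm (h q)" using elim s by (intro G_bound) auto
      also have "\<dots> \<le> m * (max 0 c * \<gamma>)" using elim m(1) by (intro mult_left_mono) auto
      finally show ?case .
    qed
  qed auto
  have "(\<integral>r. (\<integral>q. g r (G (r - q) (h q)) \<partial>lebesgue_on {s..r}) \<partial>?M) = (\<integral>r. g r (S r s y) - g r (G (r - s) y) \<partial>?M)"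
  proof (rule Bochner_Integration.integral_cong[OF refl])
    fix r assume "r \<in> space ?M"
    then show "(\<integral>q. g r (G (r - q) (h q)) \<partial>lebesgue_on {s..r}) = g r (S r s y) - g r (G (r - s) y)"
      unfolding h_def using s by (intro S_duhamel_functional) auto
  qed
  also have "\<dots> = (\<integral>r. g r (S r s y) \<partial>?M) - (\<integral>r. g r (G (r - s) y) \<partial>?M)"
    by (rule Bochner_Integration.integral_diff[OF int_gS int_gG])
  also have "(\<integral>r. g r (S r s y) \<partial>?M) = (\<integral>q. \<phi> q (h q) \<partial>?M)" by (simp add: g_def h_def)
  finally have lhs: "(\<integral>r. (\<integral>q. g r (G (r - q) (h q)) \<partial>lebesgue_on {s..r}) \<partial>?M) =
      (\<integral>q. \<phi> q (h q) \<partial>?M) - (\<integral>r. g r (G (r - s) y) \<partial>?M)" .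
  have "(\<integral>q. (\<integral>r. g r (G (r - q) (h q)) \<partial>lebesgue_on {q..T}) \<partial>?M) = (\<integral>q. \<phi> q (h q) - \<phi>T (G (T - q) (h q)) \<partial>?M)"
  proof (rule Bochner_Integration.integral_cong[OF refl])
    fix q assume "q \<in> space ?M"
    then show "(\<integral>r. g r (G (r - q) (h q)) \<partial>lebesgue_on {q..T}) = \<phi> q (h q) - \<phi>T (G (T - q) (h q))"
      using s by (intro dual) auto
  qed
  also have "\<dots> = (\<integral>q. \<phi> q (h q) \<partial>?M) - (\<integral>q. \<phi>T (G (T - q) (h q)) \<partial>?M)"
    by (rule Bochner_Integration.integral_diff[OF int_\<phi>h int_Gh])
  \<comment> \<open>The integral of \<open>\<phi> q (h q)\<close> occurs on both sides and
    cancels.\<close>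
  finally have "(\<integral>r. g r (G (r - s) y) \<partial>?M) = (\<integral>q. \<phi>T (G (T - q) (h q)) \<partial>?M)"
    using fubini lhs by linarith
  also have "\<dots> = \<phi>T (S T s y) - \<phi>T (G (T - s) y)"
    unfolding h_def using s by (intro S_duhamel_functional) auto
  finally show "\<phi> s y = (\<phi>T o\<^sub>L S T s) y" using dual[OF s, of y] by simp
qed

text \<open>The Volterra equation is solved with the adjoint semigroup, which is strongly continuous
  by reflexivity. Existence keeps the observability estimate, a statement about all solutions, from
  being vacuous.\<close>

theorem mild_backward_solution_exists:
  assumes refl: "reflexive_space TYPE('a)"
  shows "\<exists>\<phi>. mild_backward_solution (adjoint_domain D A) (adjoint_op D A) (\<lambda>t. adjoint_blinfun (F t)) T \<phi>T \<phi>"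
proof -
  interpret H: semigroup_generator "adjoint_domain D A" "adjoint_op D A" "\<lambda>t. adjoint_blinfun (G t)"
    by unfold_locales (rule adjoint_generates[OF refl])
  have bound: "AE t in lebesgue_on {0..T}. norm (adjoint_blinfun (F t)) \<le> c"
    using F_bound by eventually_elim (rule order_trans[OF norm_adjoint_blinfun])
  show ?thesis
  proof (rule H.volterra_solution[OF T strongly_measurable_adjoint_blinfun[OF F_meas] bound, of \<phi>T])
    fix \<phi>
    assume "continuous_on {0..T} \<phi>" "\<And>t. t \<in> {0..T} \<Longrightarrow> has_banach_integral (lebesgue_on {t..T})
      (\<lambda>s. adjoint_blinfun (G (s - t)) (adjoint_blinfun (F s) (\<phi> s))) (\<phi> t - adjoint_blinfun (G (T - t)) \<phi>T)"
    then have "mild_backward_solution (adjoint_domain D A) (adjoint_op D A) (\<lambda>t. adjoint_blinfun (F t)) T \<phi>T \<phi>"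
      unfolding mild_backward_solution_def by (intro conjI exI[of _ "\<lambda>t. adjoint_blinfun (G t)"] ballI H.gen)
    then show ?thesis by (rule exI[of _ \<phi>])
  qed
qed

text \<open>Strong continuity of \<open>S\<close> alone gives only weak-star continuity; norm
  continuity is that of the backward solution with which the curve coincides.\<close>

lemma dual_trajectory_continuous:
  fixes \<psi> :: "'a \<Rightarrow>\<^sub>L real"
  assumes refl: "reflexive_space TYPE('a)"
  shows "continuous_on {0..T} (\<lambda>s. \<psi> o\<^sub>L S T s)"
proof -
  obtain \<phi> where \<phi>: "mild_backward_solution (adjoint_domain D A) (adjoint_op D A) (\<lambda>t. adjoint_blinfun (F t)) T \<psi> \<phi>"
    using mild_backward_solution_exists[OF refl] by blast
  then have "continuous_on {0..T} \<phi>" by (simp add: mild_backward_solution_def)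
  then show ?thesis by (rule continuous_on_eq) (rule mild_backward_solution_eq[OF \<phi>])
qed

end

text \<open>Both sides translate into statements about one operator: its range is the reachable set,
  and the observation of the backward solution from \<psi> is \<psi> composed with its
  integrand.\<close>

theorem theorem3p2:
  fixes T :: real and p :: ennreal
    and D :: "'y::banach set" and A :: "'y \<Rightarrow> 'y"
    and G :: "real \<Rightarrow> 'y \<Rightarrow>\<^sub>L 'y"
    and F :: "real \<Rightarrow> 'y \<Rightarrow>\<^sub>L 'y"
    and B :: "real \<Rightarrow> 'u::banach \<Rightarrow>\<^sub>L 'y"
    and S :: "real \<Rightarrow> real \<Rightarrow> 'y \<Rightarrow>\<^sub>L 'y"
  assumes "0 < T"
    and "reflexive_space TYPE('y)"
    and "reflexive_space TYPE('u)"
    and "1 < p"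
    and "generates_C0_semigroup D A G"
    and "F \<in> Lp_space \<infinity> (lebesgue_on {0..T})"
    and "B \<in> Lp_space \<infinity> (lebesgue_on {0..T})"
    and "generates_evolution_op D A F T S"
  shows "finite_codim_exactly_controllable S B p T \<longleftrightarrow>
    (\<exists>(Yt :: ('y \<Rightarrow>\<^sub>L real) set) (C::real). finite_codim Yt \<and> C > 0 \<and>
       (\<forall>\<phi>T\<in>Yt. \<forall>\<phi>.
          mild_backward_solution (adjoint_domain D A) (adjoint_op D A)
            (\<lambda>t. adjoint_blinfun (F t)) T \<phi>T \<phi> \<longrightarrow>
          norm \<phi>T \<le> C * Lp_norm (conjugate_exponent p) (lebesgue_on {0..T})
            (\<lambda>t. blinfun_apply (adjoint_blinfun (B t)) (\<phi> t))))"
proof -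
  let ?M = "lebesgue_on {0..T}"
  let ?sol = "mild_backward_solution (adjoint_domain D A) (adjoint_op D A) (\<lambda>t. adjoint_blinfun (F t)) T"
  interpret M: finite_complete_measure ?M by (rule finite_complete_measure_interval)
  obtain c where F: "strongly_measurable ?M F" "AE t in ?M. norm (F t) \<le> c"
    using assms(6) by (auto simp: Lp_space_def)
  obtain b where B: "strongly_measurable ?M B" "AE t in ?M. norm (B t) \<le> b"
    using assms(7) by (auto simp: Lp_space_def)
  obtain G0 where G0: "generates_C0_semigroup D A G0"
    and duhamel: "\<forall>s t y. 0 \<le> s \<and> s \<le> t \<and> t \<le> T \<longrightarrow>
           has_banach_integral (lebesgue_on {s..t})
             (\<lambda>r. blinfun_apply (G0 (t - r)) (blinfun_apply (F r) (blinfun_apply (S r s) y)))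
             (blinfun_apply (S t s) y - blinfun_apply (G0 (t - s)) y)"
    using assms(8) unfolding generates_evolution_op_def by blast
  interpret E: evolution_system D A G0 F S T c
    using G0 duhamel F assms(1,8) by unfold_locales (auto simp: generates_evolution_op_def)
  obtain m where m: "0 < m" "\<And>s t. 0 \<le> s \<Longrightarrow> s \<le> t \<Longrightarrow> t \<le> T \<Longrightarrow> norm (S t s) \<le> m"
    using E.S_bounded by metis
  define k where "k = m * max 0 b"
  have k: "0 \<le> k" using m(1) by (simp add: k_def)
  \<comment> \<open>One null set serves all \<open>t\<close> at once, since a mild solution is an
    integral over every \<open>{0..t}\<close>.\<close>
  have SB_bound: "AE s in ?M. \<forall>t\<in>{s..T}. norm (S t s o\<^sub>L B s) \<le> k"
    using B(2) AE_space
  proof eventually_elim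
    case (elim s)
    show ?case
    proof
      fix t assume "t \<in> {s..T}"
      then have "norm (S t s) * norm (B s) \<le> k"
        unfolding k_def using elim m by (intro mult_mono) auto
      then show "norm (S t s o\<^sub>L B s) \<le> k" by (rule order_trans[OF norm_blinfun_compose])
    qed
  qed
  have SB_meas: "strongly_measurable (lebesgue_on {0..t}) (\<lambda>s. S t s (B s (u s)))"
    if u: "strongly_measurable ?M u" and t: "t \<in> {0..T}" for u t
  proof (rule strongly_measurable_operator_family)
    have sub: "{0..t} \<subseteq> {0..T}" using t by auto
    show "strongly_measurable (lebesgue_on {0..t}) (\<lambda>s. B s (u s))"
      by (rule strongly_measurable_interval_subset[OF strongly_measurable_blinfun_apply[OF B(1) u] sub])
    show "strongly_measurable (lebesgue_on {0..t}) (\<lambda>s. S t s y)" for y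
      using t by (intro strongly_measurable_continuous_on E.S_continuous_snd) simp
  qed
  interpret K: control_operator ?M p "\<lambda>s. S T s o\<^sub>L B s" k
  proof unfold_locales
    show "AE s in ?M. norm (S T s o\<^sub>L B s) \<le> k"
      using SB_bound AE_space by eventually_elim simp
    show "strongly_measurable ?M (\<lambda>s. (S T s o\<^sub>L B s) (u s))" if "strongly_measurable ?M u" for u
      using SB_meas[OF that, of T] assms(1) by simp
    \<comment> \<open>Norm continuity of the dual trajectory enters here, regrouped so that it is
      composed with the strongly measurable \<open>B\<close>.\<close>
    show "strongly_measurable ?M (\<lambda>s. \<psi> o\<^sub>L (S T s o\<^sub>L B s))" for \<psi> :: "'y \<Rightarrow>\<^sub>L real"
      using strongly_measurable_blinfun_compose[OF
          strongly_measurable_continuous_on[OF E.dual_trajectory_continuous[OF assms(2), of \<psi>]] B(1)]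
      by (simp add: blinfun_compose_assoc)
  qed (use assms k in auto)
  have "reachable_set S B p T = K.L ` Lp_space p ?M"
  proof (intro equalityI subsetI)
    fix x assume "x \<in> reachable_set S B p T"
    then obtain y u where u: "u \<in> Lp_space p ?M" "mild_control_solution S B T u y" and x: "x = y T"
      by (auto simp: reachable_set_def)
    then have "has_banach_integral ?M (\<lambda>s. S T s (B s (u s))) (y T)"
      using assms(1) by (simp add: mild_control_solution_def)
    then have "K.L u = y T" by (simp add: K.L_def M.banach_integral_eq)
    then have "x = K.L u" using x by simp
    then show "x \<in> K.L ` Lp_space p ?M" using u(1) by (rule image_eqI)
  next
    fix x assume "x \<in> K.L ` Lp_space p ?M"
    then obtain u where u: "u \<in> Lp_space p ?M" and x: "x = K.L u" by blast
    have u1: "strongly_measurable ?M u" "(\<integral>\<^sup>+s. norm (u s) \<partial>?M) < \<infinity>"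
      using K.Lp_space_L1[OF u] by (auto simp: K.L1_def)
    \<comment> \<open>Reachability asks for a trajectory on the whole interval, not only for its
      final value.\<close>
    define y where "y t = banach_integral (lebesgue_on {0..t}) (\<lambda>s. S t s (B s (u s)))" for t
    have "has_banach_integral (lebesgue_on {0..t}) (\<lambda>s. S t s (B s (u s))) (y t)" if t: "t \<in> {0..T}" for t
    proof -
      interpret I: finite_complete_measure "lebesgue_on {0..t}" by (rule finite_complete_measure_interval)
      have sub: "{0..t} \<subseteq> {0..T}" using t by auto
      have "(\<integral>\<^sup>+s. norm (S t s (B s (u s))) \<partial>lebesgue_on {0..t}) \<le> (\<integral>\<^sup>+s. ennreal k * norm (u s) \<partial>lebesgue_on {0..t})"
      proof (rule nn_integral_mono_AE)
        show "AE s in lebesgue_on {0..t}. ennreal (norm (S t s (B s (u s)))) \<le> ennreal k * ennreal (norm (u s))"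
          using AE_interval_subset[OF SB_bound sub] AE_space
        proof eventually_elim
          case (elim s)
          have "norm ((S t s o\<^sub>L B s) (u s)) \<le> norm (S t s o\<^sub>L B s) * norm (u s)" by (rule norm_blinfun)
          also have "\<dots> \<le> k * norm (u s)" using elim t by (intro mult_right_mono) auto
          finally show ?case using k by (simp add: ennreal_leI flip: ennreal_mult)
        qed
      qed
      also have "\<dots> = (\<integral>\<^sup>+s. ennreal k * norm (u s) * indicator {0..t} s \<partial>?M)"
        unfolding lebesgue_on_restrict[OF sub]
        by (rule nn_integral_restrict_space)
          (use interval_in_sets_lebesgue_on[OF sub] in \<open>simp only: space_lebesgue_on Int_absorb2[OF sub]\<close>)
      also have "\<dots> \<le> (\<integral>\<^sup>+s. ennreal k * norm (u s) \<partial>?M)"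
        by (intro nn_integral_mono) (simp add: indicator_def)
      also have "\<dots> = ennreal k * (\<integral>\<^sup>+s. norm (u s) \<partial>?M)"
        by (rule nn_integral_cmult[OF measurable_compose[OF M.norm_strongly_measurable[OF u1(1)] measurable_ennreal]])
      also have "\<dots> < \<infinity>" using u1(2) by (simp add: ennreal_mult_less_top)
      finally show ?thesis
        unfolding y_def by (intro I.has_banach_integral_banach_integral SB_meas[OF u1(1) t])
    qed
    then have "mild_control_solution S B T u y" by (simp add: mild_control_solution_def)
    moreover have "y T = x" by (simp add: y_def x K.L_def)
    ultimately show "x \<in> reachable_set S B p T" using u by (auto simp: reachable_set_def)
  qed
  then have controllable: "finite_codim_exactly_controllable S B p T \<longleftrightarrow> finite_codim (K.L ` Lp_space p ?M)"
    by (simp add: finite_codim_exactly_controllable_def)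
  have observation: "Lp_norm (conjugate_exponent p) ?M (\<lambda>t. blinfun_apply (adjoint_blinfun (B t)) (\<phi> t)) =
      Lp_norm (conjugate_exponent p) ?M (\<lambda>s. \<psi> o\<^sub>L (S T s o\<^sub>L B s))" if "?sol \<psi> \<phi>" for \<psi> \<phi>
    by (rule Lp_norm_cong) (simp add: E.mild_backward_solution_eq[OF that] blinfun_compose_assoc)
  show ?thesis
    unfolding controllable
  proof
    assume fc: "finite_codim (K.L ` Lp_space p ?M)"
    show "\<exists>(Yt :: ('y \<Rightarrow>\<^sub>L real) set) (C::real). finite_codim Yt \<and> C > 0 \<and>
       (\<forall>\<phi>T\<in>Yt. \<forall>\<phi>. ?sol \<phi>T \<phi> \<longrightarrow>
          norm \<phi>T \<le> C * Lp_norm (conjugate_exponent p) ?M (\<lambda>t. blinfun_apply (adjoint_blinfun (B t)) (\<phi> t)))"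
    proof (rule K.finite_codim_range_imp_estimate[OF fc])
      fix Yt :: "('y \<Rightarrow>\<^sub>L real) set" and C :: real
      assume Yt: "finite_codim Yt" "0 < C"
        and est: "\<And>\<psi>. \<psi> \<in> Yt \<Longrightarrow> norm \<psi> \<le> C * Lp_norm (conjugate_exponent p) ?M (\<lambda>s. \<psi> o\<^sub>L (S T s o\<^sub>L B s))"
      show ?thesis
      proof (intro exI[of _ Yt] exI[of _ C] conjI ballI allI impI Yt)
        fix \<psi> \<phi> assume \<psi>: "\<psi> \<in> Yt" and \<phi>: "?sol \<psi> \<phi>"
        show "norm \<psi> \<le> C * Lp_norm (conjugate_exponent p) ?M (\<lambda>t. blinfun_apply (adjoint_blinfun (B t)) (\<phi> t))"
          unfolding observation[OF \<phi>] by (rule est[OF \<psi>])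
      qed
    qed
  next
    assume "\<exists>(Yt :: ('y \<Rightarrow>\<^sub>L real) set) (C::real). finite_codim Yt \<and> C > 0 \<and>
       (\<forall>\<phi>T\<in>Yt. \<forall>\<phi>. ?sol \<phi>T \<phi> \<longrightarrow>
          norm \<phi>T \<le> C * Lp_norm (conjugate_exponent p) ?M (\<lambda>t. blinfun_apply (adjoint_blinfun (B t)) (\<phi> t)))"
    then obtain Yt :: "('y \<Rightarrow>\<^sub>L real) set" and C where Yt: "finite_codim Yt" "0 < C"
      and est: "\<And>\<psi> \<phi>. \<psi> \<in> Yt \<Longrightarrow> ?sol \<psi> \<phi> \<Longrightarrow>
          norm \<psi> \<le> C * Lp_norm (conjugate_exponent p) ?M (\<lambda>t. blinfun_apply (adjoint_blinfun (B t)) (\<phi> t))"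
      by blast
    show "finite_codim (K.L ` Lp_space p ?M)"
    proof (rule K.estimate_imp_finite_codim_range[OF assms(2) Yt])
      fix \<psi> assume \<psi>: "\<psi> \<in> Yt"
      \<comment> \<open>The estimate speaks about solutions only, so one has to be produced before
        it says anything about \<psi>.\<close>
      obtain \<phi> where \<phi>: "?sol \<psi> \<phi>" using E.mild_backward_solution_exists[OF assms(2)] by blast
      show "norm \<psi> \<le> C * Lp_norm (conjugate_exponent p) ?M (\<lambda>s. \<psi> o\<^sub>L (S T s o\<^sub>L B s))"
        using est[OF \<psi> \<phi>] unfolding observation[OF \<phi>] .
    qed
  qed
qed

end
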